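(* Let $A=A_S$ be a non-cyclic irreducible Artin-Tits group of spherical type. Then the additional length graph $\mathcal C_{AL}(A)$ and the Cayley graph $\Gamma(A,X_{abs}^A)$ are quasi-isometric.
   Context: Let $S$ be a finite set and $M=(m_{s,t})_{s,t\in S}$ a symmetric matrix with $m_{s,s}=1$ and $m_{s,t}\in\{2,3,\dots\}\cup\{\infty\}$ for $s\neq t$. The Artin-Tits group $A_S$ is generated by $S$ subject to the relations $\Pi(s,t;m_{s,t})=\Pi(t,s;m_{s,t})$ for all $s\ne t$ with $m_{s,t}<\infty$, where $\Pi(a,b;m)=aba\cdots$ is the alternating word of length $m$ starting with $a$. The Coxeter graph $\Gamma_S$ has vertex set $S$ and an edge between distinct $s,t$ whenever $m_{s,t}\geqslant3$. $A_S$ is irreducible if $\Gamma_S$ is connected (and nonempty), of spherical type if the Coxeter group obtained from $A_S$ by adding the relations $s^2=1$, $s\in S$, is finite, and of dihedral type if $|S|=2$. Non-cyclic means $|S|\geqslant2$. Let $A^+$ be the submonoid of $A$ generated by $S$, and let the Garside element $\Delta$ be the least common multiple of $S$ in $A^+$. An element $u\in A^+$ is simple if it is a positive prefix of $\Delta$, i.e. $u^{-1}\Delta\in A^+$. For $x\in A$, $\inf(x)=\max\{k\in\mathbb Z: \Delta^{-k}x\in A^+\}$ and $\sup(x)=\min\{k\in\mathbb Z: x^{-1}\Delta^k\in A^+\}$. An element $y\in A$ is absorbable if $\inf(y)=0$ or $\sup(y)=0$, and there exists $x\in A$ such that $\inf(xy)=\inf(x)$ and $\sup(xy)=\sup(x)$.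 $X_{abs}^A$ is the set of absorbable elements of $A$, together with the cyclic subgroup $\langle\Delta^2\rangle$ if $A$ is of dihedral type; it generates $A$. The graph $\mathcal C_{AL}(A)$ has as vertices the cosets $a\langle\Delta\rangle$, $a\in A$; there is an edge between $a\langle\Delta\rangle$ and $b\langle\Delta\rangle$ if there is some $u\in A$ which is either simple or absorbable such that $au\in b\langle\Delta\rangle$. All graphs carry the graph metric in which each edge has length 1. *)

theory Defs
  imports
    "HOL-Algebra.Left_Coset"
    "HOL-Algebra.Generated_Groups"
    "HOL-Library.Extended_Nat"
    "Graph_Theory.Graph_Theory"
begin

section \<open>Groups given by generators and relations\<close>

text \<open>
  A letter \<open>(s, True)\<close> stands for the generator \<open>s\<close> and \<open>(s, False)\<close> for its inverse.
\<close>

definition group_words :: "'a set \<Rightarrow> ('a \<times> bool) list set" where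
  "group_words S = lists (S \<times> UNIV)"

inductive_set presentation_cong ::
    "'a set \<Rightarrow> (('a \<times> bool) list \<times> ('a \<times> bool) list) set
      \<Rightarrow> (('a \<times> bool) list \<times> ('a \<times> bool) list) set"
  for S R where
  refl: "w \<in> group_words S \<Longrightarrow> (w, w) \<in> presentation_cong S R"
| sym: "(v, w) \<in> presentation_cong S R \<Longrightarrow> (w, v) \<in> presentation_cong S R"
| trans: "(u, v) \<in> presentation_cong S R \<Longrightarrow> (v, w) \<in> presentation_cong S R \<Longrightarrow>
    (u, w) \<in> presentation_cong S R"
| cancel: "s \<in> S \<Longrightarrow> u \<in> group_words S \<Longrightarrow> v \<in> group_words S \<Longrightarrow>
    (u @ [(s, b), (s, \<not> b)] @ v, u @ v) \<in> presentation_cong S R"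
| relator: "(l, r) \<in> R \<Longrightarrow> u \<in> group_words S \<Longrightarrow> v \<in> group_words S \<Longrightarrow>
    (u @ l @ v, u @ r @ v) \<in> presentation_cong S R"

text \<open>The relations \<open>R\<close> are pairs of words over \<open>S\<close>.\<close>

definition presented_group ::
    "'a set \<Rightarrow> (('a \<times> bool) list \<times> ('a \<times> bool) list) set \<Rightarrow> ('a \<times> bool) list set monoid" where
  "presented_group S R =
    \<lparr> carrier = group_words S // presentation_cong S R,
      monoid.mult = (\<lambda>X Y. \<Union>x\<in>X. \<Union>y\<in>Y. presentation_cong S R `` {x @ y}),
      one = presentation_cong S R `` {[]} \<rparr>"

lemma presentation_cong_words:
  assumes "R \<subseteq> group_words S \<times> group_words S" "(v, w) \<in> presentation_cong S R"
  shows "v \<in> group_words S \<and> w \<in> group_words S"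
  using assms(2,1) by induction (auto simp: group_words_def)

lemma equiv_presentation_cong:
  assumes "R \<subseteq> group_words S \<times> group_words S"
  shows "equiv (group_words S) (presentation_cong S R)"
proof (rule equivI)
  show "presentation_cong S R \<subseteq> group_words S \<times> group_words S"
    using presentation_cong_words[OF assms] by auto
  show "refl_on (group_words S) (presentation_cong S R)"
    by (auto intro: refl_onI presentation_cong.refl)
  show "sym (presentation_cong S R)"
    by (auto intro: symI presentation_cong.sym)
  show "trans (presentation_cong S R)"
    by (blast intro: transI presentation_cong.trans)
qed

lemma presentation_cong_context:
  assumes "(v, w) \<in> presentation_cong S R" "a \<in> group_words S" "b \<in> group_words S"
  shows "(a @ v @ b, a @ w @ b) \<in> presentation_cong S R"
  using assms
proof induction
  case (refl w)
  then show ?case by (auto intro!: presentation_cong.refl simp: group_words_def)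
next
  case (sym v w)
  then show ?case by (auto intro: presentation_cong.sym)
next
  case (trans u v w)
  then show ?case by (blast intro: presentation_cong.trans)
next
  case (cancel s u v c)
  have "((a @ u) @ [(s, c), (s, \<not> c)] @ (v @ b), (a @ u) @ (v @ b)) \<in> presentation_cong S R"
    using cancel by (intro presentation_cong.cancel) (auto simp: group_words_def)
  then show ?case by simp
next
  case (relator l r u v)
  have "((a @ u) @ l @ (v @ b), (a @ u) @ r @ (v @ b)) \<in> presentation_cong S R"
    using relator by (intro presentation_cong.relator) (auto simp: group_words_def)
  then show ?case by simp
qed

lemma presentation_cong_append:
  assumes "R \<subseteq> group_words S \<times> group_words S"
    and "(v, v') \<in> presentation_cong S R" "(w, w') \<in> presentation_cong S R"
  shows "(v @ w, v' @ w') \<in> presentation_cong S R"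
proof -
  note words = presentation_cong_words[OF assms(1) assms(2)] presentation_cong_words[OF assms(1) assms(3)]
  have "[] \<in> group_words S" by (simp add: group_words_def)
  then have "(v @ w, v' @ w) \<in> presentation_cong S R" "(v' @ w, v' @ w') \<in> presentation_cong S R"
    using presentation_cong_context[OF assms(2), of "[]" w]
      presentation_cong_context[OF assms(3), of v' "[]"] words by auto
  then show ?thesis by (rule presentation_cong.trans)
qed

lemma presented_group_mult:
  assumes R: "R \<subseteq> group_words S \<times> group_words S"
    and "v \<in> group_words S" "w \<in> group_words S"
  shows "presentation_cong S R `` {v} \<otimes>\<^bsub>presented_group S R\<^esub> presentation_cong S R `` {w}
    = presentation_cong S R `` {v @ w}"
proof -
  let ?C = "\<lambda>u. presentation_cong S R `` {u}"
  have class_eq: "?C (x @ y) = ?C (v @ w)" if "x \<in> ?C v" "y \<in> ?C w" for x y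
  proof -
    have "(v @ w, x @ y) \<in> presentation_cong S R"
      using presentation_cong_append[OF R, of v x w y] that by simp
    then show ?thesis
      using equiv_class_eq[OF equiv_presentation_cong[OF R]] by metis
  qed
  have "v \<in> ?C v" "w \<in> ?C w"
    using assms(2,3) presentation_cong.refl[of v S R] presentation_cong.refl[of w S R] by simp_all
  then have "(\<Union>x\<in>?C v. \<Union>y\<in>?C w. ?C (x @ y)) = ?C (v @ w)"
    using class_eq by blast
  then show ?thesis
    by (simp only: presented_group_def monoid.simps)
qed

lemma word_inverse:
  assumes "w \<in> group_words S"
  shows "(map (\<lambda>(s, b). (s, \<not> b)) (rev w) @ w, []) \<in> presentation_cong S R"
  using assms
proof (induction w)
  case Nil
  then show ?case by (simp add: presentation_cong.refl)
next
  case (Cons x w)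
  obtain s b where x: "x = (s, b)" by force
  have w: "w \<in> group_words S" and s: "s \<in> S" using Cons.prems x by (auto simp: group_words_def)
  let ?u = "map (\<lambda>(s, b). (s, \<not> b)) (rev w)"
  have "?u \<in> group_words S" using w by (auto simp: group_words_def)
  from presentation_cong.cancel[OF s this w, of "\<not> b" R]
  have "(?u @ [(s, \<not> b), (s, b)] @ w, ?u @ w) \<in> presentation_cong S R" by simp
  then have "(?u @ [(s, \<not> b), (s, b)] @ w, []) \<in> presentation_cong S R"
    using Cons.IH[OF w] by (rule presentation_cong.trans)
  then show ?case by (simp add: x)
qed

lemma group_presented_group:
  assumes R: "R \<subseteq> group_words S \<times> group_words S"
  shows "group (presented_group S R)"
proof (rule groupI)
  let ?G = "presented_group S R"
  have carrier: "\<exists>w\<in>group_words S. X = presentation_cong S R `` {w}" if "X \<in> carrier ?G" for X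
    using that by (auto simp: presented_group_def elim: quotientE)
  have class_in: "presentation_cong S R `` {w} \<in> carrier ?G" if "w \<in> group_words S" for w
    using that by (auto simp: presented_group_def intro: quotientI)
  have app: "v @ w \<in> group_words S" if "v \<in> group_words S" "w \<in> group_words S" for v w :: "('a \<times> bool) list"
    using that by (auto simp: group_words_def)
  have nil: "[] \<in> group_words S" by (simp add: group_words_def)
  have one: "\<one>\<^bsub>?G\<^esub> = presentation_cong S R `` {[]}" by (simp add: presented_group_def)
  show "\<one>\<^bsub>?G\<^esub> \<in> carrier ?G" using class_in[OF nil] by (simp add: one)
  fix X assume "X \<in> carrier ?G"
  then obtain x where x: "x \<in> group_words S" "X = presentation_cong S R `` {x}" using carrier by blast
  show "\<one>\<^bsub>?G\<^esub> \<otimes>\<^bsub>?G\<^esub> X = X" using presented_group_mult[OF R nil x(1)] by (simp add: one x)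
  have ix: "map (\<lambda>(s, b). (s, \<not> b)) (rev x) \<in> group_words S" using x by (auto simp: group_words_def)
  let ?y = "map (\<lambda>(s, b). (s, \<not> b)) (rev x)"
  have "presentation_cong S R `` {?y} \<otimes>\<^bsub>?G\<^esub> X = presentation_cong S R `` {?y @ x}"
    unfolding x(2) by (rule presented_group_mult[OF R ix x(1)])
  also have "\<dots> = \<one>\<^bsub>?G\<^esub>"
    unfolding one by (rule equiv_class_eq[OF equiv_presentation_cong[OF R] word_inverse[OF x(1)]])
  finally show "\<exists>Y\<in>carrier ?G. Y \<otimes>\<^bsub>?G\<^esub> X = \<one>\<^bsub>?G\<^esub>"
    using class_in[OF ix] by (rule bexI)
  fix Y assume "Y \<in> carrier ?G"
  then obtain y where y: "y \<in> group_words S" "Y = presentation_cong S R `` {y}" using carrier by blast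
  show "X \<otimes>\<^bsub>?G\<^esub> Y \<in> carrier ?G"
    using presented_group_mult[OF R x(1) y(1)] class_in[OF app[OF x(1) y(1)]] by (simp add: x y)
  fix Z assume "Z \<in> carrier ?G"
  then obtain z where z: "z \<in> group_words S" "Z = presentation_cong S R `` {z}" using carrier by blast
  show "X \<otimes>\<^bsub>?G\<^esub> Y \<otimes>\<^bsub>?G\<^esub> Z = X \<otimes>\<^bsub>?G\<^esub> (Y \<otimes>\<^bsub>?G\<^esub> Z)"
    using presented_group_mult[OF R] x y z app by simp
qed


section \<open>Artin-Tits groups and Coxeter groups\<close>

definition coxeter_matrix :: "'a set \<Rightarrow> ('a \<Rightarrow> 'a \<Rightarrow> enat) \<Rightarrow> bool" where
  "coxeter_matrix S m \<longleftrightarrow> finite S \<and>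
    (\<forall>s\<in>S. m s s = 1) \<and>
    (\<forall>s\<in>S. \<forall>t\<in>S. m s t = m t s) \<and>
    (\<forall>s\<in>S. \<forall>t\<in>S. s \<noteq> t \<longrightarrow> 2 \<le> m s t)"

fun alternating :: "'a \<Rightarrow> 'a \<Rightarrow> nat \<Rightarrow> 'a list" where
  "alternating a b 0 = []"
| "alternating a b (Suc n) = a # alternating b a n"

definition positive_word :: "'a list \<Rightarrow> ('a \<times> bool) list" where
  "positive_word w = map (\<lambda>s. (s, True)) w"

definition artin_relations ::
    "'a set \<Rightarrow> ('a \<Rightarrow> 'a \<Rightarrow> enat) \<Rightarrow> (('a \<times> bool) list \<times> ('a \<times> bool) list) set" where
  "artin_relations S m =
    {(positive_word (alternating s t n), positive_word (alternating t s n)) | s t n.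
      s \<in> S \<and> t \<in> S \<and> s \<noteq> t \<and> m s t = enat n}"

definition artin_group :: "'a set \<Rightarrow> ('a \<Rightarrow> 'a \<Rightarrow> enat) \<Rightarrow> ('a \<times> bool) list set monoid" where
  "artin_group S m = presented_group S (artin_relations S m)"

definition coxeter_group :: "'a set \<Rightarrow> ('a \<Rightarrow> 'a \<Rightarrow> enat) \<Rightarrow> ('a \<times> bool) list set monoid" where
  "coxeter_group S m =
    presented_group S (artin_relations S m \<union> {(positive_word [s, s], []) | s. s \<in> S})"

lemma group_artin_group: "group (artin_group S m)"
proof -
  have "set (alternating s t n) \<subseteq> {s, t}" for s t :: 'a and n
    by (induction s t n rule: alternating.induct) auto
  then have "positive_word (alternating s t n) \<in> group_words S" if "s \<in> S" "t \<in> S" for s t n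
    using that by (fastforce simp: positive_word_def group_words_def in_lists_conv_set)
  then show ?thesis
    unfolding artin_group_def
    by (intro group_presented_group) (auto simp: artin_relations_def)
qed

text \<open>An undirected graph is represented by the digraph with both orientations of each edge.\<close>

definition coxeter_graph :: "'a set \<Rightarrow> ('a \<Rightarrow> 'a \<Rightarrow> enat) \<Rightarrow> 'a pair_pre_digraph" where
  "coxeter_graph S m =
    mk_symmetric \<lparr> pverts = S, parcs = {(s, t). s \<in> S \<and> t \<in> S \<and> s \<noteq> t \<and> 3 \<le> m s t} \<rparr>"

text \<open>The predicate \<^const>\<open>Digraph_Component.connected\<close> of the graph library includes nonemptiness.\<close>

definition irreducible_type :: "'a set \<Rightarrow> ('a \<Rightarrow> 'a \<Rightarrow> enat) \<Rightarrow> bool" where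
  "irreducible_type S m \<longleftrightarrow> Digraph_Component.connected (coxeter_graph S m)"

definition spherical_type :: "'a set \<Rightarrow> ('a \<Rightarrow> 'a \<Rightarrow> enat) \<Rightarrow> bool" where
  "spherical_type S m \<longleftrightarrow> finite (carrier (coxeter_group S m))"

definition dihedral_type :: "'a set \<Rightarrow> bool" where
  "dihedral_type S \<longleftrightarrow> card S = 2"


section \<open>Garside structure\<close>

definition artin_gen :: "'a set \<Rightarrow> ('a \<Rightarrow> 'a \<Rightarrow> enat) \<Rightarrow> 'a \<Rightarrow> ('a \<times> bool) list set" where
  "artin_gen S m s = presentation_cong S (artin_relations S m) `` {[(s, True)]}"

definition positive_monoid :: "'a set \<Rightarrow> ('a \<Rightarrow> 'a \<Rightarrow> enat) \<Rightarrow> ('a \<times> bool) list set set" where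
  "positive_monoid S m = (\<lambda>H. submonoid H (artin_group S m)) hull (artin_gen S m ` S)"

definition positive_prefix ::
    "'a set \<Rightarrow> ('a \<Rightarrow> 'a \<Rightarrow> enat) \<Rightarrow> ('a \<times> bool) list set \<Rightarrow> ('a \<times> bool) list set \<Rightarrow> bool" where
  "positive_prefix S m u v \<longleftrightarrow>
    inv\<^bsub>artin_group S m\<^esub> u \<otimes>\<^bsub>artin_group S m\<^esub> v \<in> positive_monoid S m"

text \<open>
  The least common multiple is taken with respect to left divisibility in the positive monoid.
  It exists if the group is of spherical type, and then it is also the least common multiple with
  respect to right divisibility.
\<close>

definition garside :: "'a set \<Rightarrow> ('a \<Rightarrow> 'a \<Rightarrow> enat) \<Rightarrow> ('a \<times> bool) list set" where
  "garside S m = (THE d. d \<in> positive_monoid S m \<and>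
    (\<forall>s\<in>S. positive_prefix S m (artin_gen S m s) d) \<and>
    (\<forall>c\<in>positive_monoid S m.
      (\<forall>s\<in>S. positive_prefix S m (artin_gen S m s) c) \<longrightarrow> positive_prefix S m d c))"

definition simple_elements :: "'a set \<Rightarrow> ('a \<Rightarrow> 'a \<Rightarrow> enat) \<Rightarrow> ('a \<times> bool) list set set" where
  "simple_elements S m = {u \<in> positive_monoid S m. positive_prefix S m u (garside S m)}"

definition garside_inf :: "'a set \<Rightarrow> ('a \<Rightarrow> 'a \<Rightarrow> enat) \<Rightarrow> ('a \<times> bool) list set \<Rightarrow> int" where
  "garside_inf S m x = (GREATEST k::int.
    garside S m [^]\<^bsub>artin_group S m\<^esub> (- k) \<otimes>\<^bsub>artin_group S m\<^esub> x \<in> positive_monoid S m)"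

definition garside_sup :: "'a set \<Rightarrow> ('a \<Rightarrow> 'a \<Rightarrow> enat) \<Rightarrow> ('a \<times> bool) list set \<Rightarrow> int" where
  "garside_sup S m x = (LEAST k::int.
    inv\<^bsub>artin_group S m\<^esub> x \<otimes>\<^bsub>artin_group S m\<^esub> garside S m [^]\<^bsub>artin_group S m\<^esub> k
      \<in> positive_monoid S m)"

definition absorbable_elements :: "'a set \<Rightarrow> ('a \<Rightarrow> 'a \<Rightarrow> enat) \<Rightarrow> ('a \<times> bool) list set set" where
  "absorbable_elements S m = {y \<in> carrier (artin_group S m).
    (garside_inf S m y = 0 \<or> garside_sup S m y = 0) \<and>
    (\<exists>x\<in>carrier (artin_group S m).
      garside_inf S m (x \<otimes>\<^bsub>artin_group S m\<^esub> y) = garside_inf S m x \<and>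
      garside_sup S m (x \<otimes>\<^bsub>artin_group S m\<^esub> y) = garside_sup S m x)}"

definition X_abs :: "'a set \<Rightarrow> ('a \<Rightarrow> 'a \<Rightarrow> enat) \<Rightarrow> ('a \<times> bool) list set set" where
  "X_abs S m = absorbable_elements S m \<union>
    (if dihedral_type S
     then generate (artin_group S m) {garside S m [^]\<^bsub>artin_group S m\<^esub> (2::nat)} else {})"


section \<open>Cayley graphs and the additional length graph\<close>

definition cayley_graph :: "('g, 'b) monoid_scheme \<Rightarrow> 'g set \<Rightarrow> 'g pair_pre_digraph" where
  "cayley_graph G X = mk_symmetric
    \<lparr> pverts = carrier G, parcs = {(a, a \<otimes>\<^bsub>G\<^esub> x) | a x. a \<in> carrier G \<and> x \<in> X} \<rparr>"

definition additional_length_graph ::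
    "'a set \<Rightarrow> ('a \<Rightarrow> 'a \<Rightarrow> enat) \<Rightarrow> ('a \<times> bool) list set set pair_pre_digraph" where
  "additional_length_graph S m =
    (let A = artin_group S m; Z = generate A {garside S m} in
     mk_symmetric
      \<lparr> pverts = lcosets\<^bsub>A\<^esub> Z,
        parcs = {(a <#\<^bsub>A\<^esub> Z, b <#\<^bsub>A\<^esub> Z) | a b. a \<in> carrier A \<and> b \<in> carrier A \<and>
          (\<exists>u \<in> simple_elements S m \<union> absorbable_elements S m. a \<otimes>\<^bsub>A\<^esub> u \<in> b <#\<^bsub>A\<^esub> Z)} \<rparr>)"


section \<open>Quasi-isometries\<close>

text \<open>
  Distances are extended reals, so that the distance between vertices in different components of a
  graph is \<open>\<infinity>\<close>.
\<close>

definition graph_dist :: "'v pair_pre_digraph \<Rightarrow> 'v \<Rightarrow> 'v \<Rightarrow> ereal" where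
  "graph_dist G u v = wf_digraph.\<mu> (with_proj G) (\<lambda>_. 1) u v"

definition quasi_isometry ::
    "'v set \<Rightarrow> ('v \<Rightarrow> 'v \<Rightarrow> ereal) \<Rightarrow> 'w set \<Rightarrow> ('w \<Rightarrow> 'w \<Rightarrow> ereal) \<Rightarrow> ('v \<Rightarrow> 'w) \<Rightarrow> bool" where
  "quasi_isometry V d W d' f \<longleftrightarrow> f \<in> V \<rightarrow> W \<and>
    (\<exists>L C :: real. 1 \<le> L \<and> 0 \<le> C \<and>
      (\<forall>x\<in>V. \<forall>y\<in>V. d x y / ereal L - ereal C \<le> d' (f x) (f y) \<and>
        d' (f x) (f y) \<le> ereal L * d x y + ereal C) \<and>
      (\<forall>w\<in>W. \<exists>x\<in>V. d' (f x) w \<le> ereal C))"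

definition quasi_isometric_graphs :: "'v pair_pre_digraph \<Rightarrow> 'w pair_pre_digraph \<Rightarrow> bool" where
  "quasi_isometric_graphs G H \<longleftrightarrow>
    (\<exists>f. quasi_isometry (pverts G) (graph_dist G) (pverts H) (graph_dist H) f)"

end

theory Submission
  imports Defs
begin

text \<open>
  Sending a coset to one of its elements is a quasi-isometry as soon as the simple elements and
  the powers of \<open>\<Delta>\<close> are products of a bounded number of elements of \<open>X_abs\<close>. Every
  generator is absorbable, as it has a neighbour in the Coxeter graph, and a simple element is
  a product of at most \<open>length \<Delta>\<close> generators. In the dihedral case \<open>\<Delta> ^ (2 k)\<close> lies in
  \<open>X_abs\<close>. Otherwise there are two commuting generators \<open>s\<close> and \<open>t\<close>, and
  \<open>\<Delta> ^ n = s ^ n t ^ n z\<close> is a product of three absorbable elements.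

  The Garside structure comes from the finite reflection group \<open>W\<close> of the geometric
  representation. Its weak order is a lattice, which makes \<open>W\<close> act on sequences of elements of
  \<open>W\<close> by multiplication from the left followed by greedy normalization. This action factors
  through the positive monoid, where it shows that the lift \<open>\<Delta>\<close> of the longest element is the
  least common multiple of the generators and can be cancelled. Since \<open>\<Delta> ^ 2\<close> is central,
  inverting it embeds the positive monoid into the Artin-Tits group.
\<close>

section \<open>Groups generated by involutions satisfying the braid relations\<close>

text \<open>The presentation does not tell which positive words are equal in the group, while
  \<open>inf\<close>, \<open>sup\<close> and absorbability all speak of divisibility among them.
  This is why normal forms come before any statement about graphs.

  \<open>W\<close> is the group of operators generated by the reflections, not the Coxeter group
  itself. So faithfulness of the geometric representation is never proved: spherical type enters
  only through finiteness of this image.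

  Upper bounds on \<open>sup\<close> are witnessed by cofactors. The lower bound needed for
  absorbability is that \<open>s ^ n\<close> divides no power of \<Delta> below the n-th; this is
  why the absorbing elements are always powers of one generator. The bound on the powers of \<Delta>
  must be uniform in the exponent, because whole cosets of the group generated by \<Delta> have to
  be bounded in the Cayley graph. In the other direction it suffices to send an element to its
  coset: each element of \<open>X_abs\<close> moves a coset by at most one edge.\<close>

declare in_lists_conv_set [simp del]

lemma rev_in_lists [simp]: "rev w \<in> lists A \<longleftrightarrow> w \<in> lists A"
  by (simp add: in_lists_conv_set)

lemma length_alternating [simp]: "length (alternating a b n) = n"
  by (induction a b n rule: alternating.induct) auto

lemma alternating_add:
  "alternating a b (i + j) =
    alternating a b i @ (if even i then alternating a b j else alternating b a j)"
  by (induction i arbitrary: a b) auto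

lemma set_alternating: "set (alternating a b n) \<subseteq> {a, b}"
  by (induction a b n rule: alternating.induct) auto

lemma alternating_in_lists: "a \<in> S \<Longrightarrow> b \<in> S \<Longrightarrow> alternating a b n \<in> lists S"
  by (induction a b n rule: alternating.induct) auto

lemma alternating_of_no_repetition:
  assumes "w \<in> lists {s, t}" "\<And>p q c. w \<noteq> p @ [c, c] @ q"
  shows "\<exists>a b n. {a, b} = {s, t} \<and> w = alternating a b n"
  using assms
proof (induction w rule: list.induct)
  case Nil
  then show ?case by (metis alternating.simps(1))
next
  case (Cons c w)
  have "w \<noteq> p @ [d, d] @ q" for p d q
    using Cons.prems(2)[of "c # p" d q] by auto
  then obtain a b n where ab: "{a, b} = {s, t}" "w = alternating a b n"
    using Cons by auto
  have c: "c \<in> {a, b}" using Cons.prems(1) ab(1) by auto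
  show ?case
  proof (cases n)
    case 0
    have "c # w = alternating c d 1" for d using ab(2) 0 by simp
    moreover have "{c, d} = {s, t}" if "{c, d} = {a, b}" for d using that ab(1) by simp
    ultimately show ?thesis using c by (metis insert_commute empty_iff insert_iff)
  next
    case (Suc k)
    then have w: "w = a # alternating b a k" using ab(2) by simp
    then have "c \<noteq> a" using Cons.prems(2)[of "[]" a "alternating b a k"] by auto
    then have "c = b" using c by auto
    then have "c # w = alternating b a (Suc n)" using ab(2) by simp
    then show ?thesis using ab(1) by (metis insert_commute)
  qed
qed

definition word_product :: "('g, 'b) monoid_scheme \<Rightarrow> ('a \<Rightarrow> 'g) \<Rightarrow> 'a list \<Rightarrow> 'g" where
  "word_product G g w = foldr (\<lambda>s x. g s \<otimes>\<^bsub>G\<^esub> x) w \<one>\<^bsub>G\<^esub>"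

text \<open>A quotient of the Coxeter group; the intended instance is the group of reflections.
  Positive words suffice in \<open>generated\<close> because generators are their own
  inverses.\<close>

locale coxeter_quotient = group G for G (structure) +
  fixes S :: "'a set" and m :: "'a \<Rightarrow> 'a \<Rightarrow> enat" and g :: "'a \<Rightarrow> 'g"
  assumes coxeter: "coxeter_matrix S m"
    and gen_closed [simp]: "s \<in> S \<Longrightarrow> g s \<in> carrier G"
    and gen_square: "s \<in> S \<Longrightarrow> g s \<otimes> g s = \<one>"
    and braid: "s \<in> S \<Longrightarrow> t \<in> S \<Longrightarrow> s \<noteq> t \<Longrightarrow> m s t = enat n \<Longrightarrow>
      word_product G g (alternating s t n) = word_product G g (alternating t s n)"
    and generated: "x \<in> carrier G \<Longrightarrow> \<exists>w\<in>lists S. word_product G g w = x"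
begin

abbreviation ev :: "'a list \<Rightarrow> 'g" where "ev \<equiv> word_product G g"

lemma ev_Nil [simp]: "ev [] = \<one>"
  by (simp add: word_product_def)

lemma ev_Cons [simp]: "ev (s # w) = g s \<otimes> ev w"
  by (simp add: word_product_def)

lemma ev_closed [simp]: "w \<in> lists S \<Longrightarrow> ev w \<in> carrier G"
  by (induction w) auto

lemma ev_append: "v \<in> lists S \<Longrightarrow> w \<in> lists S \<Longrightarrow> ev (v @ w) = ev v \<otimes> ev w"
  by (induction v) (auto simp: m_assoc)

lemma inv_gen: "s \<in> S \<Longrightarrow> inv g s = g s"
  using gen_square inv_equality by simp

lemma gen_cancel [simp]: "s \<in> S \<Longrightarrow> x \<in> carrier G \<Longrightarrow> g s \<otimes> (g s \<otimes> x) = x"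
  by (simp add: m_assoc[symmetric] gen_square)

lemma inv_ev: "w \<in> lists S \<Longrightarrow> inv (ev w) = ev (rev w)"
  proof (induction w)
  case (Cons s w)
  then show ?case
    using ev_append[of "rev w" "[s]"] by (auto simp: inv_mult_group inv_gen)
qed simp

lemma label_sym: "s \<in> S \<Longrightarrow> t \<in> S \<Longrightarrow> m s t = m t s"
  using coxeter by (auto simp: coxeter_matrix_def)

lemma label_ge_2: "s \<in> S \<Longrightarrow> t \<in> S \<Longrightarrow> s \<noteq> t \<Longrightarrow> m s t = enat n \<Longrightarrow> 2 \<le> n"
  using coxeter unfolding coxeter_matrix_def
  by (metis enat_ord_simps(1) numeral_eq_enat)

definition len :: "'g \<Rightarrow> nat" where
  "len x = (LEAST n. \<exists>w\<in>lists S. length w = n \<and> ev w = x)"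

lemma reduced_word:
  assumes "x \<in> carrier G"
  obtains w where "w \<in> lists S" "ev w = x" "length w = len x"
proof -
  have "\<exists>n. \<exists>w\<in>lists S. length w = n \<and> ev w = x"
    using generated[OF assms] by auto
  from LeastI_ex[OF this] show thesis
    using that unfolding len_def by auto
qed

lemma len_le: "w \<in> lists S \<Longrightarrow> len (ev w) \<le> length w"
  unfolding len_def by (rule Least_le) auto

lemma len_one [simp]: "len \<one> = 0"
  using len_le[of "[]"] by simp

lemma len_eq_0: "x \<in> carrier G \<Longrightarrow> len x = 0 \<longleftrightarrow> x = \<one>"
  by (metis reduced_word length_0_conv ev_Nil len_one)

lemma len_mult:
  assumes "x \<in> carrier G" "y \<in> carrier G"
  shows "len (x \<otimes> y) \<le> len x + len y"
proof -
  obtain v w where "v \<in> lists S" "ev v = x" "length v = len x"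
    and "w \<in> lists S" "ev w = y" "length w = len y"
    using reduced_word assms by metis
  then show ?thesis using len_le[of "v @ w"] by (auto simp: ev_append)
qed

lemma len_inv_le: "x \<in> carrier G \<Longrightarrow> len (inv x) \<le> len x"
  by (metis reduced_word inv_ev len_le length_rev rev_in_lists)

lemma len_inv: "x \<in> carrier G \<Longrightarrow> len (inv x) = len x"
  by (metis len_inv_le inv_closed inv_inv le_antisym)

lemma len_gen_le: "s \<in> S \<Longrightarrow> len (g s) \<le> 1"
  using len_le[of "[s]"] by simp

lemma len_gen_mult_le: "s \<in> S \<Longrightarrow> x \<in> carrier G \<Longrightarrow> len (g s \<otimes> x) \<le> Suc (len x)"
  using len_mult[of "g s" x] len_gen_le[of s] by simp

lemma len_le_gen_mult: "s \<in> S \<Longrightarrow> x \<in> carrier G \<Longrightarrow> len x \<le> Suc (len (g s \<otimes> x))"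
  using len_gen_mult_le[of s "g s \<otimes> x"] by simp

lemma left_descent_exists:
  assumes "x \<in> carrier G" "x \<noteq> \<one>"
  obtains s where "s \<in> S" "len x = Suc (len (g s \<otimes> x))"
proof -
  obtain w where w: "w \<in> lists S" "ev w = x" "length w = len x"
    using reduced_word assms by metis
  then obtain s v where "w = s # v" using assms(2) by (cases w) auto
  then have "s \<in> S" "v \<in> lists S" "g s \<otimes> x = ev v" using w(1) by (simp_all flip: w(2))
  with w \<open>w = s # v\<close> show thesis
    using that[of s] len_le[of v] len_le_gen_mult[of s x] assms(1) by simp
qed

text \<open>The braid relation turns the tail into a word starting with \<open>a\<close>, and the
  two letters \<open>a\<close> cancel. So an alternating word longer than its label is not
  reduced.\<close>

lemma alternating_cancel:
  assumes "a \<in> S" "b \<in> S" "a \<noteq> b" "m a b = enat N"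
  shows "ev (alternating a b (Suc N)) = ev (alternating b a (N - 1))"
proof -
  obtain k where N: "N = Suc k" using label_ge_2[OF assms] by (cases N) auto
  have "ev (alternating a b (Suc N)) = g a \<otimes> ev (alternating a b N)"
    using braid[OF assms] by simp
  also have "\<dots> = ev (alternating b a k)"
    using assms alternating_in_lists[of b S a k] by (simp add: N)
  finally show ?thesis by (simp add: N)
qed

text \<open>Among all factorizations of \<open>x\<close> into a word in \<open>s\<close>,
  \<open>t\<close> and a rest with lengths adding up, take one with the longest word. Maximality
  leaves the rest without descents \<open>s\<close> and \<open>t\<close>; additivity makes the word
  reduced, hence alternating and not longer than the label.\<close>

lemma dihedral_decomposition:
  assumes x: "x \<in> carrier G" and st: "s \<in> S" "t \<in> S" "s \<noteq> t"
  obtains v a b n where "v \<in> carrier G" "{a, b} = {s, t}" "x = ev (alternating a b n) \<otimes> v"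
    "len x = n + len v" "len v \<le> len (g s \<otimes> v)" "len v \<le> len (g t \<otimes> v)" "enat n \<le> m s t"
proof -
  define P where "P k \<longleftrightarrow> (\<exists>w\<in>lists {s, t}. \<exists>v\<in>carrier G.
    length w = k \<and> x = ev w \<otimes> v \<and> len x = length w + len v)" for k
  have "P 0" unfolding P_def using x by (intro bexI[of _ "[]"] bexI[of _ x]) auto
  moreover have "\<forall>k. P k \<longrightarrow> k \<le> len x" unfolding P_def by auto
  ultimately obtain k where k: "P k" "\<And>j. P j \<Longrightarrow> j \<le> k"
    by (metis Nat.ex_has_greatest_nat)
  then obtain w v where w: "w \<in> lists {s, t}" and v: "v \<in> carrier G"
    and xw: "x = ev w \<otimes> v" "len x = length w + len v" "length w = k"
    unfolding P_def by auto
  have wS: "u \<in> lists {s, t} \<Longrightarrow> u \<in> lists S" for u using st by auto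
  have asc: "len v \<le> len (g c \<otimes> v)" if c: "c \<in> {s, t}" for c
  proof (rule ccontr)
    assume less: "\<not> len v \<le> len (g c \<otimes> v)"
    have cS: "c \<in> S" using c st by auto
    have "P (Suc k)"
      unfolding P_def
    proof (intro bexI conjI)
      show "length (w @ [c]) = Suc k" using xw by simp
      show "w @ [c] \<in> lists {s, t}" using w c by auto
      show "g c \<otimes> v \<in> carrier G" using v cS by simp
      show "x = ev (w @ [c]) \<otimes> (g c \<otimes> v)"
        using xw v cS wS[OF w] by (simp add: ev_append m_assoc)
      show "len x = length (w @ [c]) + len (g c \<otimes> v)"
        using xw(2) less len_le_gen_mult[OF cS v] by simp
    qed
    then show False using k(2) by fastforce
  qed
  have red: "length w \<le> length u" if u: "u \<in> lists S" "ev u = ev w" for u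
    using len_mult[of "ev u" v] len_le[of u] ev_closed[OF u(1)] u v xw by simp
  have "w \<noteq> p @ [c, c] @ q" for p c q
  proof
    assume eq: "w = p @ [c, c] @ q"
    then have "p \<in> lists S" "q \<in> lists S" "c \<in> S" using wS[OF w] by auto
    then show False using red[of "p @ q"] eq by (simp add: ev_append)
  qed
  then obtain a b where ab: "{a, b} = {s, t}" "w = alternating a b k"
    using alternating_of_no_repetition[OF w] xw length_alternating by metis
  have abS: "a \<in> S" "b \<in> S" "a \<noteq> b" "m a b = m s t"
    using ab st label_sym by (auto simp: doubleton_eq_iff)
  have "enat k \<le> m s t"
  proof (cases "m s t")
    case (enat N)
    show ?thesis
    proof (rule ccontr)
      assume "\<not> enat k \<le> m s t"
      then have "Suc N \<le> k" using enat by simp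
      then obtain j where j: "k = Suc N + j" using le_Suc_ex by blast
      define r where "r = (if even (Suc N) then alternating a b j else alternating b a j)"
      have r: "w = alternating a b (Suc N) @ r" "r \<in> lists S"
        unfolding ab(2) j alternating_add r_def using abS alternating_in_lists[of a S b j] alternating_in_lists[of b S a j] by simp_all
      have "ev w = ev (alternating b a (N - 1) @ r)"
        using alternating_cancel[of a b N] abS enat r
          ev_append[of "alternating a b (Suc N)" r] ev_append[of "alternating b a (N - 1)" r]
        by (simp del: alternating.simps add: alternating_in_lists)
      then have "length w \<le> N - 1 + length r"
        using red[of "alternating b a (N - 1) @ r"] abS r alternating_in_lists[of b S a "N - 1"]
        by simp
      then show False using r by simp
    qed
  qed simp
  then show thesis
    using that[OF v ab(1), of k] xw asc unfolding ab(2) by simp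
qed

end

section \<open>The weak order of a finite Coxeter group\<close>

text \<open>The last three assumptions are what the signs of roots provide, in
  \<open>W_len_gen_mult_neq\<close>, \<open>W_two_left_descents\<close> and
  \<open>W_all_left_descents\<close>; the monoid is studied from them alone.\<close>

locale finite_coxeter = coxeter_quotient G S m g
  for G :: "('g, 'b) monoid_scheme" (structure) and S :: "'a set" and m g +
  assumes finite_carrier: "finite (carrier G)"
    and nonempty: "S \<noteq> {}"
    and len_gen_mult_neq: "s \<in> S \<Longrightarrow> x \<in> carrier G \<Longrightarrow> len (g s \<otimes> x) \<noteq> len x"
    and two_left_descents: "x \<in> carrier G \<Longrightarrow> s \<in> S \<Longrightarrow> t \<in> S \<Longrightarrow> s \<noteq> t \<Longrightarrow>
      len (g s \<otimes> x) < len x \<Longrightarrow> len (g t \<otimes> x) < len x \<Longrightarrow>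
      \<exists>n. m s t = enat n \<and>
        (\<exists>v\<in>carrier G. x = ev (alternating s t n) \<otimes> v \<and> len x = n + len v)"
    and all_left_descents: "x \<in> carrier G \<Longrightarrow> (\<And>s. s \<in> S \<Longrightarrow> len (g s \<otimes> x) < len x) \<Longrightarrow>
      u \<in> carrier G \<Longrightarrow> len x = len u + len (inv u \<otimes> x)"
begin

section \<open>The prefix order and the longest element\<close>

lemma inv_mult_cancel [simp]: "x \<in> carrier G \<Longrightarrow> y \<in> carrier G \<Longrightarrow> inv x \<otimes> (x \<otimes> y) = y"
  by (simp add: m_assoc[symmetric])

lemma mult_inv_cancel [simp]: "x \<in> carrier G \<Longrightarrow> y \<in> carrier G \<Longrightarrow> x \<otimes> (inv x \<otimes> y) = y"
  by (simp add: m_assoc[symmetric])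

text \<open>The right weak order: some reduced word of \<open>w\<close> begins with a reduced word
  of \<open>u\<close>.\<close>

definition prefix_le :: "'g \<Rightarrow> 'g \<Rightarrow> bool" (infix "\<preceq>" 50) where
  "u \<preceq> w \<longleftrightarrow> len w = len u + len (inv u \<otimes> w)"

lemma prefix_le_refl: "u \<in> carrier G \<Longrightarrow> u \<preceq> u"
  by (simp add: prefix_le_def)

lemma prefix_le_len: "u \<preceq> w \<Longrightarrow> len u \<le> len w"
  by (simp add: prefix_le_def)

lemma prefix_le_mult:
  "u \<in> carrier G \<Longrightarrow> x \<in> carrier G \<Longrightarrow> len (u \<otimes> x) = len u + len x \<Longrightarrow> u \<preceq> u \<otimes> x"
  by (simp add: prefix_le_def)

lemma prefix_le_antisym:
  assumes "u \<in> carrier G" "w \<in> carrier G" "u \<preceq> w" "len w \<le> len u"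
  shows "u = w"
proof -
  have "inv u \<otimes> w = \<one>"
    using assms by (simp add: prefix_le_def flip: len_eq_0)
  then show ?thesis
    using assms by (metis mult_inv_cancel r_one)
qed

lemma prefix_le_mult_left:
  assumes z: "z \<in> carrier G" "u \<in> carrier G" "a \<in> carrier G"
    and le: "z \<preceq> u" "a \<preceq> inv z \<otimes> u"
  shows "z \<otimes> a \<preceq> u" and "len (z \<otimes> a) = len z + len a"
proof -
  have eq: "inv a \<otimes> (inv z \<otimes> u) = inv (z \<otimes> a) \<otimes> u"
    using z by (simp add: inv_mult_group m_assoc)
  have 1: "len u = len z + len a + len (inv (z \<otimes> a) \<otimes> u)"
    using le by (simp add: prefix_le_def eq)
  have "u = (z \<otimes> a) \<otimes> (inv (z \<otimes> a) \<otimes> u)"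
    using z by simp
  then have "len u \<le> len (z \<otimes> a) + len (inv (z \<otimes> a) \<otimes> u)"
    using len_mult[of "z \<otimes> a" "inv (z \<otimes> a) \<otimes> u"] z by simp
  with 1 len_mult[of z a] z show 2: "len (z \<otimes> a) = len z + len a"
    by simp
  show "z \<otimes> a \<preceq> u" unfolding prefix_le_def using 1 2 by simp
qed

lemma prefix_le_translate:
  assumes "z \<in> carrier G" "x \<in> carrier G" "y \<in> carrier G"
    "len (z \<otimes> x) = len z + len x" "len (z \<otimes> y) = len z + len y"
  shows "z \<otimes> x \<preceq> z \<otimes> y \<longleftrightarrow> x \<preceq> y"
  using assms by (simp add: prefix_le_def inv_mult_group m_assoc)

lemma prefix_le_trans:
  assumes c: "u \<in> carrier G" "v \<in> carrier G" "w \<in> carrier G" and le: "u \<preceq> v" "v \<preceq> w"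
  shows "u \<preceq> w"
proof -
  have "inv u \<otimes> w = (inv u \<otimes> v) \<otimes> (inv v \<otimes> w)"
    using c by (simp add: m_assoc)
  then have "len (inv u \<otimes> w) \<le> len (inv u \<otimes> v) + len (inv v \<otimes> w)"
    using len_mult[of "inv u \<otimes> v" "inv v \<otimes> w"] c by simp
  moreover have "len w \<le> len u + len (inv u \<otimes> w)"
    using len_mult[of u "inv u \<otimes> w"] c by simp
  ultimately show ?thesis
    using le by (simp add: prefix_le_def)
qed

lemma one_prefix_le: "x \<in> carrier G \<Longrightarrow> \<one> \<preceq> x"
  by (simp add: prefix_le_def)

lemma len_gen [simp]: "s \<in> S \<Longrightarrow> len (g s) = 1"
  using len_gen_mult_neq[of s \<one>] len_gen_le[of s] by simp

lemma gen_neq_one: "s \<in> S \<Longrightarrow> g s \<noteq> \<one>"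
  using len_gen by fastforce

lemma gen_prefix_le_iff: "s \<in> S \<Longrightarrow> x \<in> carrier G \<Longrightarrow> g s \<preceq> x \<longleftrightarrow> len (g s \<otimes> x) < len x"
  using len_le_gen_mult[of s x] by (auto simp: prefix_le_def inv_gen)

lemma gen_prefix_exists:
  assumes "x \<in> carrier G" "x \<noteq> \<one>"
  obtains s where "s \<in> S" "g s \<preceq> x"
  using left_descent_exists[OF assms] gen_prefix_le_iff[OF _ assms(1)] by (metis lessI)

text \<open>Some element of maximal length; its uniqueness and its role as top element come only
  with \<open>prefix_le_w0\<close> and \<open>eq_w0\<close>.\<close>

definition w0 :: 'g where
  "w0 = (SOME w. w \<in> carrier G \<and> (\<forall>u\<in>carrier G. len u \<le> len w))"

lemma w0_closed [simp]: "w0 \<in> carrier G" and len_le_w0: "u \<in> carrier G \<Longrightarrow> len u \<le> len w0"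
proof -
  obtain w where "w \<in> carrier G" "\<And>u. u \<in> carrier G \<Longrightarrow> len u \<le> len w"
    using ex_has_greatest_nat[of "\<lambda>w. w \<in> carrier G" \<one> len "Suc (Max (len ` carrier G))"]
      finite_carrier Max_ge[of "len ` carrier G"] by (auto simp: less_Suc_eq_le)
  then have "\<exists>w. w \<in> carrier G \<and> (\<forall>u\<in>carrier G. len u \<le> len w)" by blast
  from someI_ex[OF this, folded w0_def]
  show "w0 \<in> carrier G" "u \<in> carrier G \<Longrightarrow> len u \<le> len w0" by auto
qed

lemma prefix_le_w0: "u \<in> carrier G \<Longrightarrow> u \<preceq> w0"
  unfolding prefix_le_def
proof (rule all_left_descents)
  show "len (g s \<otimes> w0) < len w0" if "s \<in> S" for s
    using that len_gen_mult_neq[of s w0] len_le_w0[of "g s \<otimes> w0"] by simp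
qed auto

lemma eq_w0:
  assumes "x \<in> carrier G" "\<And>s. s \<in> S \<Longrightarrow> g s \<preceq> x"
  shows "x = w0"
proof -
  have "w0 \<preceq> x"
    unfolding prefix_le_def using assms by (intro all_left_descents) (auto simp: gen_prefix_le_iff)
  then show ?thesis
    using prefix_le_antisym[of w0 x] assms len_le_w0 by simp
qed

text \<open>Both generators are left descents of \<open>w0\<close>, so
  \<open>two_left_descents\<close> gives a finite label; the length of \<open>w0\<close> then forces
  the alternating word to be reduced.\<close>

lemma finite_label:
  assumes "s \<in> S" "t \<in> S" "s \<noteq> t"
  obtains n where "m s t = enat n" "2 \<le> n" "len (ev (alternating s t n)) = n"
proof -
  have "len (g r \<otimes> w0) < len w0" if "r \<in> S" for r
    using that prefix_le_w0[of "g r"] gen_prefix_le_iff[of r w0] by simp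
  then obtain n v where n: "m s t = enat n" and v: "v \<in> carrier G"
    "w0 = ev (alternating s t n) \<otimes> v" "len w0 = n + len v"
    using two_left_descents[of w0 s t] assms by auto
  have l: "alternating s t n \<in> lists S" by (simp add: alternating_in_lists assms)
  have "len w0 \<le> len (ev (alternating s t n)) + len v"
    unfolding v(2) using len_mult[of "ev (alternating s t n)" v] v(1) l by simp
  then have "len (ev (alternating s t n)) = n"
    using v(3) len_le[OF l] by simp
  then show thesis by (rule that[OF n label_ge_2[OF assms n]])
qed

text \<open>If \<open>g s = g t\<close>, the first two letters of the reduced word
  \<open>alternating s t n\<close> would cancel.\<close>

lemma gen_inj:
  assumes "s \<in> S" "t \<in> S" "g s = g t"
  shows "s = t"
proof (rule ccontr)
  assume "s \<noteq> t"
  then obtain n where n: "m s t = enat n" "2 \<le> n" "len (ev (alternating s t n)) = n"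
    using finite_label assms by metis
  obtain k where k: "n = Suc (Suc k)" using n(2) by (metis le_Suc_ex add_2_eq_Suc)
  have "ev (alternating s t n) = ev (alternating s t k)"
    using assms alternating_in_lists[of s S t k] by (simp add: k)
  then show False
    using n(3) len_le[of "alternating s t k"] alternating_in_lists[of s S t k] assms by (simp add: k)
qed

section \<open>Joins and meets in the weak order\<close>

lemma dihedral_prefix:
  assumes "x \<in> carrier G" "s \<in> S" "t \<in> S" "s \<noteq> t" "g s \<preceq> x" "g t \<preceq> x" "m s t = enat n"
  shows "ev (alternating s t n) \<preceq> x"
proof -
  have l: "alternating s t n \<in> lists S" by (simp add: alternating_in_lists assms)
  have "len (ev (alternating s t n)) = n" using finite_label[of s t] assms by (metis enat.inject)
  moreover obtain v where "v \<in> carrier G" "x = ev (alternating s t n) \<otimes> v" "len x = n + len v"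
    using two_left_descents[of x s t] assms by (auto simp: gen_prefix_le_iff)
  ultimately show ?thesis using prefix_le_mult[of "ev (alternating s t n)" v] l by simp
qed

text \<open>Together with \<open>dihedral_prefix\<close> this makes the alternating element the join
  of \<open>g s\<close> and \<open>g t\<close>, the rank two case from which all joins are
  built.\<close>

lemma gen_prefix_alternating:
  assumes "s \<in> S" "t \<in> S" "s \<noteq> t" "m s t = enat n"
  shows "g s \<preceq> ev (alternating s t n)" "g t \<preceq> ev (alternating s t n)"
proof -
  have *: "g s \<preceq> ev (alternating s t n)" if st: "s \<in> S" "t \<in> S" "s \<noteq> t" "m s t = enat n" for s t
  proof -
    obtain k where k: "n = Suc k" using label_ge_2[OF st] by (cases n) auto
    have l: "alternating t s k \<in> lists S" by (simp add: alternating_in_lists st)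
    have "len (ev (alternating s t n)) = n" using finite_label[of s t] st by (metis enat.inject)
    then have "len (g s \<otimes> ev (alternating t s k)) = Suc k" by (simp add: k)
    then show ?thesis
      using len_le[OF l] l st gen_prefix_le_iff[of s "ev (alternating s t n)"] by (simp add: k)
  qed
  show "g s \<preceq> ev (alternating s t n)" using * assms by blast
  show "g t \<preceq> ev (alternating s t n)" using *[of t s] assms braid label_sym by metis
qed

text \<open>
  The argument of Bjoerner, Edelman and Ziegler: joins of two covers of a common element exist
  by rank two considerations, and this propagates to all pairs above that element.
\<close>

lemma join_exists:
  assumes "z \<in> carrier G" "x \<in> carrier G" "y \<in> carrier G" "z \<preceq> x" "z \<preceq> y"
  shows "\<exists>j\<in>carrier G. x \<preceq> j \<and> y \<preceq> j \<and> (\<forall>v\<in>carrier G. x \<preceq> v \<longrightarrow> y \<preceq> v \<longrightarrow> j \<preceq> v)"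
  using assms
proof (induction "len w0 - len z" arbitrary: z x y rule: less_induct)
  case less
  note z = less.prems
  have up: "\<exists>s\<in>S. z \<otimes> g s \<preceq> u \<and> len (z \<otimes> g s) = Suc (len z) \<and> g s \<preceq> inv z \<otimes> u"
    if u: "u \<in> carrier G" "z \<preceq> u" "z \<noteq> u" for u
  proof -
    have "inv z \<otimes> u \<noteq> \<one>" using u z by (metis mult_inv_cancel r_one)
    then obtain s where s: "s \<in> S" "g s \<preceq> inv z \<otimes> u"
      using gen_prefix_exists[of "inv z \<otimes> u"] u z by auto
    then show ?thesis
      using prefix_le_mult_left[of z u "g s"] z u by auto
  qed
  show ?case
  proof (cases "z = x \<or> z = y")
    case True
    then show ?thesis using z prefix_le_refl by blast
  next
    case False
    then obtain s where s: "s \<in> S" "z \<otimes> g s \<preceq> x" "len (z \<otimes> g s) = Suc (len z)"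
      using up[of x] z by auto
    obtain t where t: "t \<in> S" "z \<otimes> g t \<preceq> y" "len (z \<otimes> g t) = Suc (len z)"
      using up[of y] z False by auto
    have smaller: "len w0 - len (z \<otimes> g r) < len w0 - len z"
      if "r \<in> S" "len (z \<otimes> g r) = Suc (len z)" for r
      using that len_le_w0[of "z \<otimes> g r"] z by simp
    have up_s: "z \<preceq> z \<otimes> g s" and up_t: "z \<preceq> z \<otimes> g t"
      using prefix_le_mult[of z "g s"] prefix_le_mult[of z "g t"] s t z by simp_all
    show ?thesis
    proof (cases "s = t")
      case True
      then show ?thesis
        using less.hyps[OF smaller[OF s(1,3)], of x y] s t z by auto
    next
      case False
      obtain n where n: "m s t = enat n" using finite_label[OF s(1) t(1) False] by metis
      define a where "a = ev (alternating s t n)"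
      have a: "a \<in> carrier G" unfolding a_def using alternating_in_lists[of s S t] s t by simp
      have above: "z \<otimes> a \<preceq> v \<and> len (z \<otimes> a) = len z + len a"
        if v: "v \<in> carrier G" "z \<otimes> g s \<preceq> v" "z \<otimes> g t \<preceq> v" for v
      proof -
        have zv: "z \<preceq> v" using prefix_le_trans[OF _ _ _ up_s v(2)] z s v by simp
        have gr: "g r \<preceq> inv z \<otimes> v" if r: "r \<in> S" "len (z \<otimes> g r) = Suc (len z)" "z \<otimes> g r \<preceq> v" for r
          using prefix_le_translate[of z "g r" "inv z \<otimes> v"] zv z v r by (simp add: prefix_le_def)
        have "a \<preceq> inv z \<otimes> v"
          unfolding a_def using dihedral_prefix[of "inv z \<otimes> v" s t n] gr s t n v z False by simp
        then show ?thesis using prefix_le_mult_left[of z v a] zv z v a by simp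
      qed
      have len_a: "len (z \<otimes> a) = len z + len a"
        using above[of w0] prefix_le_w0 z s t by simp
      have low: "z \<otimes> g s \<preceq> z \<otimes> a" "z \<otimes> g t \<preceq> z \<otimes> a"
        using prefix_le_translate[of z "g s" a] prefix_le_translate[of z "g t" a] len_a
          gen_prefix_alternating[OF s(1) t(1) False n] z s t a by (simp_all add: a_def)
      \<comment> \<open>\<open>p\<close> is the join of \<open>x\<close> and
        \<open>z \<otimes> a\<close> over \<open>z \<otimes> g s\<close>, and \<open>j\<close> that
        of \<open>p\<close> and \<open>y\<close> over \<open>z \<otimes> g t\<close>. Any common
        upper bound of \<open>x\<close> and \<open>y\<close> lies above both covers, hence above
        \<open>z \<otimes> a\<close>, so \<open>j\<close> is least.\<close>
      obtain p where p: "p \<in> carrier G" "x \<preceq> p" "z \<otimes> a \<preceq> p"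
        and p_least: "\<And>v. v \<in> carrier G \<Longrightarrow> x \<preceq> v \<Longrightarrow> z \<otimes> a \<preceq> v \<Longrightarrow> p \<preceq> v"
        using less.hyps[OF smaller[OF s(1,3)], of x "z \<otimes> a"] s z a low by auto
      have "z \<otimes> g t \<preceq> p" using prefix_le_trans[OF _ _ _ low(2) p(3)] z t a p by simp
      then obtain j where j: "j \<in> carrier G" "p \<preceq> j" "y \<preceq> j"
        and j_least: "\<And>v. v \<in> carrier G \<Longrightarrow> p \<preceq> v \<Longrightarrow> y \<preceq> v \<Longrightarrow> j \<preceq> v"
        using less.hyps[OF smaller[OF t(1,3)], of p y] t z p by auto
      show ?thesis
      proof (intro bexI conjI ballI impI)
        show "j \<in> carrier G" "y \<preceq> j" by fact+
        show "x \<preceq> j" using prefix_le_trans[OF _ _ _ p(2) j(2)] z p j by simp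
        fix v assume v: "v \<in> carrier G" "x \<preceq> v" "y \<preceq> v"
        have "z \<otimes> g s \<preceq> v" using prefix_le_trans[OF _ _ _ s(2) v(2)] z s v by simp
        moreover have "z \<otimes> g t \<preceq> v" using prefix_le_trans[OF _ _ _ t(2) v(3)] z t v by simp
        ultimately show "j \<preceq> v" using above p_least j_least v by blast
      qed
    qed
  qed
qed

text \<open>Take a common lower bound \<open>z\<close> of maximal length: its join with any other
  common lower bound is again one, so it equals \<open>z\<close>.\<close>

lemma meet_exists:
  assumes "x \<in> carrier G" "y \<in> carrier G"
  shows "\<exists>z. z \<in> carrier G \<and> z \<preceq> x \<and> z \<preceq> y \<and>
    (\<forall>u\<in>carrier G. u \<preceq> x \<longrightarrow> u \<preceq> y \<longrightarrow> u \<preceq> z)"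
proof -
  let ?P = "\<lambda>z. z \<in> carrier G \<and> z \<preceq> x \<and> z \<preceq> y"
  have "?P \<one>" using assms one_prefix_le by simp
  then obtain z where z: "?P z" and max: "\<And>u. ?P u \<Longrightarrow> len u \<le> len z"
    using ex_has_greatest_nat[of ?P \<one> len "Suc (len w0)"] len_le_w0
    by (auto simp: less_Suc_eq_le)
  have "u \<preceq> z" if u: "u \<in> carrier G" "u \<preceq> x" "u \<preceq> y" for u
  proof -
    obtain j where j: "j \<in> carrier G" "z \<preceq> j" "u \<preceq> j"
      "\<forall>v\<in>carrier G. z \<preceq> v \<longrightarrow> u \<preceq> v \<longrightarrow> j \<preceq> v"
      using join_exists[of \<one> z u] one_prefix_le z u by blast
    have "j \<preceq> x" "j \<preceq> y" using j(4) z u assms by blast+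
    then have "len j \<le> len z" using max j(1) by blast
    then have "z = j" using prefix_le_antisym[of z j] z j by blast
    then show ?thesis using j(3) by simp
  qed
  then show ?thesis using z by blast
qed

definition meet :: "'g \<Rightarrow> 'g \<Rightarrow> 'g" where
  "meet x y = (SOME z. z \<in> carrier G \<and> z \<preceq> x \<and> z \<preceq> y \<and>
    (\<forall>u\<in>carrier G. u \<preceq> x \<longrightarrow> u \<preceq> y \<longrightarrow> u \<preceq> z))"

lemma
  assumes "x \<in> carrier G" "y \<in> carrier G"
  shows meet_closed [simp]: "meet x y \<in> carrier G"
    and meet_le1: "meet x y \<preceq> x"
    and meet_le2: "meet x y \<preceq> y"
    and meet_greatest: "u \<in> carrier G \<Longrightarrow> u \<preceq> x \<Longrightarrow> u \<preceq> y \<Longrightarrow> u \<preceq> meet x y"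
  using someI_ex[OF meet_exists[OF assms], folded meet_def] by auto

lemma meet_eqI:
  assumes "x \<in> carrier G" "y \<in> carrier G" "z \<in> carrier G" "z \<preceq> x" "z \<preceq> y" "meet x y \<preceq> z"
  shows "meet x y = z"
  using prefix_le_antisym[of z "meet x y"] meet_greatest[of x y z] prefix_le_len[OF assms(6)] assms
  by simp

section \<open>Complements and the normalizing action\<close>

definition cmpl :: "'g \<Rightarrow> 'g" where
  "cmpl w = inv w \<otimes> w0"

lemma cmpl_closed [simp]: "w \<in> carrier G \<Longrightarrow> cmpl w \<in> carrier G"
  by (simp add: cmpl_def)

lemma mult_cmpl [simp]: "w \<in> carrier G \<Longrightarrow> w \<otimes> cmpl w = w0"
  by (simp add: cmpl_def)

lemma len_cmpl: "w \<in> carrier G \<Longrightarrow> len w0 = len w + len (cmpl w)"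
  using prefix_le_w0[of w] by (simp add: prefix_le_def cmpl_def)

text \<open>This is why \<open>act\<close> below uses \<open>meet v (cmpl w)\<close>: it is the
  largest prefix of \<open>v\<close> that \<open>w\<close> can take over with lengths
  adding.\<close>

lemma prefix_le_cmpl_iff:
  assumes "w \<in> carrier G" "v \<in> carrier G"
  shows "v \<preceq> cmpl w \<longleftrightarrow> len (w \<otimes> v) = len w + len v"
proof
  assume "v \<preceq> cmpl w"
  then show "len (w \<otimes> v) = len w + len v"
    using prefix_le_mult_left(2)[of w w0 v] prefix_le_w0 assms by (simp add: cmpl_def)
next
  assume "len (w \<otimes> v) = len w + len v"
  then show "v \<preceq> cmpl w"
    using prefix_le_translate[of w v "cmpl w"] prefix_le_w0[of "w \<otimes> v"] len_cmpl[of w] assms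
    by simp
qed

text \<open>
  Left multiplication of a product of simple elements, given by its list of factors, by a simple
  element \<open>w\<close>: the largest possible part of each factor is moved into its predecessor.
\<close>

fun act :: "'g \<Rightarrow> 'g list \<Rightarrow> 'g list" where
  "act w [] = (if w = \<one> then [] else [w])"
| "act w (v # vs) = (w \<otimes> meet v (cmpl w)) # act (inv (meet v (cmpl w)) \<otimes> v) vs"

lemma act_closed: "w \<in> carrier G \<Longrightarrow> L \<in> lists (carrier G) \<Longrightarrow> act w L \<in> lists (carrier G)"
  by (induction w L rule: act.induct) auto

lemma act_one: "L \<in> lists (carrier G) \<Longrightarrow> act \<one> L = L"
proof (induction L)
  case (Cons v vs)
  have "meet v (cmpl \<one>) = v"
    using Cons.prems prefix_le_w0[of v] by (intro meet_eqI) (auto simp: cmpl_def prefix_le_refl meet_le1)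
  then show ?case using Cons by simp
qed simp

text \<open>Both sides of a braid relation are reduced words of one element, so compatibility with
  length-additive products is enough for words modulo braid relations to act. The heads agree
  because \<open>w\<close> takes from \<open>w' \<otimes> u'\<close> exactly
  \<open>w' \<otimes> u\<close>, where \<open>u'\<close> and \<open>u\<close> are the parts of
  \<open>v\<close> taken by \<open>w'\<close> and by \<open>w \<otimes> w'\<close>.\<close>

lemma act_mult:
  assumes "w \<in> carrier G" "w' \<in> carrier G" "L \<in> lists (carrier G)"
    "len (w \<otimes> w') = len w + len w'"
  shows "act (w \<otimes> w') L = act w (act w' L)"
  using assms
proof (induction L arbitrary: w w')
  case Nil
  show ?case
  proof (cases "w' = \<one>")
    case False
    have "w' \<preceq> cmpl w" using Nil by (simp add: prefix_le_cmpl_iff)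
    then have "meet w' (cmpl w) = w'"
      using Nil by (intro meet_eqI) (auto simp: prefix_le_refl meet_le1)
    moreover have "w \<otimes> w' \<noteq> \<one>"
      using Nil False len_eq_0[of w'] by (metis add_eq_0_iff_both_eq_0 len_one)
    ultimately show ?thesis using Nil False by simp
  qed (use Nil in simp)
next
  case (Cons v vs)
  note ww' = \<open>w \<in> carrier G\<close> \<open>w' \<in> carrier G\<close>
  have v: "v \<in> carrier G" "vs \<in> lists (carrier G)" using Cons by simp_all
  define u where "u = meet v (cmpl (w \<otimes> w'))"
  define u' where "u' = meet v (cmpl w')"
  have u: "u \<in> carrier G" "u' \<in> carrier G" unfolding u_def u'_def using ww' v by simp_all
  have w': "w' \<otimes> cmpl (w \<otimes> w') = cmpl w"
    using ww' by (simp add: cmpl_def inv_mult_group m_assoc)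
  have w'_le: "w' \<preceq> cmpl w" using ww' Cons.prems by (simp add: prefix_le_cmpl_iff)
  have len1: "len (w' \<otimes> cmpl (w \<otimes> w')) = len w' + len (cmpl (w \<otimes> w'))"
    using w'_le ww' unfolding prefix_le_def
    by (simp add: w') (simp add: cmpl_def inv_mult_group m_assoc)
  have cc: "cmpl (w \<otimes> w') \<preceq> cmpl w'"
    using prefix_le_cmpl_iff[of w' "cmpl (w \<otimes> w')"] len1 ww' by simp
  have u_v: "u \<preceq> v" and u_c: "u \<preceq> cmpl (w \<otimes> w')" and u'_v: "u' \<preceq> v" and u'_c: "u' \<preceq> cmpl w'"
    unfolding u_def u'_def using v ww' by (simp_all add: meet_le1 meet_le2)
  have u_c': "u \<preceq> cmpl w'" using prefix_le_trans[OF _ _ _ u_c cc] u ww' by simp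
  have uu': "u \<preceq> u'" unfolding u'_def using meet_greatest u_v u_c' u v ww' by simp
  have len_u: "len (w' \<otimes> u) = len w' + len u" and len_u': "len (w' \<otimes> u') = len w' + len u'"
    using u_c' u'_c u ww' by (simp_all add: prefix_le_cmpl_iff)
  define x where "x = meet (w' \<otimes> u') (cmpl w)"
  have x: "x \<in> carrier G" "x \<preceq> w' \<otimes> u'" "x \<preceq> cmpl w"
    unfolding x_def using u ww' by (simp_all add: meet_le1 meet_le2)
  have "x = w' \<otimes> u"
    unfolding x_def
  proof (rule meet_eqI, unfold x_def[symmetric])
    show "w' \<otimes> u \<preceq> w' \<otimes> u'"
      using prefix_le_translate[of w' u u'] uu' len_u len_u' u ww' by simp
    show "w' \<otimes> u \<preceq> cmpl w"
      using prefix_le_translate[of w' u "cmpl (w \<otimes> w')"] u_c len_u len1 u ww' w' by simp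
    \<comment> \<open>As \<open>w'\<close> lies below the meet \<open>x\<close>, it can be stripped
      off; the rest \<open>y\<close> is a common prefix of \<open>v\<close> and
      \<open>cmpl (w \<otimes> w')\<close>, so of \<open>u\<close>.\<close>
    have w'x: "w' \<preceq> x"
      unfolding x_def using meet_greatest[of "w' \<otimes> u'" "cmpl w" w'] w'_le
        prefix_le_mult[of w' u'] len_u' u ww' by simp
    define y where "y = inv w' \<otimes> x"
    have y: "y \<in> carrier G" "x = w' \<otimes> y" unfolding y_def using x ww' by simp_all
    have len_y: "len (w' \<otimes> y) = len w' + len y"
      using w'x ww' y by (simp add: prefix_le_def)
    have "y \<preceq> u'"
      using prefix_le_translate[of w' y u'] x len_y len_u' u ww' y by simp
    then have "y \<preceq> v" using prefix_le_trans[OF _ _ _ _ u'_v] u v y by simp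
    moreover have "y \<preceq> cmpl (w \<otimes> w')"
      using prefix_le_translate[of w' y "cmpl (w \<otimes> w')"] x len_y len1 u ww' y w' by simp
    ultimately have "y \<preceq> u" unfolding u_def using meet_greatest v ww' y by simp
    then show "x \<preceq> w' \<otimes> u"
      using prefix_le_translate[of w' y u] len_y len_u u ww' y by simp
  qed (use u ww' in auto)
  then have x_eq: "meet (w' \<otimes> u') (cmpl w) = w' \<otimes> u" by (simp add: x_def)
  \<comment> \<open>What \<open>w \<otimes> w'\<close> leaves of \<open>v\<close> is the
    length-additive product of what \<open>w\<close> leaves of the new head and what
    \<open>w'\<close> leaves of \<open>v\<close>, so the induction hypothesis applies to the
    tail.\<close>
  have fac: "(inv u \<otimes> u') \<otimes> (inv u' \<otimes> v) = inv u \<otimes> v" using u v by (simp add: m_assoc)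
  have "len ((inv u \<otimes> u') \<otimes> (inv u' \<otimes> v)) = len (inv u \<otimes> u') + len (inv u' \<otimes> v)"
    using uu' u_v u'_v unfolding fac prefix_le_def by simp
  then have "act (inv u \<otimes> v) vs = act (inv u \<otimes> u') (act (inv u' \<otimes> v) vs)"
    using Cons.IH[of "inv u \<otimes> u'" "inv u' \<otimes> v"] u v by (simp add: fac)
  moreover have "inv (w' \<otimes> u) \<otimes> (w' \<otimes> u') = inv u \<otimes> u'"
    using u ww' by (simp add: inv_mult_group m_assoc)
  ultimately show ?case
    using u ww' by (simp add: x_eq m_assoc flip: u_def u'_def)
qed

text \<open>The complement of \<open>w0\<close> is trivial, so nothing is moved into the new first
  factor.\<close>

lemma act_w0: "v \<in> carrier G \<Longrightarrow> act w0 (v # vs) = w0 # act v vs"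
proof -
  assume v: "v \<in> carrier G"
  have "meet v (cmpl w0) = \<one>"
  proof (rule prefix_le_antisym[symmetric])
    show "\<one> \<preceq> meet v (cmpl w0)" using one_prefix_le v by simp
    show "len (meet v (cmpl w0)) \<le> len \<one>"
      using prefix_le_len[OF meet_le2[of v "cmpl w0"]] v by (simp add: cmpl_def)
  qed (use v in auto)
  then show ?thesis using v by simp
qed

end

section \<open>The positive monoid\<close>

inductive braid_step :: "'a set \<Rightarrow> ('a \<Rightarrow> 'a \<Rightarrow> enat) \<Rightarrow> 'a list \<Rightarrow> 'a list \<Rightarrow> bool" for S m where
  "s \<in> S \<Longrightarrow> t \<in> S \<Longrightarrow> s \<noteq> t \<Longrightarrow> m s t = enat n \<Longrightarrow>
    braid_step S m (u @ alternating s t n @ v) (u @ alternating t s n @ v)"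

text \<open>Equality in the monoid presented by the braid relations; that it is also equality of
  positive words in the group is proved only in \<open>positive_element_eq\<close>.\<close>

definition braid_eq :: "'a set \<Rightarrow> ('a \<Rightarrow> 'a \<Rightarrow> enat) \<Rightarrow> 'a list \<Rightarrow> 'a list \<Rightarrow> bool" where
  "braid_eq S m = (braid_step S m)\<^sup>*\<^sup>*"

lemma braid_eq_refl [simp]: "braid_eq S m w w"
  by (simp add: braid_eq_def)

lemma braid_eq_trans [trans]: "braid_eq S m u v \<Longrightarrow> braid_eq S m v w \<Longrightarrow> braid_eq S m u w"
  by (simp add: braid_eq_def)

lemma braid_eq_sym:
  assumes "coxeter_matrix S m" "braid_eq S m v w"
  shows "braid_eq S m w v"
proof -
  have "symp (braid_step S m)"
  proof (rule sympI)
    fix v w assume "braid_step S m v w"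
    then show "braid_step S m w v"
    proof cases
      case (1 s t n u u')
      moreover have "m t s = enat n" using 1 assms(1) by (simp add: coxeter_matrix_def)
      ultimately show ?thesis using braid_step.intros[of t S s m n u u'] by simp
    qed
  qed
  then show ?thesis
    using assms(2) unfolding braid_eq_def by (metis sympD symp_rtranclp)
qed

lemma braid_eq_context: "braid_eq S m v w \<Longrightarrow> braid_eq S m (a @ v @ b) (a @ w @ b)"
  unfolding braid_eq_def
proof (induction rule: rtranclp_induct)
  case (step y z)
  from step.hyps(2) have "braid_step S m (a @ y @ b) (a @ z @ b)"
  proof cases
    case (1 s t n u v)
    then show ?thesis using braid_step.intros[of s S t m n "a @ u" "v @ b"] by simp
  qed
  then show ?case using step.IH by simp
qed simp

lemma braid_eq_append: "braid_eq S m v v' \<Longrightarrow> braid_eq S m w w' \<Longrightarrow> braid_eq S m (v @ w) (v' @ w')"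
  using braid_eq_context[of S m v v' "[]" w] braid_eq_context[of S m w w' v' "[]"]
  by (auto intro: braid_eq_trans)

lemma braid_eq_Cons: "braid_eq S m v w \<Longrightarrow> braid_eq S m (s # v) (s # w)"
  using braid_eq_context[of S m v w "[s]" "[]"] by simp

lemma braid_eq_alternating:
  "s \<in> S \<Longrightarrow> t \<in> S \<Longrightarrow> s \<noteq> t \<Longrightarrow> m s t = enat n \<Longrightarrow>
    braid_eq S m (alternating s t n) (alternating t s n)"
  unfolding braid_eq_def using braid_step.intros[of s S t m n "[]" "[]"] by auto

lemma braid_eq_length: "braid_eq S m v w \<Longrightarrow> length v = length w"
  unfolding braid_eq_def
  by (induction rule: rtranclp_induct) (auto elim!: braid_step.cases)

lemma set_alternating_eq: "2 \<le> n \<Longrightarrow> set (alternating s t n) = {s, t}"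
  using set_alternating[of s t n] by (cases "(s, t, n)" rule: alternating.cases) (auto simp: numeral_2_eq_2 Suc_le_eq gr0_conv_Suc)

text \<open>Labels are at least 2, so both sides of a relation contain both letters. The invariant
  shows later that a word missing a letter is not divisible by \<open>delta\<close>.\<close>

lemma braid_eq_set:
  assumes "coxeter_matrix S m" "braid_eq S m v w"
  shows "set v = set w"
  using assms(2) unfolding braid_eq_def
proof (induction rule: rtranclp_induct)
  case (step y z)
  from step.hyps(2) show ?case
  proof cases
    case (1 s t n u v)
    then have "2 \<le> n"
      using assms(1) unfolding coxeter_matrix_def by (metis enat_ord_simps(1) numeral_eq_enat)
    then show ?thesis using 1 step.IH by (auto simp: set_alternating_eq)
  qed
qed simp

lemma braid_eq_lists: "coxeter_matrix S m \<Longrightarrow> braid_eq S m v w \<Longrightarrow> v \<in> lists A \<longleftrightarrow> w \<in> lists A"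
  using braid_eq_set[of S m v w] by (simp add: in_lists_conv_set)

context finite_coxeter
begin

section \<open>Reduced words and Matsumoto's theorem\<close>

abbreviation beq :: "'a list \<Rightarrow> 'a list \<Rightarrow> bool" (infix "\<approx>" 50) where
  "v \<approx> w \<equiv> braid_eq S m v w"

lemmas beq_sym = braid_eq_sym[OF coxeter]

text \<open>If the first letters \<open>s\<close> and \<open>t\<close> differ, both are left
  descents, so the element starts with the alternating word of length \<open>m s t\<close>; its two
  forms link the given words, and the tails are shorter.\<close>

theorem matsumoto:
  assumes "v \<in> lists S" "w \<in> lists S" "ev v = ev w" "length v = len (ev v)" "length w = len (ev w)"
  shows "v \<approx> w"
  using assms
proof (induction "length v" arbitrary: v w rule: less_induct)
  case less
  show ?case
  proof (cases v)
    case Nil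
    then have "w = []" using less.prems by simp
    then show ?thesis using Nil by simp
  next
    case (Cons s v')
    then obtain t w' where w: "w = t # w'" using less.prems by (cases w) auto
    have st: "s \<in> S" "t \<in> S" "v' \<in> lists S" "w' \<in> lists S" using less.prems Cons w by auto
    have red: "u \<in> lists S \<Longrightarrow> r \<in> S \<Longrightarrow> length (r # u) = len (ev (r # u)) \<Longrightarrow>
      length u = len (ev u)" for r u
      using len_le[of u] len_gen_mult_le[of r "ev u"] by simp
    have red': "length v' = len (ev v')" "length w' = len (ev w')"
      using red[of v' s] red[of w' t] less.prems Cons w st by simp_all
    show ?thesis
    proof (cases "s = t")
      case True
      then have "g s \<otimes> (g s \<otimes> ev v') = g s \<otimes> (g s \<otimes> ev w')" using less.prems Cons w by simp
      then have "ev v' = ev w'" using st by simp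
      then have "v' \<approx> w'" using less.hyps[of v' w'] Cons st red' by simp
      then show ?thesis using True Cons w by (simp add: braid_eq_Cons)
    next
      case False
      define x where "x = ev v"
      have x: "x \<in> carrier G" "x = ev w" using less.prems by (simp_all add: x_def)
      have "len (g s \<otimes> x) < len x" "len (g t \<otimes> x) < len x"
      proof -
        have "g s \<otimes> x = ev v'" by (simp add: x_def Cons st)
        moreover have "g t \<otimes> x = ev w'" by (simp add: x(2) w st)
        moreover have "Suc (length v') = len x" "Suc (length w') = len x"
          using less.prems(4,5) x(2) unfolding Cons w x_def by (metis length_Cons)+
        ultimately show "len (g s \<otimes> x) < len x" "len (g t \<otimes> x) < len x"
          using red' by simp_all
      qed
      then obtain n y where n: "m s t = enat n" and y: "y \<in> carrier G"
          "x = ev (alternating s t n) \<otimes> y" "len x = n + len y"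
        using two_left_descents[OF x(1) st(1,2) False] by auto
      obtain r where r: "r \<in> lists S" "ev r = y" "length r = len y"
        using reduced_word y by metis
      obtain k where k: "n = Suc k" using label_ge_2[OF st(1,2) False n] by (cases n) auto
      have alt: "alternating s t j \<in> lists S" "alternating t s j \<in> lists S" for j
        using st by (simp_all add: alternating_in_lists)
      let ?v = "alternating t s k @ r" and ?w = "alternating s t k @ r"
      have ev1: "ev (s # ?v) = x" using y r st alt by (simp add: k ev_append m_assoc)
      have "ev (t # ?w) = ev (alternating t s n) \<otimes> y"
        using y(1) r st alt by (simp add: k ev_append m_assoc)
      then have ev2: "ev (t # ?w) = x"
        using y(2) braid[OF st(1,2) False n] by simp
      have l: "length (s # ?v) = len x" "length (t # ?w) = len x"
        using y(3) r k by simp_all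
      have redv: "length ?v = len (ev ?v)" and redw: "length ?w = len (ev ?w)"
        using red[of ?v s] red[of ?w t] l ev1 ev2 st r alt by auto
      have "g s \<otimes> (g s \<otimes> ev v') = g s \<otimes> (g s \<otimes> ev ?v)"
        using ev1 Cons by (simp add: x_def)
      then have "v' \<approx> ?v"
        using less.hyps[of v' ?v] Cons st r alt red' redv by (simp del: ev_Cons)
      moreover have "g t \<otimes> (g t \<otimes> ev w') = g t \<otimes> (g t \<otimes> ev ?w)"
        using ev2 w x by simp
      then have "?w \<approx> w'"
        using less.hyps[of ?w w'] w st r alt red' redw l less.prems Cons
        by (simp del: ev_Cons add: x_def)
      moreover have "s # ?v \<approx> t # ?w"
        using braid_eq_append[OF braid_eq_alternating[of s S t m n] braid_eq_refl[of S m r]] st False n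
        by (simp add: k)
      ultimately show ?thesis
        unfolding Cons w by (meson braid_eq_Cons braid_eq_trans)
    qed
  qed
qed

text \<open>The lift of \<open>W\<close> into the monoid; by \<open>matsumoto\<close> it does not
  depend on the choice up to \<open>\<approx>\<close>, and it is multiplicative where lengths add
  (\<open>red_mult\<close>).\<close>

definition red :: "'g \<Rightarrow> 'a list" where
  "red x = (SOME w. w \<in> lists S \<and> ev w = x \<and> length w = len x)"

lemma
  assumes "x \<in> carrier G"
  shows red_closed [simp]: "red x \<in> lists S" and ev_red [simp]: "ev (red x) = x"
    and length_red [simp]: "length (red x) = len x"
proof -
  have "\<exists>w. w \<in> lists S \<and> ev w = x \<and> length w = len x"
    using reduced_word[OF assms] by metis
  from someI_ex[OF this, folded red_def]
  show "red x \<in> lists S" "ev (red x) = x" "length (red x) = len x" by auto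
qed

lemma red_ev: "w \<in> lists S \<Longrightarrow> length w = len (ev w) \<Longrightarrow> red (ev w) \<approx> w"
  by (intro matsumoto) simp_all

lemma red_gen: "s \<in> S \<Longrightarrow> red (g s) \<approx> [s]"
  using red_ev[of "[s]"] by simp

lemma red_one: "red \<one> = []"
  using length_red[of \<one>] by (simp del: length_red)

lemma red_mult:
  assumes "x \<in> carrier G" "y \<in> carrier G" "len (x \<otimes> y) = len x + len y"
  shows "red (x \<otimes> y) \<approx> red x @ red y"
  using assms by (intro matsumoto) (simp_all add: ev_append)

section \<open>Normal forms of positive words and divisibility by \<open>delta\<close>\<close>

definition word_act :: "'a list \<Rightarrow> 'g list \<Rightarrow> 'g list" where
  "word_act w L = foldr (\<lambda>s. act (g s)) w L"

lemma word_act_Nil [simp]: "word_act [] L = L"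
  by (simp add: word_act_def)

lemma word_act_Cons [simp]: "word_act (s # w) L = act (g s) (word_act w L)"
  by (simp add: word_act_def)

lemma word_act_append: "word_act (v @ w) L = word_act v (word_act w L)"
  by (simp add: word_act_def)

lemma word_act_closed [simp]:
  "w \<in> lists S \<Longrightarrow> L \<in> lists (carrier G) \<Longrightarrow> word_act w L \<in> lists (carrier G)"
  by (induction w) (simp_all add: act_closed)

lemma word_act_reduced:
  assumes "w \<in> lists S" "length w = len (ev w)" "L \<in> lists (carrier G)"
  shows "word_act w L = act (ev w) L"
  using assms
proof (induction w rule: list.induct)
  case Nil
  then show ?case by (simp add: act_one)
next
  case (Cons s w)
  then have "length w = len (ev w)"
    using len_le[of w] len_gen_mult_le[of s "ev w"] by simp
  then show ?case
    using Cons act_mult[of "g s" "ev w" L] by simp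
qed

lemma word_act_red: "x \<in> carrier G \<Longrightarrow> L \<in> lists (carrier G) \<Longrightarrow> word_act (red x) L = act x L"
  using word_act_reduced[of "red x" L] by simp

text \<open>By \<open>finite_label\<close> both sides of a braid relation are reduced, so each acts
  as their common value does.\<close>

lemma beq_word_act:
  assumes "v \<approx> w" "v \<in> lists S" "L \<in> lists (carrier G)"
  shows "word_act v L = word_act w L"
  using assms(1) unfolding braid_eq_def
proof (induction rule: rtranclp_induct)
  case (step y z)
  have y: "y \<in> lists S"
    using step assms(2) braid_eq_lists[OF coxeter, of v y S] by (simp add: braid_eq_def)
  from step.hyps(2) have "word_act y L = word_act z L"
  proof cases
    case (1 s t n u v)
    have a: "alternating s t n \<in> lists S" "alternating t s n \<in> lists S"
      using 1 by (simp_all add: alternating_in_lists)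
    have l: "len (ev (alternating s t n)) = n" using finite_label[of s t] 1 by (metis enat.inject)
    have v: "word_act v L \<in> lists (carrier G)" using y 1 assms(3) by simp
    have "word_act (alternating s t n) (word_act v L) = word_act (alternating t s n) (word_act v L)"
      using a l v braid[of s t n] 1 by (simp add: word_act_reduced)
    then show ?thesis using 1 by (simp add: word_act_append)
  qed
  then show ?case using step by simp
qed simp

definition list_word :: "'g list \<Rightarrow> 'a list" where
  "list_word L = concat (map red L)"

lemma list_word_simps [simp]: "list_word [] = []" "list_word (x # L) = red x @ list_word L"
  by (simp_all add: list_word_def)

lemma list_word_closed [simp]: "L \<in> lists (carrier G) \<Longrightarrow> list_word L \<in> lists S"
  by (induction L) simp_all

text \<open>Each step of \<open>act\<close> regroups \<open>w\<close>, \<open>u\<close> and the rest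
  of \<open>v\<close> with lengths adding, and \<open>red\<close> respects such regroupings.\<close>

lemma list_word_act:
  "w \<in> carrier G \<Longrightarrow> L \<in> lists (carrier G) \<Longrightarrow> list_word (act w L) \<approx> red w @ list_word L"
proof (induction w L rule: act.induct)
  case (1 w)
  then show ?case by (simp add: red_one)
next
  case (2 w v vs)
  then have v: "v \<in> carrier G" "vs \<in> lists (carrier G)" by simp_all
  define u where "u = meet v (cmpl w)"
  have u: "u \<in> carrier G" using 2 v by (simp add: u_def)
  have "u \<preceq> cmpl w" "u \<preceq> v" unfolding u_def using 2 v by (simp_all add: meet_le1 meet_le2)
  then have len: "len (w \<otimes> u) = len w + len u" "len (u \<otimes> (inv u \<otimes> v)) = len u + len (inv u \<otimes> v)"
    using 2 u v by (simp_all add: prefix_le_cmpl_iff) (simp add: prefix_le_def)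
  let ?r = "inv u \<otimes> v"
  have "list_word (act w (v # vs)) = red (w \<otimes> u) @ list_word (act ?r vs)"
    by (simp add: u_def)
  also have "\<dots> \<approx> (red w @ red u) @ (red ?r @ list_word vs)"
    using red_mult[of w u] len 2 u v by (intro braid_eq_append) (auto simp: u_def)
  also have "\<dots> = red w @ (red u @ red ?r) @ list_word vs" by simp
  also have "\<dots> \<approx> red w @ red v @ list_word vs"
    using red_mult[of u ?r] len u v by (intro braid_eq_context) (simp add: beq_sym)
  finally show ?case by simp
qed

text \<open>With \<open>beq_word_act\<close> this makes \<open>word_act w []\<close> a complete
  invariant of the class of \<open>w\<close>.\<close>

lemma list_word_word_act: "w \<in> lists S \<Longrightarrow> list_word (word_act w []) \<approx> w"
proof (induction w)
  case (Cons s w)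
  then have "list_word (act (g s) (word_act w [])) \<approx> red (g s) @ list_word (word_act w [])"
    by (intro list_word_act) simp_all
  also have "\<dots> \<approx> [s] @ w" using Cons by (intro braid_eq_append red_gen) simp_all
  finally show ?case by simp
qed simp

definition delta :: "'a list" where "delta = red w0"

lemma delta_closed [simp]: "delta \<in> lists S"
  by (simp add: delta_def)

text \<open>Multiplication by \<open>delta\<close> puts \<open>w0\<close> in front of the normal
  form (\<open>act_w0\<close>), so removing the head recovers the class of \<open>x\<close>.\<close>

lemma delta_cancel:
  assumes "x \<in> lists S" "y \<in> lists S" "delta @ x \<approx> delta @ y"
  shows "x \<approx> y"
proof -
  have tail: "list_word (tl (act w0 L)) \<approx> list_word L" if "L \<in> lists (carrier G)" for L
  proof (cases L)
    case (Cons v vs)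
    then have "v \<in> carrier G" "vs \<in> lists (carrier G)" using that by simp_all
    then show ?thesis using Cons list_word_act by (simp add: act_w0 del: act.simps)
  qed simp
  have *: "list_word (tl (word_act (delta @ x) [])) \<approx> x" if "x \<in> lists S" for x
    using tail[of "word_act x []"] list_word_word_act[OF that] that
    by (simp add: delta_def word_act_append word_act_red) (metis braid_eq_trans)
  have "word_act (delta @ x) [] = word_act (delta @ y) []"
    using beq_word_act[OF assms(3), of "[]"] assms by simp
  then show ?thesis using *[OF assms(1)] *[OF assms(2)] by (metis beq_sym braid_eq_trans)
qed

text \<open>A generator dividing \<open>c\<close> from the left shows in the first factor of its
  normal form, so divisibility by generators can be tested in \<open>W\<close>.\<close>

lemma head_word_act:
  assumes "c \<approx> s # y" "s \<in> S" "y \<in> lists S"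
  obtains h L where "word_act c [] = h # L" "h \<in> carrier G" "L \<in> lists (carrier G)" "g s \<preceq> h"
proof -
  have "s # y \<approx> c" using assms beq_sym by simp
  then have c: "word_act c [] = act (g s) (word_act y [])"
    using beq_word_act[of "s # y" c "[]"] assms by simp
  have cl: "word_act y [] \<in> lists (carrier G)" using assms by simp
  show thesis
  proof (cases "word_act y []")
    case Nil
    then show thesis using c assms by (intro that[of "g s" "[]"]) (simp_all add: gen_neq_one prefix_le_refl)
  next
    case (Cons v vs)
    then have v: "v \<in> carrier G" "vs \<in> lists (carrier G)" using cl by simp_all
    define u where "u = meet v (cmpl (g s))"
    have "u \<in> carrier G" using v assms by (simp add: u_def)
    moreover have "u \<preceq> cmpl (g s)" using v assms by (simp add: u_def meet_le2)
    ultimately have "g s \<preceq> g s \<otimes> u"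
      using assms by (intro prefix_le_mult) (simp_all add: prefix_le_cmpl_iff)
    then show thesis
      using c Cons v assms \<open>u \<in> carrier G\<close>
      by (intro that[of "g s \<otimes> u" "act (inv u \<otimes> v) vs"]) (simp_all add: u_def act_closed)
  qed
qed

text \<open>All generators lie below the head of the normal form of \<open>c\<close>, which is then
  \<open>w0\<close>.\<close>

lemma delta_least:
  assumes c: "c \<in> lists S" and div: "\<And>s. s \<in> S \<Longrightarrow> \<exists>y\<in>lists S. c \<approx> s # y"
  obtains y where "y \<in> lists S" "c \<approx> delta @ y"
proof -
  have cl: "word_act c [] \<in> lists (carrier G)" using c by simp
  obtain s where s: "s \<in> S" using nonempty by auto
  then obtain h L where h: "word_act c [] = h # L"
    using div[OF s] head_word_act by metis
  then have hL: "h \<in> carrier G" "L \<in> lists (carrier G)" using cl by simp_all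
  have "g s \<preceq> h" if "s \<in> S" for s
    using div[OF that] head_word_act[of c s] that h by (metis list.inject)
  then have "h = w0" using eq_w0 hL by simp
  then have "list_word (word_act c []) = delta @ list_word L"
    using h by (simp add: delta_def)
  then have "c \<approx> delta @ list_word L"
    using list_word_word_act[OF c] beq_sym by metis
  then show thesis by (rule that[rotated]) (use hL in simp)
qed

lemma delta_gen:
  assumes "s \<in> S"
  obtains y where "y \<in> lists S" "delta \<approx> s # y"
proof -
  let ?y = "cmpl (g s)"
  have "delta \<approx> red (g s) @ red ?y"
    unfolding delta_def using red_mult[of "g s" ?y] len_cmpl[of "g s"] assms by simp
  also have "\<dots> \<approx> [s] @ red ?y" using assms by (intro braid_eq_append red_gen) simp_all
  finally show thesis using that[of "red ?y"] assms by simp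
qed

section \<open>Conjugation by the longest element and left cancellation\<close>

lemma w0_square: "w0 \<otimes> w0 = \<one>"
proof -
  have "inv w0 = w0"
    using prefix_le_antisym[of "inv w0" w0] prefix_le_w0[of "inv w0"] len_inv[of w0] by simp
  then show ?thesis using r_inv[of w0] by simp
qed

lemma w0_cancel [simp]: "x \<in> carrier G \<Longrightarrow> w0 \<otimes> (w0 \<otimes> x) = x"
  by (simp add: m_assoc[symmetric] w0_square)

lemma inv_w0: "inv w0 = w0"
  using w0_square inv_equality by simp

text \<open>With \<open>t\<close> the conjugate, \<open>w0\<close> is the length-additive product of
  \<open>t\<close> and \<open>w0 \<otimes> g s\<close>; the second factor has length
  \<open>len w0 - 1\<close>, so \<open>t\<close> has length 1.\<close>

lemma w0_conj_gen:
  assumes "s \<in> S"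
  shows "\<exists>t\<in>S. g t = w0 \<otimes> g s \<otimes> w0"
proof -
  let ?t = "w0 \<otimes> g s \<otimes> w0"
  have "inv ?t \<otimes> w0 = w0 \<otimes> g s"
    using assms by (simp add: inv_mult_group inv_w0 inv_gen m_assoc w0_square)
  then have "len w0 = len ?t + len (w0 \<otimes> g s)"
    using prefix_le_w0[of ?t] assms by (simp add: prefix_le_def)
  moreover have "len (w0 \<otimes> g s) = len (g s \<otimes> w0)"
    using len_inv[of "w0 \<otimes> g s"] assms by (simp add: inv_mult_group inv_w0 inv_gen)
  moreover have "len w0 = 1 + len (g s \<otimes> w0)"
    using prefix_le_w0[of "g s"] assms by (simp add: prefix_le_def inv_gen)
  ultimately have "len ?t = 1" by simp
  then obtain w where w: "w \<in> lists S" "ev w = ?t" "length w = 1"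
    using reduced_word[of ?t] assms by (metis m_closed gen_closed w0_closed)
  then obtain t where "w = [t]" by (metis One_nat_def length_0_conv length_Suc_conv)
  then show ?thesis using w by auto
qed

text \<open>Classically the opposition involution.\<close>

definition twist :: "'a \<Rightarrow> 'a" where
  "twist s = (SOME t. t \<in> S \<and> g t = w0 \<otimes> g s \<otimes> w0)"

lemma
  assumes "s \<in> S"
  shows twist_closed [simp]: "twist s \<in> S" and gen_twist: "g (twist s) = w0 \<otimes> g s \<otimes> w0"
proof -
  have "\<exists>t. t \<in> S \<and> g t = w0 \<otimes> g s \<otimes> w0" using w0_conj_gen[OF assms] by blast
  from someI_ex[OF this, folded twist_def]
  show "twist s \<in> S" "g (twist s) = w0 \<otimes> g s \<otimes> w0" by auto
qed

lemma twist_twist [simp]: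
  assumes "s \<in> S"
  shows "twist (twist s) = s"
proof (rule gen_inj)
  show "g (twist (twist s)) = g s"
    using assms by (simp add: gen_twist m_assoc w0_square)
qed (use assms in simp_all)

lemma map_twist_closed [simp]: "w \<in> lists S \<Longrightarrow> map twist w \<in> lists S"
  by (induction w) simp_all

lemma map_twist_twist [simp]: "w \<in> lists S \<Longrightarrow> map (twist \<circ> twist) w = w"
  by (induction w) simp_all

text \<open>With \<open>x\<close> the element \<open>w0 \<otimes> g s\<close>, \<open>delta\<close>
  lifts both \<open>twist s\<close> times \<open>x\<close> and \<open>x\<close> times
  \<open>s\<close>; both sides become the product of \<open>twist s\<close>, \<open>x\<close> and
  \<open>s\<close>.\<close>

lemma delta_gen_commute:
  assumes "s \<in> S"
  shows "delta @ [s] \<approx> [twist s] @ delta"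
proof -
  let ?t = "g (twist s)" and ?x = "w0 \<otimes> g s"
  have x: "?x \<in> carrier G" "?t \<otimes> ?x = w0" "?x \<otimes> g s = w0"
    using assms gen_square[OF assms] by (simp_all add: gen_twist m_assoc)
  have "inv ?t \<otimes> w0 = ?x" using x inv_gen[of "twist s"] assms by (metis gen_cancel twist_closed)
  then have l: "len w0 = 1 + len ?x"
    using prefix_le_w0[of ?t] assms by (simp add: prefix_le_def)
  have "delta @ [s] \<approx> (red ?t @ red ?x) @ [s]"
    unfolding delta_def using red_mult[of ?t ?x] x l assms by (intro braid_eq_append) simp_all
  also have "\<dots> \<approx> ([twist s] @ red ?x) @ red (g s)"
    using assms red_gen beq_sym by (intro braid_eq_append) simp_all
  also have "\<dots> = [twist s] @ red ?x @ red (g s)" by simp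
  also have "\<dots> \<approx> [twist s] @ delta"
    unfolding delta_def using red_mult[of ?x "g s"] x l assms beq_sym by (intro braid_eq_append) simp_all
  finally show ?thesis .
qed

lemma delta_commute: "w \<in> lists S \<Longrightarrow> delta @ w \<approx> map twist w @ delta"
proof (induction w)
  case (Cons s w)
  have "(delta @ [s]) @ w \<approx> ([twist s] @ delta) @ w"
    using Cons by (intro braid_eq_append delta_gen_commute) simp_all
  also have "\<dots> = [twist s] @ (delta @ w)" by simp
  also have "\<dots> \<approx> [twist s] @ (map twist w @ delta)"
    using Cons by (intro braid_eq_append[OF braid_eq_refl]) simp_all
  finally show ?case by simp
qed simp

lemma delta_left_gen:
  assumes "s \<in> S"
  obtains y where "y \<in> lists S" "delta \<approx> y @ [s]"
proof -
  let ?x = "w0 \<otimes> g s"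
  have x: "?x \<in> carrier G" "?x \<otimes> g s = w0"
    using assms gen_square[OF assms] by (simp_all add: m_assoc)
  have "len ?x = len (g s \<otimes> w0)"
    using len_inv[of ?x] assms by (simp add: inv_mult_group inv_w0 inv_gen)
  then have "len w0 = len ?x + 1"
    using prefix_le_w0[of "g s"] assms by (simp add: prefix_le_def inv_gen)
  then have "delta \<approx> red ?x @ red (g s)"
    unfolding delta_def using red_mult[of ?x "g s"] x assms by simp
  also have "\<dots> \<approx> red ?x @ [s]" using assms by (intro braid_eq_append red_gen) simp_all
  finally show thesis using that[of "red ?x"] x by simp
qed

text \<open>Since \<open>d @ [s]\<close> is \<open>delta\<close> for some \<open>d\<close>,
  cancelling a letter reduces to \<open>delta_cancel\<close>.\<close>

lemma beq_cancel_left: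
  assumes "a \<in> lists S" "x \<in> lists S" "y \<in> lists S" "a @ x \<approx> a @ y"
  shows "x \<approx> y"
  using assms
proof (induction a rule: list.induct)
  case (Cons s a)
  obtain d where d: "d \<in> lists S" "delta \<approx> d @ [s]" using delta_left_gen[of s] Cons by auto
  have *: "delta @ z \<approx> d @ s # z" for z
    using braid_eq_append[OF d(2) braid_eq_refl[of S m z]] by simp
  have "delta @ (a @ x) \<approx> d @ s # (a @ x)" by (rule *)
  also have "\<dots> \<approx> d @ s # (a @ y)" using Cons.prems by (intro braid_eq_append) simp_all
  also have "\<dots> \<approx> delta @ (a @ y)" using * beq_sym by simp
  finally have "a @ x \<approx> a @ y" using Cons.prems by (intro delta_cancel[of "a @ x"]) simp_all
  then show ?case using Cons by simp
qed simp

section \<open>Powers of one generator dividing powers of \<open>delta\<close>\<close>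

fun delta_pow :: "nat \<Rightarrow> 'a list" where
  "delta_pow 0 = []"
| "delta_pow (Suc k) = delta @ delta_pow k"

lemma delta_pow_closed [simp]: "delta_pow k \<in> lists S"
  by (induction k) simp_all

text \<open>
  The complement of \<open>s ^ k\<close> in the \<open>k\<close>-th power of the Garside element; its displayed
  factorization is in normal form, so that it has no \<open>s\<close> as a prefix.
\<close>

fun gen_pow_cmpl :: "'a \<Rightarrow> nat \<Rightarrow> 'g list" where
  "gen_pow_cmpl s 0 = []"
| "gen_pow_cmpl s (Suc k) = (g s \<otimes> w0) # gen_pow_cmpl (twist s) k"

lemma gen_pow_cmpl_closed [simp]: "s \<in> S \<Longrightarrow> gen_pow_cmpl s k \<in> lists (carrier G)"
  by (induction k arbitrary: s) simp_all

lemma gen_pow_mult_cmpl: "s \<in> S \<Longrightarrow> replicate k s @ list_word (gen_pow_cmpl s k) \<approx> delta_pow k"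
proof (induction k arbitrary: s)
  case (Suc k)
  let ?L = "list_word (gen_pow_cmpl (twist s) k)" and ?y = "cmpl (g s)"
  have y: "?y = g s \<otimes> w0" using Suc.prems by (simp add: cmpl_def inv_gen)
  have "[s] @ red (g s \<otimes> w0) \<approx> red (g s) @ red (g s \<otimes> w0)"
    using Suc.prems red_gen beq_sym by (intro braid_eq_append) simp_all
  also have "\<dots> \<approx> delta"
    unfolding delta_def using red_mult[of "g s" ?y] len_cmpl[of "g s"] Suc.prems beq_sym by (simp add: y)
  finally have d: "[s] @ red (g s \<otimes> w0) \<approx> delta" .
  \<comment> \<open>The last \<open>s\<close> completes the first factor to \<open>delta\<close>,
    which moves to the front and twists the remaining letters; this is why
    \<open>gen_pow_cmpl\<close> recurses on \<open>twist s\<close>.\<close>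
  have "replicate (Suc k) s @ list_word (gen_pow_cmpl s (Suc k))
      = replicate k s @ ([s] @ red (g s \<otimes> w0)) @ ?L"
    by (simp add: replicate_app_Cons_same)
  also have "\<dots> \<approx> replicate k s @ delta @ ?L"
    using d by (rule braid_eq_context)
  also have "\<dots> = (map twist (replicate k (twist s)) @ delta) @ ?L"
    using Suc.prems by (simp add: map_replicate)
  also have "\<dots> \<approx> (delta @ replicate k (twist s)) @ ?L"
    using Suc.prems delta_commute[of "replicate k (twist s)"] beq_sym
    by (intro braid_eq_append[OF _ braid_eq_refl]) (simp_all add: in_lists_conv_set)
  also have "\<dots> = delta @ (replicate k (twist s) @ ?L)" by simp
  also have "\<dots> \<approx> delta @ delta_pow k"
    using Suc by (intro braid_eq_append[OF braid_eq_refl]) simp_all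
  finally show ?case by simp
qed simp

text \<open>The complement of \<open>g s \<otimes> w0\<close> is the single generator
  \<open>g (twist s)\<close>, and this is no prefix of \<open>g (twist s) \<otimes> w0\<close>. So
  nothing moves between consecutive factors of \<open>gen_pow_cmpl\<close>.\<close>

lemma meet_gen_pow_cmpl:
  assumes "s \<in> S"
  shows "meet (g (twist s) \<otimes> w0) (cmpl (g s \<otimes> w0)) = \<one>"
proof -
  let ?t = "g (twist s)" and ?x = "g (twist s) \<otimes> w0"
  define u where "u = meet ?x (cmpl (g s \<otimes> w0))"
  have c: "cmpl (g s \<otimes> w0) = ?t"
    using assms by (simp add: cmpl_def inv_mult_group inv_w0 inv_gen gen_twist m_assoc)
  have u: "u \<in> carrier G" "u \<preceq> ?x" "u \<preceq> ?t"
    unfolding u_def c using assms by (simp_all add: meet_le1 meet_le2)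
  have "\<not> ?t \<preceq> ?x"
    using len_le_w0[of ?x] assms by (simp add: gen_prefix_le_iff)
  then have "len u \<noteq> 1"
    using u prefix_le_antisym[of u ?t] assms by force
  then have "len u = 0" using prefix_le_len[OF u(3)] assms by simp
  then show ?thesis using u len_eq_0 by (simp add: u_def)
qed

text \<open>\<open>g t \<noteq> w0\<close> excludes rank one, where the factor
  \<open>g s \<otimes> w0\<close> is trivial and \<open>act\<close> would drop it.\<close>

lemma act_gen_pow_cmpl:
  assumes "\<And>t. t \<in> S \<Longrightarrow> g t \<noteq> w0" "s \<in> S"
  shows "act (g s \<otimes> w0) (gen_pow_cmpl (twist s) k) = gen_pow_cmpl s (Suc k)"
  using assms(2)
proof (induction k arbitrary: s)
  case 0
  have "g s \<otimes> w0 \<noteq> \<one>"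
    using assms(1)[OF 0] 0 by (metis gen_cancel gen_closed r_one w0_closed)
  then show ?case by simp
next
  case (Suc k)
  then show ?case using meet_gen_pow_cmpl[OF Suc.prems] Suc.IH[of "twist s"] by simp
qed

lemma word_act_gen_pow_cmpl:
  assumes "\<And>t. t \<in> S \<Longrightarrow> g t \<noteq> w0" "s \<in> S"
  shows "word_act (list_word (gen_pow_cmpl s k)) [] = gen_pow_cmpl s k"
  using assms(2)
proof (induction k arbitrary: s)
  case (Suc k)
  then have "word_act (list_word (gen_pow_cmpl s (Suc k))) [] =
      act (g s \<otimes> w0) (gen_pow_cmpl (twist s) k)"
    by (simp add: word_act_append word_act_red)
  then show ?case using act_gen_pow_cmpl[OF assms(1) Suc.prems] by simp
qed simp

text \<open>This is the lower bound for the supremum of a power of a generator. If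
  \<open>n > k\<close>, cancelling \<open>s ^ k\<close> leaves \<open>s\<close> as a prefix of the
  complement, whose normal form is empty or starts with \<open>g s \<otimes> w0\<close>, an element
  without prefix \<open>g s\<close>.\<close>

lemma gen_pow_prefix_delta_pow:
  assumes small: "\<And>t. t \<in> S \<Longrightarrow> g t \<noteq> w0" and s: "s \<in> S" and q: "q \<in> lists S"
    and eq: "replicate n s @ q \<approx> delta_pow k"
  shows "n \<le> k"
proof (rule ccontr)
  assume "\<not> n \<le> k"
  then obtain j where n: "n = k + Suc j" using less_imp_Suc_add[of k n] by auto
  let ?E = "list_word (gen_pow_cmpl s k)" and ?q = "replicate j s @ q"
  have rep: "replicate i s \<in> lists S" for i using s by (simp add: in_lists_conv_set)
  have "replicate k s @ ?E \<approx> delta_pow k" by (rule gen_pow_mult_cmpl[OF s])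
  also have "\<dots> \<approx> replicate n s @ q" by (rule beq_sym[OF eq])
  also have "\<dots> = replicate k s @ (s # ?q)" by (simp add: n replicate_add replicate_app_Cons_same)
  finally have "replicate k s @ ?E \<approx> replicate k s @ (s # ?q)" .
  then have E: "?E \<approx> s # ?q"
    by (intro beq_cancel_left[of "replicate k s" ?E "s # ?q"]) (simp_all add: rep s q)
  then have "?E \<noteq> []" using braid_eq_length[OF E] by auto
  then obtain i where k: "k = Suc i" by (cases k) auto
  have "?q \<in> lists S" using rep q by simp
  then obtain h L where "word_act ?E [] = h # L" "g s \<preceq> h"
    by (rule head_word_act[OF E s])
  then have "g s \<preceq> g s \<otimes> w0"
    using word_act_gen_pow_cmpl[OF small s, of k] by (simp add: k)
  then show False
    using len_le_w0[of "g s \<otimes> w0"] s by (simp add: gen_prefix_le_iff)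
qed

end

section \<open>The geometric representation\<close>

text \<open>Chebyshev polynomials of the second kind, shifted and rescaled; they are the
  coefficients of the roots of a rank two subsystem.\<close>

fun cheb :: "real \<Rightarrow> nat \<Rightarrow> real" where
  "cheb c 0 = 0"
| "cheb c (Suc 0) = 1"
| "cheb c (Suc (Suc n)) = c * cheb c (Suc n) - cheb c n"

lemma cheb_cos: "cheb (2 * cos \<theta>) n * sin \<theta> = sin (real n * \<theta>)"
proof (induction "2 * cos \<theta>" n rule: cheb.induct)
  case (3 n)
  have "sin (real (Suc (Suc n)) * \<theta>) = sin (real (Suc n) * \<theta> + \<theta>)"
    and "sin (real n * \<theta>) = sin (real (Suc n) * \<theta> - \<theta>)"
    by (simp_all add: algebra_simps)
  then have "sin (real (Suc (Suc n)) * \<theta>) = 2 * cos \<theta> * sin (real (Suc n) * \<theta>) - sin (real n * \<theta>)"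
    by (simp add: sin_add sin_diff)
  then show ?case using 3 by (simp add: algebra_simps)
qed simp_all

lemma cheb_two: "cheb 2 n = real n"
  by (induction "2::real" n rule: cheb.induct) simp_all

text \<open>Vectors are plain functions on letters, and compatibility with \<open>comb\<close> is
  how linearity is expressed.\<close>

definition comb :: "real \<Rightarrow> ('a \<Rightarrow> real) \<Rightarrow> real \<Rightarrow> ('a \<Rightarrow> real) \<Rightarrow> 'a \<Rightarrow> real" where
  "comb a u b v = (\<lambda>x. a * u x + b * v x)"

definition simple_root :: "'a \<Rightarrow> 'a \<Rightarrow> real" where
  "simple_root s = (\<lambda>x. if x = s then 1 else 0)"

locale coxeter_type =
  fixes S :: "'a set" and m :: "'a \<Rightarrow> 'a \<Rightarrow> enat"
  assumes coxeter_matrix: "coxeter_matrix S m"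
begin

lemma finite_S: "finite S"
  using coxeter_matrix by (simp add: coxeter_matrix_def)

lemma m_sym: "s \<in> S \<Longrightarrow> t \<in> S \<Longrightarrow> m s t = m t s"
  using coxeter_matrix by (simp add: coxeter_matrix_def)

lemma m_ge_2: "s \<in> S \<Longrightarrow> t \<in> S \<Longrightarrow> s \<noteq> t \<Longrightarrow> 2 \<le> m s t"
  using coxeter_matrix by (simp add: coxeter_matrix_def)

lemma m_enat_ge_2: "s \<in> S \<Longrightarrow> t \<in> S \<Longrightarrow> s \<noteq> t \<Longrightarrow> m s t = enat n \<Longrightarrow> 2 \<le> n"
  using m_ge_2[of s t] by (simp add: numeral_eq_enat)

text \<open>Minus twice the usual bilinear form on simple roots. The label 1 on the diagonal gives
  \<open>2 * cos pi\<close>, that is -2, so no separate case is needed.\<close>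

definition weight :: "'a \<Rightarrow> 'a \<Rightarrow> real" where
  "weight s t = (case m s t of enat n \<Rightarrow> 2 * cos (pi / real n) | \<infinity> \<Rightarrow> 2)"

lemma weight_self: "s \<in> S \<Longrightarrow> weight s s = - 2"
  using coxeter_matrix by (simp add: weight_def coxeter_matrix_def one_enat_def)

lemma weight_sym: "s \<in> S \<Longrightarrow> t \<in> S \<Longrightarrow> weight s t = weight t s"
  by (simp add: weight_def m_sym)

lemma weight_ge_1:
  assumes "s \<in> S" "t \<in> S" "s \<noteq> t" "m s t \<noteq> 2"
  shows "1 \<le> weight s t"
proof (cases "m s t")
  case (enat n)
  then have "3 \<le> n"
    using m_enat_ge_2[OF assms(1-3) enat] assms(4) by (auto simp: numeral_eq_enat)
  then have "pi / real n \<le> pi / 3" by (intro divide_left_mono) auto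
  then have "cos (pi / 3) \<le> cos (pi / real n)"
    using \<open>3 \<le> n\<close> by (intro cos_monotone_0_pi_le) auto
  then show ?thesis using enat by (simp add: weight_def cos_60)
qed (simp add: weight_def)

text \<open>The value is \<open>sin (n * pi / N) / sin (pi / N)\<close> with
  \<open>n \<le> N\<close>, or \<open>n\<close> itself for an infinite label.\<close>

lemma cheb_weight_nonneg:
  assumes "s \<in> S" "t \<in> S" "s \<noteq> t" "enat n \<le> m s t"
  shows "0 \<le> cheb (weight s t) n"
proof (cases "m s t")
  case (enat N)
  then have N: "2 \<le> N" "n \<le> N" using m_enat_ge_2 assms by auto
  have "0 < sin (pi / real N)" using N by (intro sin_gt_zero) (auto simp: field_simps)
  moreover have "0 \<le> sin (real n * (pi / real N))"
    using N by (intro sin_ge_zero) (auto simp: field_simps)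
  ultimately have "0 \<le> cheb (2 * cos (pi / real N)) n"
    unfolding cheb_cos[symmetric] by (metis mult_neg_pos not_le)
  then show ?thesis using enat by (simp add: weight_def)
qed (simp add: weight_def cheb_two)

lemma cheb_weight_label:
  assumes "s \<in> S" "t \<in> S" "s \<noteq> t" "m s t = enat (Suc k)"
  shows "cheb (weight s t) (Suc k) = 0" "cheb (weight s t) k = 1"
proof -
  let ?\<theta> = "pi / real (Suc k)"
  have k: "1 \<le> k" using m_enat_ge_2[OF assms] by simp
  have w: "weight s t = 2 * cos ?\<theta>" using assms by (simp add: weight_def)
  have pos: "0 < sin ?\<theta>" using k by (intro sin_gt_zero) (auto simp: field_simps)
  have "real (Suc k) * ?\<theta> = pi" by simp
  then have "cheb (2 * cos ?\<theta>) (Suc k) * sin ?\<theta> = 0"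
    using cheb_cos[of ?\<theta> "Suc k"] by simp
  then show "cheb (weight s t) (Suc k) = 0" using pos unfolding w by auto
  have "real k * ?\<theta> = pi - ?\<theta>" by (simp add: field_simps)
  then have "cheb (2 * cos ?\<theta>) k * sin ?\<theta> = sin ?\<theta>"
    using cheb_cos[of ?\<theta> k] by simp
  then show "cheb (weight s t) k = 1" using pos unfolding w by simp
qed

text \<open>\<open>4 - weight s t * weight s t\<close> is the determinant of the linear system
  solved in \<open>word_refl_braid\<close>.\<close>

lemma weight_square_neq_4:
  assumes "s \<in> S" "t \<in> S" "s \<noteq> t" "m s t = enat n"
  shows "weight s t * weight s t \<noteq> 4"
proof -
  have n: "2 \<le> n" using m_enat_ge_2[OF assms] .
  have "0 < sin (pi / real n)" using n by (intro sin_gt_zero) (auto simp: field_simps)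
  then have "0 < (sin (pi / real n))\<^sup>2" by simp
  then have "(cos (pi / real n))\<^sup>2 < 1" using sin_cos_squared_add[of "pi / real n"] by linarith
  then show ?thesis using assms by (simp add: weight_def power2_eq_square)
qed

section \<open>Reflections and the braid relations\<close>

definition pairing :: "'a \<Rightarrow> ('a \<Rightarrow> real) \<Rightarrow> real" where
  "pairing s v = (\<Sum>u\<in>S. weight s u * v u)"

definition reflection :: "'a \<Rightarrow> ('a \<Rightarrow> real) \<Rightarrow> 'a \<Rightarrow> real" where
  "reflection s v = v(s := v s + pairing s v)"

abbreviation word_refl :: "'a list \<Rightarrow> ('a \<Rightarrow> real) \<Rightarrow> 'a \<Rightarrow> real" where
  "word_refl \<equiv> fold reflection"

lemma pairing_comb: "pairing s (comb a u b v) = a * pairing s u + b * pairing s v"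
  by (simp add: pairing_def comb_def algebra_simps sum.distrib sum_distrib_left)

lemma pairing_simple_root: "t \<in> S \<Longrightarrow> pairing s (simple_root t) = weight s t"
  by (simp add: pairing_def simple_root_def if_distrib[of "times _"] finite_S cong: if_cong)

lemma reflection_comb: "reflection s (comb a u b v) = comb a (reflection s u) b (reflection s v)"
  unfolding reflection_def pairing_comb by (auto simp: comb_def algebra_simps)

lemma word_refl_comb: "word_refl w (comb a u b v) = comb a (word_refl w u) b (word_refl w v)"
  by (induction w arbitrary: u v) (simp_all add: reflection_comb)

lemma word_refl_uminus: "word_refl w (\<lambda>x. - v x) = (\<lambda>x. - word_refl w v x)"
  using word_refl_comb[of w "- 1" v 0 v] by (simp add: comb_def)

lemma word_refl_zero: "word_refl w (\<lambda>x. 0) = (\<lambda>x. 0)"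
  using word_refl_comb[of w 0 "\<lambda>x. 0" 0 "\<lambda>x. 0"] by (simp add: comb_def)

lemma word_refl_sum:
  "finite T \<Longrightarrow> word_refl w (\<lambda>y. \<Sum>t\<in>T. c t * v t y) = (\<lambda>y. \<Sum>t\<in>T. c t * word_refl w (v t) y)"
proof (induction T rule: finite_induct)
  case (insert t T)
  have "word_refl w (comb (c t) (v t) 1 (\<lambda>y. \<Sum>t\<in>T. c t * v t y)) =
      comb (c t) (word_refl w (v t)) 1 (\<lambda>y. \<Sum>t\<in>T. c t * word_refl w (v t) y)"
    unfolding word_refl_comb insert.IH ..
  then show ?case using insert.hyps by (simp add: comb_def)
qed (simp add: word_refl_zero)

lemma pairing_reflection: "s \<in> S \<Longrightarrow> pairing s (reflection s v) = - pairing s v"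
proof -
  assume s: "s \<in> S"
  have "reflection s v = comb 1 v (pairing s v) (simple_root s)"
    by (auto simp: reflection_def comb_def simple_root_def)
  then show ?thesis using s by (simp add: pairing_comb pairing_simple_root weight_self)
qed

lemma reflection_reflection: "s \<in> S \<Longrightarrow> reflection s (reflection s v) = v"
  unfolding reflection_def[of s "reflection s v"] pairing_reflection by (simp add: reflection_def)

lemma reflection_simple_root:
  "t \<in> S \<Longrightarrow> reflection s (simple_root t) = comb 1 (simple_root t) (weight s t) (simple_root s)"
  unfolding reflection_def pairing_simple_root by (auto simp: comb_def simple_root_def)

lemma reflection_simple_root_self:
  "s \<in> S \<Longrightarrow> reflection s (simple_root s) = (\<lambda>x. - simple_root s x)"
  by (simp add: reflection_simple_root weight_self comb_def)

lemma word_refl_rev: "w \<in> lists S \<Longrightarrow> word_refl (rev w) (word_refl w v) = v"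
  by (induction w arbitrary: v) (simp_all add: reflection_reflection)

lemma word_refl_alternating:
  assumes "s \<in> S" "t \<in> S"
  shows "word_refl (alternating t s n) (simple_root s) =
    (if even n then comb (cheb (weight s t) (Suc n)) (simple_root s) (cheb (weight s t) n) (simple_root t)
     else comb (cheb (weight s t) n) (simple_root s) (cheb (weight s t) (Suc n)) (simple_root t))"
  using assms
proof (induction n arbitrary: s t rule: less_induct)
  case (less n)
  define c where "c = weight s t"
  have c: "weight t s = c" using less.prems weight_sym by (simp add: c_def)
  consider "n = 0" | "n = 1" | k where "n = Suc (Suc k)"
    by (metis One_nat_def not0_implies_Suc)
  then show ?case
  proof cases
    case 1
    then show ?thesis by (simp add: comb_def)
  next
    case 2
    then show ?thesis
      using less.prems by (simp add: reflection_simple_root c c_def)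
  next
    case (3 k)
    let ?R = "\<lambda>n s t. word_refl (alternating t s n) (simple_root s)"
    \<comment> \<open>\<open>fold\<close> applies \<open>t\<close> first, giving a combination of
      two simple roots; on \<open>simple_root s\<close> the next letter \<open>s\<close> only
      changes the sign, which leaves a word shorter by two. This is the recursion of
      \<open>cheb\<close>.\<close>
    have "alternating t s n = t # alternating s t (Suc k)" by (simp add: 3)
    then have "?R n s t = comb 1 (word_refl (alternating s t (Suc k)) (simple_root s)) c (?R (Suc k) t s)"
      by (simp only: fold_simps reflection_simple_root[OF less.prems(1)] c word_refl_comb)
    also have "word_refl (alternating s t (Suc k)) (simple_root s) = (\<lambda>x. - ?R k s t x)"
      using less.prems by (simp add: reflection_simple_root_self word_refl_uminus)
    finally have "?R n s t = comb 1 (\<lambda>x. - ?R k s t x) c (?R (Suc k) t s)" .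
    then show ?thesis
      using less.IH[of k s t] less.IH[of "Suc k" t s] less.prems
      by (auto simp: 3 c comb_def algebra_simps simp flip: c_def)
  qed
qed

lemma word_refl_alternating_fixed:
  "pairing s v = 0 \<Longrightarrow> pairing t v = 0 \<Longrightarrow> word_refl (alternating s t n) v = v"
  by (induction s t n rule: alternating.induct) (simp_all add: reflection_def)

lemma word_refl_braid_simple_root:
  assumes "s \<in> S" "t \<in> S" "s \<noteq> t" "m s t = enat n"
  shows "word_refl (alternating s t n) (simple_root s) = word_refl (alternating t s n) (simple_root s)"
proof -
  obtain k where k: "n = Suc k" using m_enat_ge_2[OF assms] by (cases n) auto
  note c = cheb_weight_label[OF assms(1-3), of k]
  have "word_refl (alternating s t n) (simple_root s) =
      (\<lambda>x. - word_refl (alternating t s k) (simple_root s) x)"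
    using assms by (simp add: k reflection_simple_root_self word_refl_uminus)
  also have "\<dots> = word_refl (alternating t s n) (simple_root s)"
    unfolding word_refl_alternating[OF assms(1,2)] using c assms(4) by (auto simp: k comb_def)
  finally show ?thesis .
qed

text \<open>Every vector splits into a combination \<open>e\<close> of the two simple roots and a
  vector \<open>v'\<close> fixed by both reflections, so it suffices to compare the words on the two
  simple roots.\<close>

lemma word_refl_braid:
  assumes "s \<in> S" "t \<in> S" "s \<noteq> t" "m s t = enat n"
  shows "word_refl (alternating s t n) = word_refl (alternating t s n)"
proof
  fix v :: "'a \<Rightarrow> real"
  define k p q where "k = weight s t" and "p = pairing s v" and "q = pairing t v"
  have k: "weight t s = k" "4 - k * k \<noteq> 0"
    using weight_square_neq_4[OF assms] weight_sym assms by (simp_all add: k_def)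
  \<comment> \<open>Cramer's rule for the coefficients that make both pairings of \<open>v'\<close>
    vanish.\<close>
  define a b where "a = - (2 * p + k * q) / (4 - k * k)" and "b = - (k * p + 2 * q) / (4 - k * k)"
  define e v' where "e = comb a (simple_root s) b (simple_root t)" and "v' = comb 1 v (- 1) e"
  have "(4 - k * k) * a = - (2 * p + k * q)" "(4 - k * k) * b = - (k * p + 2 * q)"
    using k(2) by (simp_all add: a_def b_def)
  then have "(4 - k * k) * (p + 2 * a - k * b) = 0" "(4 - k * k) * (q - k * a + 2 * b) = 0"
    by algebra+
  then have ab: "p + 2 * a - k * b = 0" "q - k * a + 2 * b = 0" using k(2) by auto
  have "pairing s v' = p + 2 * a - k * b" "pairing t v' = q - k * a + 2 * b"
    using assms k unfolding v'_def e_def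
    by (simp_all add: pairing_comb pairing_simple_root weight_self algebra_simps flip: k_def p_def q_def)
  then have "pairing s v' = 0" "pairing t v' = 0" using ab by simp_all
  then have v': "word_refl (alternating s t n) v' = v'" "word_refl (alternating t s n) v' = v'"
    by (simp_all add: word_refl_alternating_fixed)
  have "m t s = enat n" using assms m_sym by simp
  then have e: "word_refl (alternating s t n) e = word_refl (alternating t s n) e"
    unfolding e_def word_refl_comb
    using word_refl_braid_simple_root[OF assms] word_refl_braid_simple_root[of t s n] assms by simp
  have v: "v = comb 1 v' 1 e" by (simp add: v'_def comb_def)
  show "word_refl (alternating s t n) v = word_refl (alternating t s n) v"
    unfolding v word_refl_comb v' e ..
qed

text \<open>\<open>fold\<close> applies the first letter first, so the product is reversed
  composition and words evaluate to products in order. Consequently \<open>x (simple_root s)\<close>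
  changes sign when \<open>x\<close> is multiplied by \<open>reflection s\<close> from the left, so
  it detects left descents.\<close>

definition reflection_group :: "(('a \<Rightarrow> real) \<Rightarrow> 'a \<Rightarrow> real) monoid" where
  "reflection_group = \<lparr> carrier = word_refl ` lists S, monoid.mult = (\<lambda>x y. y \<circ> x), one = id \<rparr>"

lemma reflection_group_simps [simp]:
  "carrier reflection_group = word_refl ` lists S"
  "x \<otimes>\<^bsub>reflection_group\<^esub> y = y \<circ> x"
  "\<one>\<^bsub>reflection_group\<^esub> = id"
  by (simp_all add: reflection_group_def)

lemma group_reflection_group: "group reflection_group"
proof (rule groupI)
  show "\<one>\<^bsub>reflection_group\<^esub> \<in> carrier reflection_group"
    using image_eqI[of id word_refl "[]" "lists S"] by simp
next
  fix x y assume "x \<in> carrier reflection_group" "y \<in> carrier reflection_group"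
  then obtain v w where "v \<in> lists S" "w \<in> lists S" "x = word_refl v" "y = word_refl w" by auto
  then have "x \<otimes>\<^bsub>reflection_group\<^esub> y = word_refl (v @ w)" "v @ w \<in> lists S"
    by simp_all
  then show "x \<otimes>\<^bsub>reflection_group\<^esub> y \<in> carrier reflection_group"
    unfolding reflection_group_simps(1) by (rule image_eqI)
next
  fix x assume "x \<in> carrier reflection_group"
  then obtain w where w: "w \<in> lists S" "x = word_refl w" by auto
  show "\<exists>y\<in>carrier reflection_group. y \<otimes>\<^bsub>reflection_group\<^esub> x = \<one>\<^bsub>reflection_group\<^esub>"
    using w word_refl_rev[of "rev w"] by (intro bexI[of _ "word_refl (rev w)"]) (auto simp: fun_eq_iff)
qed (auto simp: comp_assoc)

lemma word_product_reflection: "word_product reflection_group reflection w = word_refl w"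
  by (induction w) (simp_all add: word_product_def)

sublocale W: coxeter_quotient reflection_group S m reflection
proof (intro coxeter_quotient.intro coxeter_quotient_axioms.intro group_reflection_group coxeter_matrix)
  fix s assume s: "s \<in> S"
  then show "reflection s \<in> carrier reflection_group"
    using image_eqI[of "reflection s" word_refl "[s]" "lists S"] by simp
  show "reflection s \<otimes>\<^bsub>reflection_group\<^esub> reflection s = \<one>\<^bsub>reflection_group\<^esub>"
    using s by (simp add: fun_eq_iff reflection_reflection)
next
  fix s t n assume "s \<in> S" "t \<in> S" "s \<noteq> t" "m s t = enat n"
  then show "word_product reflection_group reflection (alternating s t n) =
      word_product reflection_group reflection (alternating t s n)"
    unfolding word_product_reflection by (rule word_refl_braid)
qed (auto simp: word_product_reflection)

section \<open>Signs of roots and descents\<close>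

lemma W_linear:
  assumes "x \<in> carrier reflection_group"
  shows "x (comb a u b v) = comb a (x u) b (x v)"
  using assms by (auto simp: word_refl_comb)

lemma W_uminus:
  assumes "x \<in> carrier reflection_group"
  shows "x (\<lambda>y. - v y) = (\<lambda>y. - x v y)"
  using assms by (auto simp: word_refl_uminus)

lemma W_simple_root_neq_0:
  assumes "x \<in> carrier reflection_group"
  shows "\<exists>y. x (simple_root s) y \<noteq> 0"
proof (rule ccontr)
  assume "\<not> (\<exists>y. x (simple_root s) y \<noteq> 0)"
  then have x0: "x (simple_root s) = (\<lambda>y. 0)" by auto
  obtain w where w: "w \<in> lists S" "x = word_refl w" using assms by auto
  have "simple_root s = (\<lambda>y. 0)"
    using word_refl_rev[OF w(1), of "simple_root s"] x0 w(2) by (simp add: word_refl_zero)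
  then have "simple_root s s = 0" by simp
  then show False by (simp add: simple_root_def)
qed

lemma alternating_root_nonneg:
  assumes "s \<in> S" "t \<in> S" "s \<noteq> t" "enat (Suc n) \<le> m s t" "v \<in> carrier reflection_group"
    "0 \<le> v (simple_root s) y" "0 \<le> v (simple_root t) y"
  shows "0 \<le> v (word_refl (alternating t s n) (simple_root s)) y"
proof -
  have "enat n \<le> m s t" using assms(4) by (metis Suc_ile_eq order_less_imp_le)
  then have "0 \<le> cheb (weight s t) n" "0 \<le> cheb (weight s t) (Suc n)"
    using cheb_weight_nonneg assms by blast+
  then show ?thesis
    unfolding word_refl_alternating[OF assms(1,2)]
    using assms(6,7) by (simp add: W_linear[OF assms(5)]) (simp add: comb_def)
qed

text \<open>Split \<open>x\<close> along \<open>s\<close> and another left descent \<open>t\<close>.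
  The dihedral part cannot be written with first letter \<open>s\<close>, hence it is shorter than
  the label and sends \<open>simple_root s\<close> to a nonnegative combination of the two simple
  roots; the rest \<open>v\<close> is shorter than \<open>x\<close> and covered by induction. The
  hypothesis has a weak inequality because equal lengths are excluded only afterwards.\<close>

theorem root_nonneg:
  assumes "x \<in> carrier reflection_group" "s \<in> S"
    "W.len x \<le> W.len (reflection s \<otimes>\<^bsub>reflection_group\<^esub> x)"
  shows "0 \<le> x (simple_root s) y"
  using assms
proof (induction "W.len x" arbitrary: x s rule: less_induct)
  case less
  let ?G = reflection_group
  note x = less.prems(1)
  show ?case
  proof (cases "x = \<one>\<^bsub>?G\<^esub>")
    case True
    then show ?thesis by (simp add: simple_root_def)
  next
    case False
    then obtain t where t: "t \<in> S" "W.len x = Suc (W.len (reflection t \<otimes>\<^bsub>?G\<^esub> x))"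
      using W.left_descent_exists[OF x] by blast
    then have "s \<noteq> t" using less.prems by auto
    obtain v a b n where v: "v \<in> carrier ?G" and ab: "{a, b} = {s, t}"
      and xv: "x = W.ev (alternating a b n) \<otimes>\<^bsub>?G\<^esub> v" and len: "W.len x = n + W.len v"
      and asc: "W.len v \<le> W.len (reflection s \<otimes>\<^bsub>?G\<^esub> v)" "W.len v \<le> W.len (reflection t \<otimes>\<^bsub>?G\<^esub> v)"
      and n: "enat n \<le> m s t"
      using W.dihedral_decomposition[OF x less.prems(2) t(1) \<open>s \<noteq> t\<close>] by metis
    have "n \<noteq> 0" using xv asc(2) t(2) v by (intro notI) simp
    then obtain k where k: "n = Suc k" by (cases n) auto
    have not_s: "x \<noteq> W.ev (alternating s t n) \<otimes>\<^bsub>?G\<^esub> v"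
    proof
      assume eq: "x = W.ev (alternating s t n) \<otimes>\<^bsub>?G\<^esub> v"
      have alt: "alternating t s k \<in> lists S"
        using less.prems t by (simp add: alternating_in_lists)
      have "reflection s \<otimes>\<^bsub>?G\<^esub> x = W.ev (alternating t s k) \<otimes>\<^bsub>?G\<^esub> v"
        unfolding eq k using less.prems(2) v alt W.gen_cancel[of s "W.ev (alternating t s k) \<otimes>\<^bsub>?G\<^esub> v"]
        by (simp add: W.m_assoc del: reflection_group_simps)
      then have "W.len (reflection s \<otimes>\<^bsub>?G\<^esub> x) \<le> k + W.len v"
        using W.len_mult[of "W.ev (alternating t s k)" v] W.len_le[OF alt] W.ev_closed[OF alt] v
        by (simp del: reflection_group_simps)
      then show False using less.prems(3) len k by simp
    qed
    then have ab': "a = t" "b = s" using ab xv by (auto simp: doubleton_eq_iff)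
    have "enat n \<noteq> m s t"
      using not_s xv W.braid[OF less.prems(2) t(1) \<open>s \<noteq> t\<close>, of n] unfolding ab' by metis
    then have "enat (Suc n) \<le> m s t" using n by (metis Suc_ile_eq order_le_imp_less_or_eq)
    moreover have "0 \<le> v (simple_root s) y" "0 \<le> v (simple_root t) y"
      using less.hyps[of v] v asc less.prems(2) t(1) len k by simp_all
    ultimately have "0 \<le> v (word_refl (alternating t s n) (simple_root s)) y"
      using alternating_root_nonneg less.prems(2) t(1) \<open>s \<noteq> t\<close> v by blast
    then show ?thesis unfolding xv ab' by (simp add: word_product_reflection)
  qed
qed

lemma root_nonpos:
  assumes x: "x \<in> carrier reflection_group" and s: "s \<in> S"
    and len: "W.len (reflection s \<otimes>\<^bsub>reflection_group\<^esub> x) \<le> W.len x"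
  shows "x (simple_root s) y \<le> 0"
proof -
  let ?y = "reflection s \<otimes>\<^bsub>reflection_group\<^esub> x"
  have "?y \<in> carrier reflection_group"
    using W.m_closed[OF W.gen_closed[OF s] x] .
  moreover have "reflection s \<otimes>\<^bsub>reflection_group\<^esub> ?y = x"
    using W.gen_cancel[OF s x] .
  ultimately have "0 \<le> ?y (simple_root s) y"
    using root_nonneg[of ?y s] s len by (simp del: reflection_group_simps)
  then show ?thesis using s by (simp add: reflection_simple_root_self W_uminus[OF x])
qed

text \<open>Equal lengths would make the root both nonnegative and nonpositive, hence zero.\<close>

lemma W_len_gen_mult_neq:
  assumes "s \<in> S" "x \<in> carrier reflection_group"
  shows "W.len (reflection s \<otimes>\<^bsub>reflection_group\<^esub> x) \<noteq> W.len x"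
proof
  assume "W.len (reflection s \<otimes>\<^bsub>reflection_group\<^esub> x) = W.len x"
  then have "0 \<le> x (simple_root s) y" "x (simple_root s) y \<le> 0" for y
    using root_nonneg[of x s] root_nonpos[of x s] assms by simp_all
  then show False using W_simple_root_neq_0[OF assms(2), of s] by (meson order_antisym)
qed

text \<open>If the dihedral part were shorter than the label, the root of the letter it does not
  start with would be nonnegative; but that letter is a descent, so the root is also
  nonpositive.\<close>

lemma W_two_left_descents:
  assumes x: "x \<in> carrier reflection_group" and st: "s \<in> S" "t \<in> S" "s \<noteq> t"
    and desc: "W.len (reflection s \<otimes>\<^bsub>reflection_group\<^esub> x) < W.len x"
      "W.len (reflection t \<otimes>\<^bsub>reflection_group\<^esub> x) < W.len x"
  shows "\<exists>n. m s t = enat n \<and> (\<exists>v\<in>carrier reflection_group.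
    x = W.ev (alternating s t n) \<otimes>\<^bsub>reflection_group\<^esub> v \<and> W.len x = n + W.len v)"
proof -
  let ?G = reflection_group
  obtain v a b n where v: "v \<in> carrier ?G" and ab: "{a, b} = {s, t}"
    and xv: "x = W.ev (alternating a b n) \<otimes>\<^bsub>?G\<^esub> v" and len: "W.len x = n + W.len v"
    and asc: "W.len v \<le> W.len (reflection s \<otimes>\<^bsub>?G\<^esub> v)" "W.len v \<le> W.len (reflection t \<otimes>\<^bsub>?G\<^esub> v)"
    and n: "enat n \<le> m s t"
    using W.dihedral_decomposition[OF x st] by metis
  have abS: "a \<in> S" "b \<in> S" "b \<noteq> a" "m b a = m s t"
    using ab st m_sym by (auto simp: doubleton_eq_iff)
  have "m s t = enat n"
  proof (rule ccontr)
    assume "m s t \<noteq> enat n"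
    then have lt: "enat (Suc n) \<le> m b a"
      using n abS(4) by (metis Suc_ile_eq order_le_imp_less_or_eq)
    have v_pos: "0 \<le> v (simple_root c) y" if "c \<in> {a, b}" for c y
      using that root_nonneg[OF v] asc st unfolding ab by blast
    have "0 \<le> x (simple_root b) y" for y
      using alternating_root_nonneg[OF abS(2,1,3) lt v] v_pos unfolding xv
      by (simp add: word_product_reflection)
    moreover have "x (simple_root b) y \<le> 0" for y
    proof -
      have "b \<in> {s, t}" using ab by auto
      then show ?thesis using root_nonpos[OF x abS(2)] desc by (metis insertE less_imp_le singletonD)
    qed
    ultimately show False using W_simple_root_neq_0[OF x, of b] by (meson order_antisym)
  qed
  moreover have "W.ev (alternating a b n) = W.ev (alternating s t n)"
    using ab W.braid[OF st calculation] by (auto simp: doubleton_eq_iff)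
  ultimately show ?thesis using v xv len by auto
qed

lemma word_refl_support:
  assumes "w \<in> lists S" "\<And>y. y \<notin> S \<Longrightarrow> v y = 0" "y \<notin> S"
  shows "word_refl w v y = 0"
  using assms
proof (induction w arbitrary: v rule: list.induct)
  case (Cons s w)
  have "reflection s v y = 0" if "y \<notin> S" for y
    using Cons.prems(1,2) that by (auto simp: reflection_def)
  then show ?case using Cons by simp
qed simp

text \<open>A reduced word of \<open>u\<close> is stripped off \<open>x\<close> letter by letter. If
  a letter \<open>s\<close> failed to shorten the rest \<open>y\<close>, then
  \<open>y (simple_root s)\<close> would be nonnegative; but it is \<open>x\<close> applied to a
  nonnegative combination \<open>\<beta>\<close> of simple roots, each of which \<open>x\<close>
  makes nonpositive, so it would vanish.\<close>

lemma W_all_left_descents: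
  assumes x: "x \<in> carrier reflection_group"
    and desc: "\<And>s. s \<in> S \<Longrightarrow> W.len (reflection s \<otimes>\<^bsub>reflection_group\<^esub> x) < W.len x"
    and u: "u \<in> carrier reflection_group"
  shows "W.len x = W.len u + W.len (inv\<^bsub>reflection_group\<^esub> u \<otimes>\<^bsub>reflection_group\<^esub> x)"
proof -
  let ?G = reflection_group
  have "w \<in> lists S \<Longrightarrow> length w = W.len (W.ev w) \<Longrightarrow>
    W.len x = length w + W.len (inv\<^bsub>?G\<^esub> (W.ev w) \<otimes>\<^bsub>?G\<^esub> x)" for w
  proof (induction w rule: rev_induct)
    case Nil
    then show ?case using x by (simp del: reflection_group_simps)
  next
    case (snoc s w)
    have w: "w \<in> lists S" and s: "s \<in> S" using snoc.prems by auto
    let ?u = "W.ev w" and ?g = "reflection s"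
    have uc: "?u \<in> carrier ?G" "?g \<in> carrier ?G" using w s by (simp_all del: reflection_group_simps)
    have us: "W.ev (w @ [s]) = ?u \<otimes>\<^bsub>?G\<^esub> ?g"
      using W.ev_append[of w "[s]"] w s uc by (simp del: reflection_group_simps)
    have lw: "length w = W.len ?u"
      using snoc.prems(2) W.len_mult[OF uc] W.len_gen_le[OF s] W.len_le[OF w] unfolding us
      by (simp del: reflection_group_simps)
    define y where "y = inv\<^bsub>?G\<^esub> ?u \<otimes>\<^bsub>?G\<^esub> x"
    have y: "y \<in> carrier ?G" unfolding y_def using uc x by blast
    have IH: "W.len x = length w + W.len y" using snoc.IH[OF w lw] unfolding y_def .
    have inv_us: "inv\<^bsub>?G\<^esub> (W.ev (w @ [s])) = ?g \<otimes>\<^bsub>?G\<^esub> inv\<^bsub>?G\<^esub> ?u"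
      unfolding us using uc W.inv_gen[OF s] by (simp add: W.inv_mult_group del: reflection_group_simps)
    have gy: "inv\<^bsub>?G\<^esub> (W.ev (w @ [s])) \<otimes>\<^bsub>?G\<^esub> x = ?g \<otimes>\<^bsub>?G\<^esub> y"
      unfolding inv_us y_def using uc x by (simp add: W.m_assoc del: reflection_group_simps)
    have "W.len (?g \<otimes>\<^bsub>?G\<^esub> y) < W.len y"
    proof (rule ccontr)
      assume "\<not> W.len (?g \<otimes>\<^bsub>?G\<^esub> y) < W.len y"
      then have pos: "0 \<le> y (simple_root s) z" for z using root_nonneg[OF y s] by simp
      define \<beta> where "\<beta> = (inv\<^bsub>?G\<^esub> ?u) (simple_root s)"
      have iu: "inv\<^bsub>?G\<^esub> ?u \<in> carrier ?G" using uc by blast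
      have "W.len (?g \<otimes>\<^bsub>?G\<^esub> inv\<^bsub>?G\<^esub> ?u) = W.len (W.ev (w @ [s]))"
        using W.len_inv[of "W.ev (w @ [s])"] inv_us snoc.prems(1) W.ev_closed by metis
      also have "\<dots> = Suc (W.len ?u)" using snoc.prems(2) lw by simp
      also have "W.len ?u = W.len (inv\<^bsub>?G\<^esub> ?u)" using W.len_inv[OF uc(1)] by simp
      finally have \<beta>: "0 \<le> \<beta> z" for z
        unfolding \<beta>_def using root_nonneg[OF iu s] by (simp del: reflection_group_simps)
      have "\<beta> z = 0" if "z \<notin> S" for z
      proof -
        obtain r where r: "r \<in> lists S" "inv\<^bsub>?G\<^esub> ?u = word_refl r" using iu by auto
        have "simple_root s z = 0" if "z \<notin> S" for z using that s by (auto simp: simple_root_def)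
        then show ?thesis unfolding \<beta>_def r(2) using word_refl_support[OF r(1)] that by blast
      qed
      then have expand: "\<beta> = (\<lambda>z. \<Sum>t\<in>S. \<beta> t * simple_root t z)"
        by (auto simp: simple_root_def if_distrib[of "times _"] finite_S cong: if_cong)
      obtain r where r: "r \<in> lists S" "x = word_refl r" using x by auto
      have "y (simple_root s) = x \<beta>" unfolding y_def \<beta>_def by simp
      also have "\<dots> = x (\<lambda>z. \<Sum>t\<in>S. \<beta> t * simple_root t z)" using expand by (rule arg_cong)
      also have "\<dots> = (\<lambda>z. \<Sum>t\<in>S. \<beta> t * x (simple_root t) z)"
        unfolding r(2) by (rule word_refl_sum[OF finite_S])
      finally have y_eq: "y (simple_root s) = (\<lambda>z. \<Sum>t\<in>S. \<beta> t * x (simple_root t) z)" .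
      have "x (simple_root t) z \<le> 0" if "t \<in> S" for t z
        using root_nonpos[OF x that] desc[OF that] by (simp del: reflection_group_simps)
      then have "y (simple_root s) z \<le> 0" for z
        unfolding y_eq using \<beta> by (intro sum_nonpos mult_nonneg_nonpos) simp_all
      then show False using pos W_simple_root_neq_0[OF y, of s] by (meson order_antisym)
    qed
    then have "W.len y = Suc (W.len (?g \<otimes>\<^bsub>?G\<^esub> y))" using W.len_le_gen_mult[OF s y] by simp
    then show ?case using IH unfolding gy by (simp del: reflection_group_simps)
  qed
  moreover obtain w where "w \<in> lists S" "W.ev w = u" "length w = W.len u"
    using W.reduced_word[OF u] .
  ultimately show ?thesis by metis
qed

section \<open>Finiteness and commuting generators\<close>

lemma finite_coxeter_reflection_group:
  assumes "finite (carrier reflection_group)" "S \<noteq> {}"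
  shows "finite_coxeter reflection_group S m reflection"
  by (intro finite_coxeter.intro finite_coxeter_axioms.intro W.coxeter_quotient_axioms assms
    W_len_gen_mult_neq W_two_left_descents W_all_left_descents)

lemma finite_reflection_group:
  assumes "spherical_type S m"
  shows "finite (carrier reflection_group)"
proof -
  define R where "R = artin_relations S m \<union> {(positive_word [s, s], []) | s. s \<in> S}"
  define \<phi> where "\<phi> w = word_refl (map fst w)" for w :: "('a \<times> bool) list"
  have step: "\<phi> v = \<phi> w" if "(v, w) \<in> presentation_cong S R" for v w
    using that
  proof induction
    case (cancel s u v b)
    then show ?case by (auto simp: \<phi>_def fun_eq_iff reflection_reflection)
  next
    case (relator l r u v)
    have pw: "map fst (positive_word w) = w" for w :: "'a list"
      by (induction w) (simp_all add: positive_word_def)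
    from relator(1) consider s t n where "s \<in> S" "t \<in> S" "s \<noteq> t" "m s t = enat n"
        "l = positive_word (alternating s t n)" "r = positive_word (alternating t s n)"
      | s where "s \<in> S" "l = positive_word [s, s]" "r = []"
      unfolding R_def artin_relations_def by blast
    then have "word_refl (map fst l) = word_refl (map fst r)"
    proof cases
      case 1
      show ?thesis unfolding 1(5,6) pw by (rule word_refl_braid[OF 1(1-4)])
    next
      case 2
      then show ?thesis by (simp add: pw fun_eq_iff reflection_reflection)
    qed
    then show ?case by (simp add: \<phi>_def)
  qed auto
  have "carrier reflection_group \<subseteq> (\<lambda>X. \<phi> (SOME w. w \<in> X)) ` carrier (coxeter_group S m)"
  proof
    fix x assume "x \<in> carrier reflection_group"
    then obtain w where w: "w \<in> lists S" "x = word_refl w" by auto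
    let ?p = "positive_word w"
    have pw: "map fst ?p = w" by (simp add: positive_word_def comp_def)
    have p: "?p \<in> group_words S"
      using w(1) by (auto simp: group_words_def positive_word_def in_lists_conv_set)
    let ?X = "presentation_cong S R `` {?p}"
    have "?p \<in> ?X" using presentation_cong.refl[OF p] by auto
    then have "(?p, SOME w. w \<in> ?X) \<in> presentation_cong S R"
      using someI[of "\<lambda>w. w \<in> ?X" ?p] by auto
    then have "x = \<phi> (SOME w. w \<in> ?X)" using step w(2) pw by (fastforce simp: \<phi>_def)
    moreover have "?X \<in> carrier (coxeter_group S m)"
      using p by (auto simp: coxeter_group_def presented_group_def R_def intro: quotientI)
    ultimately show "x \<in> (\<lambda>X. \<phi> (SOME w. w \<in> X)) ` carrier (coxeter_group S m)" by blast
  qed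
  then show ?thesis
    using assms finite_surj unfolding spherical_type_def by blast
qed

text \<open>
  Reflecting in turn in three pairwise non-commuting simple roots, each new coefficient is at least
  the sum of the two other ones minus the old one; hence the coefficients grow without bound.
\<close>

lemma unbounded_root:
  assumes S: "{r, s, t} \<subseteq> S" and ne: "r \<noteq> s" "r \<noteq> t" "s \<noteq> t"
    and label: "m r s \<noteq> 2" "m r t \<noteq> 2" "m s t \<noteq> 2"
  shows "\<exists>w\<in>lists S. \<exists>p q z. distinct [p, q, z] \<and> {p, q, z} = {r, s, t} \<and>
    (let v = word_refl w (simple_root t) in (\<forall>y. y \<notin> {r, s, t} \<longrightarrow> v y = 0) \<and>
      0 \<le> v p \<and> v p \<le> v q \<and> v q + 1 \<le> v z \<and> real n \<le> v z)"
proof (induction n)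
  case 0
  show ?case
    using ne by (intro bexI[of _ "[]"] exI[of _ r] exI[of _ s] exI[of _ t]) (auto simp: simple_root_def)
next
  case (Suc n)
  have lab: "m a b \<noteq> 2" if "a \<in> {r, s, t}" "b \<in> {r, s, t}" "a \<noteq> b" for a b
    using that label m_sym S by auto
  have step: "v p' + v z' - v q' \<le> reflection q' v q'"
    if "distinct [p', q', z']" "{p', q', z'} = {r, s, t}" "\<forall>y. y \<notin> {r, s, t} \<longrightarrow> v y = 0"
      "0 \<le> v p'" "0 \<le> v z'" for v p' q' z'
  proof -
    have w: "1 \<le> weight q' p'" "1 \<le> weight q' z'" and q': "q' \<in> S"
    proof -
      have "p' \<in> {r, s, t}" "q' \<in> {r, s, t}" "z' \<in> {r, s, t}" using that(2) by blast+
      moreover have "q' \<noteq> p'" "q' \<noteq> z'" using that(1) by auto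
      ultimately show "1 \<le> weight q' p'" "1 \<le> weight q' z'" "q' \<in> S"
        using lab S by (meson weight_ge_1 subsetD)+
    qed
    have "pairing q' v = (\<Sum>u\<in>{p', q', z'}. weight q' u * v u)"
      unfolding pairing_def using that(2,3) S finite_S by (intro sum.mono_neutral_right) auto
    also have "\<dots> = weight q' p' * v p' - 2 * v q' + weight q' z' * v z'"
      using that(1) q' by (simp add: weight_self)
    finally show ?thesis
      using mult_right_mono[OF w(1) that(4)] mult_right_mono[OF w(2) that(5)]
      by (simp add: reflection_def)
  qed
  obtain w p q z where w: "w \<in> lists S" and dist: "distinct [p, q, z]"
    and pqz: "{p, q, z} = {r, s, t}"
    and IH: "let v = word_refl w (simple_root t) in (\<forall>y. y \<notin> {r, s, t} \<longrightarrow> v y = 0) \<and>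
      0 \<le> v p \<and> v p \<le> v q \<and> v q + 1 \<le> v z \<and> real n \<le> v z"
    using Suc by blast
  define v where "v = word_refl w (simple_root t)"
  have v: "\<forall>y. y \<notin> {r, s, t} \<longrightarrow> v y = 0" "0 \<le> v p" "v p \<le> v q" "v q + 1 \<le> v z" "real n \<le> v z"
    using IH by (simp_all add: Let_def v_def)
  \<comment> \<open>Reflect in the smallest and then in the middle coordinate:
    \<open>v1 p \<ge> v z\<close> and \<open>v2 q \<ge> v1 p + 1\<close>, so the order becomes
    \<open>z\<close>, \<open>p\<close>, \<open>q\<close> and the largest coefficient has grown by at
    least one.\<close>
  define v1 where "v1 = reflection p v"
  define v2 where "v2 = reflection q v1"
  have mem: "p \<in> {r, s, t}" "q \<in> {r, s, t}" using pqz by blast+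
  have v1: "v1 q = v q" "v1 z = v z" "\<forall>y. y \<notin> {r, s, t} \<longrightarrow> v1 y = 0"
    using dist v(1) mem by (auto simp: v1_def reflection_def)
  have v1p: "v q + v z - v p \<le> v1 p"
    unfolding v1_def using step[of q p z v] dist pqz v by (auto simp: insert_commute)
  have v2: "v2 p = v1 p" "v2 z = v z" "\<forall>y. y \<notin> {r, s, t} \<longrightarrow> v2 y = 0"
    using dist v1 mem by (auto simp: v2_def reflection_def)
  have v2q: "v1 p + v z - v q \<le> v2 q"
    unfolding v2_def using step[of p q z v1] dist pqz v v1 v1p by (auto simp: insert_commute)
  have "v2 = word_refl (w @ [p, q]) (simple_root t)" by (simp add: v_def v1_def v2_def)
  moreover have "w @ [p, q] \<in> lists S" using w mem S by auto
  moreover have "distinct [z, p, q]" "{z, p, q} = {r, s, t}" using dist pqz by auto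
  moreover have "0 \<le> v2 z \<and> v2 z \<le> v2 p \<and> v2 p + 1 \<le> v2 q \<and> real (Suc n) \<le> v2 q"
    using v v1p v2 v2q by simp
  ultimately show ?case
    using v2(3) by (intro bexI[of _ "w @ [p, q]"] exI[of _ z] exI[of _ p] exI[of _ q]) (simp_all add: Let_def)
qed

lemma commuting_pair:
  assumes fin: "finite (carrier reflection_group)" and card: "3 \<le> card S"
  shows "\<exists>s\<in>S. \<exists>t\<in>S. s \<noteq> t \<and> m s t = 2"
proof (rule ccontr)
  assume "\<not> (\<exists>s\<in>S. \<exists>t\<in>S. s \<noteq> t \<and> m s t = 2)"
  then have label: "m s t \<noteq> 2" if "s \<in> S" "t \<in> S" "s \<noteq> t" for s t using that by blast
  obtain T where T: "T \<subseteq> S" "card T = 3"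
    using obtain_subset_with_card_n[OF card] by metis
  then obtain r s t where rst: "T = {r, s, t}" "r \<noteq> s" "r \<noteq> t" "s \<noteq> t"
    by (auto simp: card_3_iff)
  have sub: "{r, s, t} \<subseteq> S" using T rst by simp
  then have lab: "m r s \<noteq> 2" "m r t \<noteq> 2" "m s t \<noteq> 2" using label rst by simp_all
  define A where "A = (\<lambda>(x, u). x (simple_root t) u) ` (carrier reflection_group \<times> {r, s, t})"
  have "finite A" unfolding A_def using fin by blast
  obtain n where n: "Max A < real n" using reals_Archimedean2 by blast
  obtain w p q z where w: "w \<in> lists S" and z: "{p, q, z} = {r, s, t}"
    and v: "let v = word_refl w (simple_root t) in (\<forall>y. y \<notin> {r, s, t} \<longrightarrow> v y = 0) \<and>
      0 \<le> v p \<and> v p \<le> v q \<and> v q + 1 \<le> v z \<and> real n \<le> v z"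
    using unbounded_root[OF sub rst(2-4) lab, of n] by (elim bexE exE conjE) (rule that; assumption)
  have "z \<in> {r, s, t}" using z by blast
  then have "word_refl w (simple_root t) z \<in> A"
    unfolding A_def using w by (auto intro!: image_eqI[of _ _ "(word_refl w, z)"])
  then have "word_refl w (simple_root t) z \<le> Max A" using \<open>finite A\<close> by simp
  then show False using v n by (simp add: Let_def)
qed

end

section \<open>The Garside structure of the Artin-Tits group\<close>

declare in_listsI [rule del] in_listsD [rule del]

lemma artin_relations_words: "artin_relations S m \<subseteq> group_words S \<times> group_words S"
proof -
  have "positive_word (alternating s t n) \<in> group_words S" if "s \<in> S" "t \<in> S" for s t n
    using alternating_in_lists[OF that, of n]
    by (auto simp: positive_word_def group_words_def in_lists_conv_set)
  then show ?thesis by (auto simp: artin_relations_def)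
qed

definition positive_element :: "'a set \<Rightarrow> ('a \<Rightarrow> 'a \<Rightarrow> enat) \<Rightarrow> 'a list \<Rightarrow> ('a \<times> bool) list set" where
  "positive_element S m w = presentation_cong S (artin_relations S m) `` {positive_word w}"

lemma positive_word_in_group_words: "w \<in> lists S \<Longrightarrow> positive_word w \<in> group_words S"
  by (auto simp: positive_word_def group_words_def in_lists_conv_set)

lemma positive_word_append [simp]: "positive_word (v @ w) = positive_word v @ positive_word w"
  by (simp add: positive_word_def)

lemma positive_element_eq_iff:
  assumes "v \<in> lists S" "w \<in> lists S"
  shows "positive_element S m v = positive_element S m w \<longleftrightarrow>
    (positive_word v, positive_word w) \<in> presentation_cong S (artin_relations S m)"
  unfolding positive_element_def
  using eq_equiv_class_iff[OF equiv_presentation_cong[OF artin_relations_words]]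
    positive_word_in_group_words assms by metis

lemma positive_element_closed:
  "w \<in> lists S \<Longrightarrow> positive_element S m w \<in> carrier (artin_group S m)"
  using positive_word_in_group_words[of w S]
  by (auto simp: positive_element_def artin_group_def presented_group_def intro: quotientI)

lemma positive_element_mult:
  "v \<in> lists S \<Longrightarrow> w \<in> lists S \<Longrightarrow>
    positive_element S m v \<otimes>\<^bsub>artin_group S m\<^esub> positive_element S m w = positive_element S m (v @ w)"
  unfolding positive_element_def artin_group_def
  by (simp add: presented_group_mult[OF artin_relations_words] positive_word_in_group_words)

lemma positive_element_Nil: "positive_element S m [] = \<one>\<^bsub>artin_group S m\<^esub>"
  by (simp add: positive_element_def artin_group_def presented_group_def positive_word_def)

lemma braid_eq_positive_element:
  assumes "coxeter_matrix S m" "braid_eq S m v w" "v \<in> lists S"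
  shows "positive_element S m v = positive_element S m w"
  using assms(2) unfolding braid_eq_def
proof (induction rule: rtranclp_induct)
  case (step y z)
  have y: "y \<in> lists S"
    using step assms braid_eq_lists[of S m v y S] by (simp add: braid_eq_def)
  from step.hyps(2) have "positive_element S m y = positive_element S m z"
  proof cases
    case (1 s t n u v)
    have z: "z \<in> lists S" using y 1 by (simp add: alternating_in_lists)
    have "(positive_word (alternating s t n), positive_word (alternating t s n)) \<in> artin_relations S m"
      using 1 by (auto simp: artin_relations_def)
    moreover have "positive_word u \<in> group_words S" "positive_word v \<in> group_words S"
      using y 1 by (simp_all add: positive_word_in_group_words)
    ultimately have "(positive_word y, positive_word z) \<in> presentation_cong S (artin_relations S m)"
      unfolding 1 positive_word_append by (rule presentation_cong.relator)
    then show ?thesis using positive_element_eq_iff[OF y z] by blast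
  qed
  then show ?case using step by simp
qed simp

lemma positive_monoid_eq: "positive_monoid S m = positive_element S m ` lists S"
proof
  let ?A = "artin_group S m"
  interpret A: group ?A by (rule group_artin_group)
  have gen: "artin_gen S m s = positive_element S m [s]" for s
    by (simp add: artin_gen_def positive_element_def positive_word_def)
  have "submonoid (positive_element S m ` lists S) ?A"
  proof
    fix x y assume "x \<in> positive_element S m ` lists S" "y \<in> positive_element S m ` lists S"
    then obtain v w where "v \<in> lists S" "w \<in> lists S" "x = positive_element S m v" "y = positive_element S m w"
      by auto
    then have "x \<otimes>\<^bsub>?A\<^esub> y = positive_element S m (v @ w)" "v @ w \<in> lists S"
      by (simp_all add: positive_element_mult)
    then show "x \<otimes>\<^bsub>?A\<^esub> y \<in> positive_element S m ` lists S" by (rule image_eqI)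
  next
    show "\<one>\<^bsub>?A\<^esub> \<in> positive_element S m ` lists S"
      by (rule image_eqI[of _ _ "[]"]) (simp_all add: positive_element_Nil)
  qed (simp add: image_subset_iff positive_element_closed)
  then show "positive_monoid S m \<subseteq> positive_element S m ` lists S"
    unfolding positive_monoid_def by (intro hull_minimal) (auto simp: gen)
  have "positive_element S m w \<in> H"
    if H: "submonoid H ?A" "artin_gen S m ` S \<subseteq> H" and "w \<in> lists S" for w H
    using that(3)
  proof (induction w rule: list.induct)
    case Nil
    then show ?case using submonoid.one_closed[OF H(1)] by (simp add: positive_element_Nil)
  next
    case (Cons s w)
    then have "positive_element S m [s] \<in> H" using H(2) by (auto simp: gen)
    then have "positive_element S m [s] \<otimes>\<^bsub>?A\<^esub> positive_element S m w \<in> H"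
      using Cons submonoid.m_closed[OF H(1)] by simp
    then show ?case using Cons positive_element_mult[of "[s]" S w m] by simp
  qed
  then show "positive_element S m ` lists S \<subseteq> positive_monoid S m"
    unfolding positive_monoid_def hull_def by auto
qed

context finite_coxeter
begin

abbreviation A :: "('a \<times> bool) list set monoid" where "A \<equiv> artin_group S m"

abbreviation P :: "'a list \<Rightarrow> ('a \<times> bool) list set" where "P \<equiv> positive_element S m"

abbreviation R :: "(('a \<times> bool) list \<times> ('a \<times> bool) list) set" where "R \<equiv> artin_relations S m"

section \<open>Fractions with central denominators\<close>

lemma delta_pow_add: "delta_pow (i + j) = delta_pow i @ delta_pow j"
  by (induction i) simp_all

lemma funpow_map_twist_closed [simp]: "w \<in> lists S \<Longrightarrow> (map twist ^^ k) w \<in> lists S"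
  by (induction k) simp_all

lemma delta_pow_commute: "w \<in> lists S \<Longrightarrow> delta_pow k @ w \<approx> (map twist ^^ k) w @ delta_pow k"
proof (induction k)
  case (Suc k)
  have "delta @ (delta_pow k @ w) \<approx> delta @ ((map twist ^^ k) w @ delta_pow k)"
    using Suc by (intro braid_eq_append[OF braid_eq_refl]) simp_all
  also have "\<dots> = (delta @ (map twist ^^ k) w) @ delta_pow k" by simp
  also have "\<dots> \<approx> (map twist ((map twist ^^ k) w) @ delta) @ delta_pow k"
    using Suc by (intro braid_eq_append[OF delta_commute braid_eq_refl]) simp_all
  finally show ?case by simp
qed simp

definition center_pow :: "nat \<Rightarrow> 'a list" where "center_pow k = delta_pow (2 * k)"

lemma center_pow_closed [simp]: "center_pow k \<in> lists S"
  by (simp add: center_pow_def)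

lemma center_pow_add: "center_pow (i + j) = center_pow i @ center_pow j"
  unfolding center_pow_def distrib_left by (rule delta_pow_add)

lemma center_pow_0 [simp]: "center_pow 0 = []"
  by (simp add: center_pow_def)

text \<open>\<open>twist\<close> is an involution, so passing an even number of factors
  \<open>delta\<close> changes nothing.\<close>

lemma center_pow_commute:
  assumes "w \<in> lists S"
  shows "center_pow k @ w \<approx> w @ center_pow k"
proof -
  have "(map twist ^^ (2 * k)) w = w"
    using assms by (induction k) simp_all
  then show ?thesis using delta_pow_commute[OF assms, of "2 * k"] by (simp add: center_pow_def)
qed

text \<open>Stands for the square of \<Delta> times the inverse of \<open>s\<close>; it is a
  cofactor on both sides because the square is central.\<close>

definition gen_cmpl :: "'a \<Rightarrow> 'a list" where
  "gen_cmpl s = (SOME y. y \<in> lists S \<and> [s] @ y \<approx> center_pow 1)"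

lemma
  assumes s: "s \<in> S"
  shows gen_cmpl_closed [simp]: "gen_cmpl s \<in> lists S"
    and gen_gen_cmpl: "[s] @ gen_cmpl s \<approx> center_pow 1"
    and gen_cmpl_gen: "gen_cmpl s @ [s] \<approx> center_pow 1"
proof -
  obtain y where y: "y \<in> lists S" "delta \<approx> s # y" using delta_gen[OF s] .
  have "center_pow 1 = delta @ delta" by (simp add: center_pow_def numeral_2_eq_2)
  also have "\<dots> \<approx> (s # y) @ delta" using y by (intro braid_eq_append) simp_all
  finally have "[s] @ (y @ delta) \<approx> center_pow 1" using beq_sym by simp
  then have "\<exists>y. y \<in> lists S \<and> [s] @ y \<approx> center_pow 1" using y by (intro exI[of _ "y @ delta"]) simp
  from someI_ex[OF this, folded gen_cmpl_def]
  show c: "gen_cmpl s \<in> lists S" "[s] @ gen_cmpl s \<approx> center_pow 1" by auto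
  have "[s] @ (gen_cmpl s @ [s]) = ([s] @ gen_cmpl s) @ [s]" by simp
  also have "\<dots> \<approx> center_pow 1 @ [s]" using c by (intro braid_eq_append) simp_all
  also have "\<dots> \<approx> [s] @ center_pow 1" using s by (intro center_pow_commute) simp
  finally show "gen_cmpl s @ [s] \<approx> center_pow 1"
    using beq_cancel_left[of "[s]" "gen_cmpl s @ [s]" "center_pow 1"] c s by simp
qed

text \<open>
  Every group word is turned into a positive word, replacing \<open>s\<close> inverse by
  \<open>\<Delta> ^ 2\<close> times \<open>s\<close> inverse, which is positive; \<open>neg_count\<close> is the power of the central
  element \<open>\<Delta> ^ 2\<close> by which the result has to be divided.
\<close>

definition pos_part :: "('a \<times> bool) list \<Rightarrow> 'a list" where
  "pos_part w = concat (map (\<lambda>(s, b). if b then [s] else gen_cmpl s) w)"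

definition neg_count :: "('a \<times> bool) list \<Rightarrow> nat" where
  "neg_count w = length (filter (\<lambda>(s, b). \<not> b) w)"

lemma pos_part_append: "pos_part (v @ w) = pos_part v @ pos_part w"
  by (simp add: pos_part_def)

lemma neg_count_append: "neg_count (v @ w) = neg_count v + neg_count w"
  by (simp add: neg_count_def)

lemma pos_part_closed: "w \<in> group_words S \<Longrightarrow> pos_part w \<in> lists S"
proof (induction w rule: list.induct)
  case (Cons x w)
  obtain s b where "x = (s, b)" by force
  then show ?case using Cons by (cases b) (simp_all add: group_words_def pos_part_def)
qed (simp add: pos_part_def)

lemma pos_part_positive_word [simp]: "pos_part (positive_word w) = w"
  by (induction w) (simp_all add: pos_part_def positive_word_def)

lemma neg_count_positive_word [simp]: "neg_count (positive_word w) = 0"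
  by (induction w) (simp_all add: neg_count_def positive_word_def)

text \<open>Equality of fractions, cross-multiplied. Transitivity is the step that needs left
  cancellation.\<close>

lemma presentation_cong_pos_part:
  assumes "(v, w) \<in> presentation_cong S R"
  shows "center_pow (neg_count w) @ pos_part v \<approx> center_pow (neg_count v) @ pos_part w"
  using assms
proof induction
  case (sym v w)
  then show ?case using beq_sym by blast
next
  case (trans u v w)
  let ?u = "pos_part u" and ?v = "pos_part v" and ?w = "pos_part w"
  let ?a = "neg_count u" and ?b = "neg_count v" and ?c = "neg_count w"
  have cl: "?u \<in> lists S" "?w \<in> lists S"
    using presentation_cong_words[OF artin_relations_words] trans.hyps pos_part_closed by blast+
  have "center_pow ?b @ (center_pow ?c @ ?u) = center_pow ?c @ (center_pow ?b @ ?u)"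
    by (metis append_assoc center_pow_add add.commute)
  also have "\<dots> \<approx> center_pow ?c @ (center_pow ?a @ ?v)"
    by (rule braid_eq_append[OF braid_eq_refl trans.IH(1)])
  also have "\<dots> = center_pow ?a @ (center_pow ?c @ ?v)"
    by (metis append_assoc center_pow_add add.commute)
  also have "\<dots> \<approx> center_pow ?a @ (center_pow ?b @ ?w)"
    by (rule braid_eq_append[OF braid_eq_refl trans.IH(2)])
  also have "\<dots> = center_pow ?b @ (center_pow ?a @ ?w)"
    by (metis append_assoc center_pow_add add.commute)
  finally show ?case
    by (rule beq_cancel_left[rotated 3]) (simp_all add: cl)
next
  case (cancel s u v b)
  let ?u = "pos_part u" and ?v = "pos_part v" and ?n = "neg_count u + neg_count v"
  have cl: "?u \<in> lists S" "?v \<in> lists S" using cancel pos_part_closed by blast+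
  have n: "neg_count [(s, b), (s, \<not> b)] = 1" by (cases b) (simp_all add: neg_count_def)
  have "pos_part [(s, b), (s, \<not> b)] \<approx> center_pow 1"
    using gen_gen_cmpl[OF cancel(1)] gen_cmpl_gen[OF cancel(1)] by (cases b) (simp_all add: pos_part_def)
  then have "center_pow ?n @ (?u @ pos_part [(s, b), (s, \<not> b)] @ ?v) \<approx>
      center_pow ?n @ (?u @ center_pow 1 @ ?v)"
    by (intro braid_eq_append[OF braid_eq_refl] braid_eq_context)
  also have "\<dots> = center_pow ?n @ (?u @ center_pow 1) @ ?v" by simp
  also have "\<dots> \<approx> center_pow ?n @ (center_pow 1 @ ?u) @ ?v"
    using center_pow_commute[OF cl(1)] beq_sym by (intro braid_eq_context) blast
  also have "\<dots> = center_pow (?n + 1) @ (?u @ ?v)"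
    by (simp only: center_pow_add append_assoc)
  finally show ?case
    unfolding pos_part_append neg_count_append n by (simp only: add.commute add.left_commute append_assoc)
next
  case (relator l r u v)
  then obtain s t n where "s \<in> S" "t \<in> S" "s \<noteq> t" "m s t = enat n"
      and lr: "l = positive_word (alternating s t n)" "r = positive_word (alternating t s n)"
    by (auto simp: artin_relations_def)
  then have "pos_part l \<approx> pos_part r" using braid_eq_alternating by (simp add: lr)
  then have "center_pow (neg_count (u @ r @ v)) @ (pos_part u @ pos_part l @ pos_part v) \<approx>
      center_pow (neg_count (u @ r @ v)) @ (pos_part u @ pos_part r @ pos_part v)"
    by (intro braid_eq_append[OF braid_eq_refl] braid_eq_context)
  then show ?case by (simp add: pos_part_append neg_count_append lr)
qed simp

theorem positive_element_eq:
  assumes "v \<in> lists S" "w \<in> lists S"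
  shows "P v = P w \<longleftrightarrow> v \<approx> w"
proof
  assume "P v = P w"
  then have "(positive_word v, positive_word w) \<in> presentation_cong S R"
    using positive_element_eq_iff[OF assms] by simp
  from presentation_cong_pos_part[OF this] show "v \<approx> w" by simp
next
  assume "v \<approx> w"
  then show "P v = P w" using braid_eq_positive_element[OF coxeter _ assms(1)] by simp
qed

section \<open>The Garside element, infimum, supremum and absorption\<close>

sublocale A: group A
  by (rule group_artin_group)

lemma P_closed [simp]: "w \<in> lists S \<Longrightarrow> P w \<in> carrier A"
  by (rule positive_element_closed)

lemma P_append: "v \<in> lists S \<Longrightarrow> w \<in> lists S \<Longrightarrow> P (v @ w) = P v \<otimes>\<^bsub>A\<^esub> P w"
  by (simp add: positive_element_mult)

lemma positive_prefix_iff: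
  assumes "v \<in> lists S" "w \<in> lists S"
  shows "positive_prefix S m (P v) (P w) \<longleftrightarrow> (\<exists>y\<in>lists S. w \<approx> v @ y)"
proof -
  have "inv\<^bsub>A\<^esub> P v \<otimes>\<^bsub>A\<^esub> P w = P y \<longleftrightarrow> w \<approx> v @ y" if y: "y \<in> lists S" for y
  proof -
    have "inv\<^bsub>A\<^esub> P v \<otimes>\<^bsub>A\<^esub> P w = P y \<longleftrightarrow> P w = P v \<otimes>\<^bsub>A\<^esub> P y"
      using assms y A.inv_solve_left[of "P y" "P v" "P w"] by auto
    also have "\<dots> \<longleftrightarrow> w \<approx> v @ y"
      using assms y positive_element_eq[of w "v @ y"] by (simp add: P_append)
    finally show ?thesis .
  qed
  then show ?thesis unfolding positive_prefix_def positive_monoid_eq by blast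
qed

lemma artin_gen_eq: "artin_gen S m s = P [s]"
  by (simp add: artin_gen_def positive_element_def positive_word_def)

theorem garside_eq: "garside S m = P delta"
  unfolding garside_def
proof (rule the_equality)
  let ?lcm = "\<lambda>d. d \<in> positive_monoid S m \<and>
    (\<forall>s\<in>S. positive_prefix S m (artin_gen S m s) d) \<and>
    (\<forall>c\<in>positive_monoid S m.
      (\<forall>s\<in>S. positive_prefix S m (artin_gen S m s) c) \<longrightarrow> positive_prefix S m d c)"
  have gens: "(\<forall>s\<in>S. positive_prefix S m (artin_gen S m s) (P c)) \<longleftrightarrow>
      (\<forall>s\<in>S. \<exists>y\<in>lists S. c \<approx> s # y)" if "c \<in> lists S" for c
    using that by (simp add: artin_gen_eq positive_prefix_iff)
  have delta_gens: "\<forall>s\<in>S. \<exists>y\<in>lists S. delta \<approx> s # y" using delta_gen by metis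
  show lcm: "?lcm (P delta)"
  proof (intro conjI ballI impI)
    show "P delta \<in> positive_monoid S m" by (simp add: positive_monoid_eq)
    show "positive_prefix S m (artin_gen S m s) (P delta)" if "s \<in> S" for s
      using that delta_gens gens[of delta] by simp
    fix c assume "c \<in> positive_monoid S m" and div: "\<forall>s\<in>S. positive_prefix S m (artin_gen S m s) c"
    then obtain w where w: "w \<in> lists S" "c = P w" by (auto simp: positive_monoid_eq)
    then have "\<forall>s\<in>S. \<exists>y\<in>lists S. w \<approx> s # y" using div gens[of w] by simp
    then obtain y where "y \<in> lists S" "w \<approx> delta @ y"
      using delta_least[OF w(1)] by metis
    then show "positive_prefix S m (P delta) c" using w by (auto simp: positive_prefix_iff)
  qed
  \<comment> \<open>Two least common multiples divide each other, and lengths make the cofactors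
    empty.\<close>
  fix d assume d: "?lcm d"
  then obtain e where e: "e \<in> lists S" "d = P e" by (auto simp: positive_monoid_eq)
  have "positive_prefix S m (P delta) (P e)" using lcm d e by blast
  moreover have "positive_prefix S m (P e) (P delta)" using lcm d e by blast
  ultimately obtain y z where y: "y \<in> lists S" "e \<approx> delta @ y" and "delta \<approx> e @ z"
    using e by (auto simp: positive_prefix_iff)
  then have "length e = length delta + length y" "length delta = length e + length z"
    using braid_eq_length by fastforce+
  then have "e \<approx> delta" using y by simp
  then show "d = P delta" using e positive_element_eq by simp
qed

abbreviation \<Delta> :: "('a \<times> bool) list set" where "\<Delta> \<equiv> P delta"

lemma delta_pow_P: "P (delta_pow k) = \<Delta> [^]\<^bsub>A\<^esub> k"
proof (induction k)
  case (Suc k)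
  then show ?case using A.nat_pow_Suc2[of \<Delta> k] by (simp add: P_append)
qed (simp add: positive_element_Nil)

lemma length_delta_pos: "0 < length delta"
proof -
  obtain s where s: "s \<in> S" using nonempty by auto
  obtain y where "delta \<approx> s # y" using delta_gen[OF s] .
  then show ?thesis using braid_eq_length by fastforce
qed

lemma garside_inf_eq_0:
  assumes w: "w \<in> lists S" and no: "\<And>y. y \<in> lists S \<Longrightarrow> \<not> w \<approx> delta @ y"
  shows "garside_inf S m (P w) = 0"
  unfolding garside_inf_def garside_eq
proof (rule Greatest_equality)
  show "\<Delta> [^]\<^bsub>A\<^esub> (- 0::int) \<otimes>\<^bsub>A\<^esub> P w \<in> positive_monoid S m"
    using w by (simp add: positive_monoid_eq)
  fix k :: int assume "\<Delta> [^]\<^bsub>A\<^esub> (- k) \<otimes>\<^bsub>A\<^esub> P w \<in> positive_monoid S m"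
  then obtain y where y: "y \<in> lists S" "\<Delta> [^]\<^bsub>A\<^esub> (- k) \<otimes>\<^bsub>A\<^esub> P w = P y"
    by (auto simp: positive_monoid_eq)
  show "k \<le> 0"
  proof (rule ccontr)
    assume "\<not> k \<le> 0"
    then obtain n where n: "k = int (Suc n)" by (metis not_le zero_less_imp_eq_int Suc_pred)
    have c: "\<Delta> [^]\<^bsub>A\<^esub> Suc n \<in> carrier A" by (intro A.nat_pow_closed P_closed delta_closed)
    have "P y = inv\<^bsub>A\<^esub> (\<Delta> [^]\<^bsub>A\<^esub> Suc n) \<otimes>\<^bsub>A\<^esub> P w"
      unfolding y(2)[symmetric] n A.int_pow_neg_int[OF P_closed[OF delta_closed]] ..
    then have "P w = \<Delta> [^]\<^bsub>A\<^esub> Suc n \<otimes>\<^bsub>A\<^esub> P y"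
      using A.inv_solve_left[OF P_closed[OF y(1)] c P_closed[OF w]] by (rule iffD1[rotated])
    also have "\<dots> = P (delta_pow (Suc n) @ y)"
      unfolding P_append[OF delta_pow_closed y(1)] delta_pow_P ..
    finally have "w \<approx> delta_pow (Suc n) @ y"
      using positive_element_eq[of w "delta_pow (Suc n) @ y"] w y by simp
    then have "w \<approx> delta @ delta_pow n @ y" by simp
    then show False using no y by simp
  qed
qed

lemma garside_sup_eq:
  assumes w: "w \<in> lists S" and q: "q \<in> lists S" "w @ q \<approx> delta_pow n"
    and least: "\<And>k y. y \<in> lists S \<Longrightarrow> w @ y \<approx> delta_pow k \<Longrightarrow> n \<le> k"
  shows "garside_sup S m (P w) = int n"
  unfolding garside_sup_def garside_eq
proof (rule Least_equality)
  have "P w \<otimes>\<^bsub>A\<^esub> P q = \<Delta> [^]\<^bsub>A\<^esub> n"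
    using positive_element_eq[of "w @ q" "delta_pow n"] w q by (simp add: P_append delta_pow_P)
  then have "inv\<^bsub>A\<^esub> P w \<otimes>\<^bsub>A\<^esub> \<Delta> [^]\<^bsub>A\<^esub> n = P q"
    using A.inv_solve_left[of "P q" "P w" "\<Delta> [^]\<^bsub>A\<^esub> n"] w q by simp
  then show "inv\<^bsub>A\<^esub> P w \<otimes>\<^bsub>A\<^esub> \<Delta> [^]\<^bsub>A\<^esub> int n \<in> positive_monoid S m"
    using q by (simp add: positive_monoid_eq int_pow_int)
  fix k :: int assume "inv\<^bsub>A\<^esub> P w \<otimes>\<^bsub>A\<^esub> \<Delta> [^]\<^bsub>A\<^esub> k \<in> positive_monoid S m"
  then obtain y where y: "y \<in> lists S" "P y = inv\<^bsub>A\<^esub> P w \<otimes>\<^bsub>A\<^esub> \<Delta> [^]\<^bsub>A\<^esub> k"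
    by (auto simp: positive_monoid_eq)
  then have eq: "\<Delta> [^]\<^bsub>A\<^esub> k = P w \<otimes>\<^bsub>A\<^esub> P y"
    using A.inv_solve_left[of "P y" "P w" "\<Delta> [^]\<^bsub>A\<^esub> k"] w by simp
  show "int n \<le> k"
  proof (cases "0 \<le> k")
    case True
    then obtain j where j: "k = int j" by (metis zero_le_imp_eq_int)
    then have "P (w @ y) = P (delta_pow j)"
      using eq w y by (simp add: P_append delta_pow_P int_pow_int)
    then have "w @ y \<approx> delta_pow j" using positive_element_eq w y by simp
    then show ?thesis using least y j by simp
  next
    \<comment> \<open>A negative exponent would make a nonempty positive word equivalent to the
      empty one.\<close>
    case False
    then obtain j where j: "k = - int (Suc j)"
      by (metis not_le neg_0_less_iff_less zero_less_imp_eq_int Suc_pred minus_minus)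
    have "P (w @ y) = inv\<^bsub>A\<^esub> (\<Delta> [^]\<^bsub>A\<^esub> Suc j)"
      using eq by (simp only: j A.int_pow_neg_int[OF P_closed[OF delta_closed]] P_append[OF w y(1)])
    then have "P (delta_pow (Suc j) @ (w @ y)) = \<Delta> [^]\<^bsub>A\<^esub> Suc j \<otimes>\<^bsub>A\<^esub> inv\<^bsub>A\<^esub> (\<Delta> [^]\<^bsub>A\<^esub> Suc j)"
      using P_append[of "delta_pow (Suc j)" "w @ y"] w y
      by (simp only: delta_pow_P delta_pow_closed append_in_lists_conv)
    also have "\<dots> = P []" using A.r_inv[of "\<Delta> [^]\<^bsub>A\<^esub> Suc j"] by (simp add: positive_element_Nil)
    finally have "delta_pow (Suc j) @ (w @ y) \<approx> []"
      using positive_element_eq[of "delta_pow (Suc j) @ (w @ y)" "[]"] w y by simp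
    then show ?thesis using braid_eq_length length_delta_pos by fastforce
  qed
qed

text \<open>The absorbing element is \<open>t ^ n\<close>. Its supremum and that of its product with
  \<open>y\<close> are at least \<open>n\<close> by \<open>gen_pow_prefix_delta_pow\<close> and at
  most \<open>n\<close> by the cofactors read off \<open>eq\<close>; the infima vanish because no
  word involved is divisible by \<open>delta\<close>.\<close>

lemma absorbable_positive:
  assumes small: "\<And>s. s \<in> S \<Longrightarrow> g s \<noteq> w0" and t: "t \<in> S"
    and y: "y \<in> lists S" and q: "q \<in> lists S"
    and eq: "(replicate n t @ y) @ q \<approx> delta_pow n"
    and no1: "\<And>z. z \<in> lists S \<Longrightarrow> \<not> y \<approx> delta @ z"
    and no2: "\<And>z. z \<in> lists S \<Longrightarrow> \<not> replicate n t @ y \<approx> delta @ z"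
  shows "P y \<in> absorbable_elements S m"
proof -
  let ?x = "replicate n t"
  have x: "?x \<in> lists S" using t by (simp add: in_lists_conv_set)
  have no3: "\<not> ?x \<approx> delta @ z" if z: "z \<in> lists S" for z
  proof
    assume "?x \<approx> delta @ z"
    then have "?x @ y \<approx> (delta @ z) @ y" by (rule braid_eq_append[OF _ braid_eq_refl])
    then show False using no2[of "z @ y"] z y by simp
  qed
  have least: "n \<le> k" if "v \<in> lists S" "?x @ v \<approx> delta_pow k" for k v
    using gen_pow_prefix_delta_pow[OF small t that] .
  have "garside_sup S m (P (?x @ y)) = int n"
    using eq y q x least[of "y @ _"] by (intro garside_sup_eq[of _ q]) simp_all
  moreover have "garside_sup S m (P ?x) = int n"
    using eq y q x least by (intro garside_sup_eq[of _ "y @ q"]) simp_all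
  moreover have "garside_inf S m (P (?x @ y)) = 0" "garside_inf S m (P ?x) = 0" "garside_inf S m (P y) = 0"
    using no1 no2 no3 x y by (simp_all add: garside_inf_eq_0)
  ultimately show ?thesis
    unfolding absorbable_elements_def using x y
    by (simp add: P_append) (rule bexI[of _ "P ?x"], simp_all)
qed

lemma gen_neq_w0:
  assumes "2 \<le> card S" "s \<in> S"
  shows "g s \<noteq> w0"
proof
  assume eq: "g s = w0"
  have "S \<noteq> {s}" using assms by auto
  then obtain t where t: "t \<in> S" "t \<noteq> s" using assms(2) by auto
  then have "g t \<preceq> g s" using prefix_le_w0 by (simp add: eq)
  then have "g t = g s" using prefix_le_antisym[of "g t" "g s"] assms t by simp
  then show False using gen_inj assms t by blast
qed

lemma alternating_prefix_delta:
  assumes "s \<in> S" "t \<in> S" "s \<noteq> t" "m s t = enat n"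
  obtains y where "y \<in> lists S" "delta \<approx> alternating s t n @ y"
proof -
  let ?a = "alternating s t n"
  have a: "?a \<in> lists S" using assms by (simp add: alternating_in_lists)
  have l: "len (ev ?a) = n" using finite_label[of s t] assms by (metis enat.inject)
  have "delta \<approx> red (ev ?a) @ red (cmpl (ev ?a))"
    unfolding delta_def using red_mult[of "ev ?a" "cmpl (ev ?a)"] len_cmpl[of "ev ?a"] a by simp
  also have "\<dots> \<approx> ?a @ red (cmpl (ev ?a))"
    using a l by (intro braid_eq_append red_ev) simp_all
  finally show thesis using that[of "red (cmpl (ev ?a))"] a by simp
qed

text \<open>Absorbed by a neighbour \<open>t\<close>, with \<open>n = 1\<close>: the word
  \<open>t s\<close> starts the braid word of length at least 3, which divides \<open>delta\<close>,
  and it is too short to be divisible by \<open>delta\<close>.\<close>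

lemma absorbable_gen:
  assumes s: "s \<in> S" and t: "t \<in> S" and st: "s \<noteq> t" "m s t \<noteq> 2"
  shows "P [s] \<in> absorbable_elements S m"
proof -
  have small: "g r \<noteq> w0" if "r \<in> S" for r
  proof -
    have "card {s, t} \<le> card S" using s t coxeter by (intro card_mono) (auto simp: coxeter_matrix_def)
    then show ?thesis using gen_neq_w0 that st by simp
  qed
  obtain n where n: "m t s = enat n" "2 \<le> n" using finite_label[OF t s] st by metis
  have "n \<noteq> 2" using n st label_sym[OF s t] by (auto simp: numeral_eq_enat)
  with n(2) obtain k where k: "n = Suc (Suc (Suc k))"
    by (metis Suc_le_D le_antisym not_less_eq_eq numeral_2_eq_2)
  obtain y where y: "y \<in> lists S" "delta \<approx> alternating t s n @ y"
    using alternating_prefix_delta[OF t s _ n(1)] st by metis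
  have long: "3 \<le> length delta" using braid_eq_length[OF y(2)] k by simp
  have "\<not> w \<approx> delta @ z" if "length w \<le> 2" for w z
    using that long braid_eq_length[of S m w "delta @ z"] by auto
  moreover have "(replicate 1 t @ [s]) @ (alternating t s (Suc k) @ y) \<approx> delta_pow 1"
    using beq_sym[OF y(2)] by (simp add: k)
  ultimately show ?thesis
    using s t y by (intro absorbable_positive[OF small t, of "[s]" "alternating t s (Suc k) @ y" 1])
      (simp_all add: alternating_in_lists)
qed

lemma replicate_commute:
  assumes "s \<in> S" "t \<in> S" "[s, t] \<approx> [t, s]"
  shows "replicate i s @ replicate j t \<approx> replicate j t @ replicate i s"
proof -
  have *: "s # replicate j t \<approx> replicate j t @ [s]" for j
  proof (induction j)
    case (Suc j)
    have "[s, t] @ replicate j t \<approx> [t, s] @ replicate j t"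
      using assms by (intro braid_eq_append) simp_all
    also have "\<dots> = [t] @ (s # replicate j t)" by simp
    also have "\<dots> \<approx> [t] @ (replicate j t @ [s])"
      by (rule braid_eq_append[OF braid_eq_refl Suc.IH])
    finally show ?case by simp
  qed simp
  show ?thesis
  proof (induction i)
    case (Suc i)
    have "[s] @ (replicate i s @ replicate j t) \<approx> [s] @ (replicate j t @ replicate i s)"
      by (rule braid_eq_append[OF braid_eq_refl Suc.IH])
    also have "\<dots> = (s # replicate j t) @ replicate i s" by simp
    also have "\<dots> \<approx> (replicate j t @ [s]) @ replicate i s"
      by (rule braid_eq_append[OF * braid_eq_refl])
    finally show ?case by simp
  qed simp
qed

text \<open>
  If \<open>s\<close> and \<open>t\<close> commute and \<open>S\<close> has a third element, then \<open>\<Delta> ^ n\<close> is the product of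
  \<open>s ^ n\<close>, \<open>t ^ n\<close> and a third factor, and none of the three factors, nor the product of two
  cyclically consecutive ones, is divisible by \<open>\<Delta>\<close>. So each factor is absorbed by its predecessor.
\<close>

lemma delta_pow_absorbable:
  fixes n :: nat
  assumes s: "s \<in> S" and t: "t \<in> S" and st: "s \<noteq> t" "m s t = 2" and card: "3 \<le> card S" and n: "0 < n"
  obtains x y z where "x \<in> absorbable_elements S m" "y \<in> absorbable_elements S m"
    "z \<in> absorbable_elements S m" "\<Delta> [^]\<^bsub>A\<^esub> n = x \<otimes>\<^bsub>A\<^esub> y \<otimes>\<^bsub>A\<^esub> z"
proof -
  have small: "g r \<noteq> w0" if "r \<in> S" for r using gen_neq_w0 that card by simp
  have "\<not> S \<subseteq> {s, t}"
    using card card_mono[of "{s, t}" S] st by auto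
  then obtain r where r: "r \<in> S" "r \<noteq> s" "r \<noteq> t" by blast
  have m2: "m s t = enat 2" using st by (simp add: numeral_eq_enat)
  have comm: "[s, t] \<approx> [t, s]"
    using braid_eq_alternating[of s S t m 2] s t st(1) m2 by (simp add: numeral_2_eq_2)
  obtain d where d: "d \<in> lists S" "delta \<approx> [s, t] @ d"
    using alternating_prefix_delta[OF s t st(1) m2] by (auto simp: numeral_2_eq_2)
  let ?s = "\<lambda>n. replicate n s" and ?t = "\<lambda>n. replicate n t"
  have rep: "replicate n u \<in> lists S" if "u \<in> S" for u n using that by (simp add: in_lists_conv_set)
  \<comment> \<open>\<open>[s, t] @ d\<close> is one more \<open>delta\<close>; exchanging it with
    the old cofactor twists the latter, so the new cofactor is
    \<open>d @ map twist Z\<close>.\<close>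
  have "\<exists>Z\<in>lists S. ?s n @ ?t n @ Z \<approx> delta_pow n" for n
  proof (induction n)
    case (Suc n)
    then obtain Z where Z: "Z \<in> lists S" "?s n @ ?t n @ Z \<approx> delta_pow n" by auto
    have "?s (Suc n) @ ?t (Suc n) @ (d @ map twist Z) = ?s n @ ([s] @ ?t n) @ [t] @ d @ map twist Z"
      by (simp add: replicate_app_Cons_same)
    also have "\<dots> \<approx> ?s n @ (?t n @ [s]) @ [t] @ d @ map twist Z"
      using replicate_commute[OF s t comm, of 1 n] by (intro braid_eq_context) simp
    also have "\<dots> = (?s n @ ?t n) @ ([s, t] @ d) @ map twist Z" by simp
    also have "\<dots> \<approx> (?s n @ ?t n) @ delta @ map twist Z"
      using d beq_sym by (intro braid_eq_context) simp
    also have "\<dots> \<approx> (?s n @ ?t n) @ (Z @ delta)"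
      using delta_commute[of "map twist Z"] Z by (intro braid_eq_append[OF braid_eq_refl]) simp
    also have "\<dots> = (?s n @ ?t n @ Z) @ delta" by simp
    also have "\<dots> \<approx> delta_pow n @ delta"
      using Z by (intro braid_eq_append) simp_all
    also have "\<dots> = delta_pow (Suc n)" using delta_pow_add[of n 1] delta_pow_add[of 1 n] by simp
    finally show ?case using d Z by (intro bexI[of _ "d @ map twist Z"]) simp_all
  qed (auto intro: bexI[of _ "[]"])
  then obtain Z where Z: "Z \<in> lists S" "?s n @ ?t n @ Z \<approx> delta_pow n" by blast
  have no_delta: "\<not> w \<approx> delta @ z" if "r \<notin> set w" for w z
  proof
    assume "w \<approx> delta @ z"
    obtain y where "delta \<approx> r # y" using delta_gen[OF r(1)] .
    then have "r \<in> set delta" using braid_eq_set[OF coxeter] by fastforce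
    then show False using that braid_eq_set[OF coxeter \<open>w \<approx> delta @ z\<close>] by simp
  qed
  \<comment> \<open>Cancelling one \<open>delta\<close> would leave the n-th power of
    \<open>twist u\<close> as a divisor of the power of \<open>delta\<close> with exponent
    \<open>n - 1\<close>.\<close>
  have no: "\<not> replicate n u @ (delta @ y) \<approx> delta_pow n" if u: "u \<in> S" "y \<in> lists S" for u y
  proof
    assume eq: "replicate n u @ (delta @ y) \<approx> delta_pow n"
    obtain k where k: "n = Suc k" using n by (cases n) auto
    have "delta @ (map twist (replicate n u) @ y) = (delta @ map twist (replicate n u)) @ y" by simp
    also have "\<dots> \<approx> (replicate n u @ delta) @ y"
      using delta_commute[of "map twist (replicate n u)"] rep[of "twist u" n] u(1)
      by (intro braid_eq_append[OF _ braid_eq_refl]) simp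
    also have "\<dots> \<approx> delta_pow n" using eq by simp
    also have "delta_pow n = delta @ delta_pow k" by (simp add: k)
    finally have "map twist (replicate n u) @ y \<approx> delta_pow k"
      by (rule delta_cancel[rotated 2]) (simp_all add: u rep)
    then have "n \<le> k" using gen_pow_prefix_delta_pow[OF small, of "twist u" y] u by simp
    then show False by (simp add: k)
  qed
  have st_Z: "(?s n @ ?t n) @ Z \<approx> delta_pow n" using Z by simp
  have ts_Z: "(?t n @ ?s n) @ Z \<approx> delta_pow n"
    using braid_eq_append[OF replicate_commute[OF s t comm, of n n] braid_eq_refl[of S m Z]] st_Z beq_sym
      braid_eq_trans by blast
  \<comment> \<open>The absorbing powers are \<open>t ^ n\<close> for \<open>s ^ n\<close>,
    \<open>s ^ n\<close> for \<open>t ^ n\<close>, and \<open>t ^ n\<close> for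
    \<open>Z\<close>.\<close>
  have "P (?s n) \<in> absorbable_elements S m"
    using ts_Z rep s t Z r by (intro absorbable_positive[OF small t _ Z(1)] no_delta) simp_all
  moreover have "P (?t n) \<in> absorbable_elements S m"
    using st_Z rep s t Z r by (intro absorbable_positive[OF small s _ Z(1)] no_delta) simp_all
  moreover have "P Z \<in> absorbable_elements S m"
  proof (rule absorbable_positive[OF small t])
    \<comment> \<open>Carrying \<open>s ^ n\<close> through the n-th power of \<open>delta\<close>
      twists it \<open>n\<close> times; cancelling \<open>s ^ n\<close> on the left then shows that
      \<open>?q\<close> completes \<open>?t n @ Z\<close> to that power.\<close>
    let ?q = "(map twist ^^ n) (?s n)"
    have q: "?q \<in> lists S" using rep s by simp
    show "?q \<in> lists S" by (rule q)
    have twice: "(map twist ^^ k) ((map twist ^^ k) w) = w" if "w \<in> lists S" for w k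
      using that
    proof (induction k arbitrary: w)
      case (Suc k)
      have "(map twist ^^ Suc k) ((map twist ^^ Suc k) w)
          = map twist ((map twist ^^ k) ((map twist ^^ k) (map twist w)))"
        by (simp add: funpow_swap1)
      then show ?case using Suc by simp
    qed simp
    have "?s n @ ((?t n @ Z) @ ?q) = (?s n @ ?t n @ Z) @ ?q" by simp
    also have "\<dots> \<approx> delta_pow n @ ?q" using Z by (intro braid_eq_append) simp_all
    also have "\<dots> \<approx> ?s n @ delta_pow n"
      using delta_pow_commute[OF q, of n] twice[of "?s n" n] rep[OF s] by simp
    finally show "(?t n @ Z) @ ?q \<approx> delta_pow n"
      by (rule beq_cancel_left[rotated 3]) (use rep s t Z q in simp_all)
    show "\<not> ?t n @ Z \<approx> delta @ z" if z: "z \<in> lists S" for z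
    proof
      assume "?t n @ Z \<approx> delta @ z"
      then have "?s n @ (delta @ z) \<approx> ?s n @ (?t n @ Z)"
        using beq_sym by (intro braid_eq_append[OF braid_eq_refl]) blast
      also have "\<dots> \<approx> delta_pow n" using Z by simp
      finally show False using no s z by blast
    qed
    show "\<not> Z \<approx> delta @ z" if z: "z \<in> lists S" for z
    proof
      assume eq: "Z \<approx> delta @ z"
      have "?s n @ (delta @ (map twist (?t n) @ z)) = ?s n @ ((delta @ map twist (?t n)) @ z)" by simp
      also have "\<dots> \<approx> ?s n @ ((?t n @ delta) @ z)"
        using delta_commute[of "map twist (?t n)"] rep[of "twist t" n] t
        by (intro braid_eq_append[OF braid_eq_refl] braid_eq_append[OF _ braid_eq_refl]) simp
      also have "\<dots> = (?s n @ ?t n) @ (delta @ z)" by simp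
      also have "\<dots> \<approx> (?s n @ ?t n) @ Z"
        using beq_sym[OF eq] by (intro braid_eq_append[OF braid_eq_refl])
      also have "\<dots> \<approx> delta_pow n" by (rule st_Z)
      finally show False using no[OF s, of "map twist (?t n) @ z"] z rep[of "twist t" n] t by simp
    qed
  qed (simp_all add: Z(1))
  moreover have "\<Delta> [^]\<^bsub>A\<^esub> n = P (?s n) \<otimes>\<^bsub>A\<^esub> P (?t n) \<otimes>\<^bsub>A\<^esub> P Z"
    using positive_element_eq[of "?s n @ ?t n @ Z" "delta_pow n"] Z rep s t
    by (simp add: P_append A.m_assoc flip: delta_pow_P)
  ultimately show thesis using that by blast
qed

end

section \<open>The quasi-isometry\<close>

text \<open>Keeps all estimates in natural numbers; only \<open>graph_dist_le\<close> and
  \<open>graph_dist_cases\<close> translate to the extended real distance.\<close>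

definition joined :: "'v pair_pre_digraph \<Rightarrow> 'v \<Rightarrow> 'v \<Rightarrow> nat \<Rightarrow> bool" where
  "joined G u v k \<longleftrightarrow> (\<exists>p. pre_digraph.awalk (with_proj G) u p v \<and> length p \<le> k)"

lemma joined_mono: "joined G u v i \<Longrightarrow> i \<le> j \<Longrightarrow> joined G u v j"
  unfolding joined_def using order_trans by blast

context pair_wf_digraph
begin

lemma joined_refl: "u \<in> pverts G \<Longrightarrow> joined G u u k"
  unfolding joined_def by (intro exI[of _ "[]"]) (simp add: awalk_Nil_iff)

lemma joined_arc: "(u, v) \<in> parcs G \<Longrightarrow> joined G u v 1"
  unfolding joined_def using arc_implies_awalk[of "(u, v)"] by (intro exI[of _ "[(u, v)]"]) simp

lemma joined_trans: "joined G u v i \<Longrightarrow> joined G v w j \<Longrightarrow> joined G u w (i + j)"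
  unfolding joined_def using awalk_appendI by (metis add_mono length_append)

lemma joined_induct [consumes 1, case_names refl step mono]:
  assumes "joined G u v k"
    and "\<And>u. u \<in> pverts G \<Longrightarrow> Q u u 0"
    and "\<And>u v w k. (u, v) \<in> parcs G \<Longrightarrow> Q v w k \<Longrightarrow> Q u w (Suc k)"
    and "\<And>u v i j. Q u v i \<Longrightarrow> i \<le> j \<Longrightarrow> Q u v j"
  shows "Q u v k"
proof -
  obtain p where p: "awalk u p v" "length p \<le> k" using assms(1) by (auto simp: joined_def)
  have "Q u v (length p)"
    using p(1)
  proof (induction p arbitrary: u)
    case Nil
    then show ?case using assms(2)[of v] by (auto simp: awalk_Nil_iff)
  next
    case (Cons e p)
    then show ?case using assms(3)[of u "snd e" v "length p"] by (cases e) (simp add: awalk_Cons_iff)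
  qed
  then show ?thesis using assms(4) p(2) by blast
qed

lemma joined_sym:
  assumes "\<And>u v. (u, v) \<in> parcs G \<Longrightarrow> (v, u) \<in> parcs G" "joined G u v k"
  shows "joined G v u k"
  using assms(2)
proof (induction rule: joined_induct)
  case (step u v w k)
  then show ?case using joined_trans[OF step(2) joined_arc[OF assms(1)[OF step(1)]]] by simp
qed (auto intro: joined_refl joined_mono)

lemma awalk_cost_one: "awalk_cost (\<lambda>_. 1) p = real (length p)"
  by (induction p) simp_all

lemma graph_dist_le: "joined G u v k \<Longrightarrow> graph_dist G u v \<le> ereal (real k)"
proof -
  assume "joined G u v k"
  then obtain p where p: "awalk u p v" "length p \<le> k" by (auto simp: joined_def)
  have "graph_dist G u v \<le> ereal (awalk_cost (\<lambda>_. 1) p)"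
    unfolding graph_dist_def using p(1) by (rule min_cost_le_walk_cost)
  also have "\<dots> \<le> ereal (real k)" using p(2) by (simp add: awalk_cost_one)
  finally show ?thesis .
qed

text \<open>Walk lengths are natural numbers, so their infimum is attained unless there is no walk
  and it is infinite.\<close>

lemma graph_dist_cases:
  obtains "graph_dist G u v = \<infinity>" | n where "graph_dist G u v = ereal (real n)" "joined G u v n"
proof (cases "\<exists>p. awalk u p v")
  case False
  then have "graph_dist G u v = \<infinity>"
    unfolding graph_dist_def \<mu>_def by (simp add: top_ereal_def)
  then show thesis by (rule that(1))
next
  case True
  define n where "n = (LEAST n. \<exists>p. awalk u p v \<and> length p = n)"
  have "\<exists>n p. awalk u p v \<and> length p = n" using True by blast
  from LeastI_ex[OF this, folded n_def] obtain p where p: "awalk u p v" "length p = n" by blast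
  have "n \<le> length q" if "awalk u q v" for q
    unfolding n_def using that by (intro Least_le) blast
  then have "ereal (real n) \<le> graph_dist G u v"
    unfolding graph_dist_def \<mu>_def by (intro INF_greatest) (simp add: awalk_cost_one)
  moreover have j: "joined G u v n" using p by (auto simp: joined_def)
  ultimately have "graph_dist G u v = ereal (real n)" using graph_dist_le[OF j] by simp
  then show thesis using j by (rule that(2))
qed

end

text \<open>The lower estimate is assumed without constants, because it will come from a projection
  that does not increase distances. Infinite distances are covered too: a walk in one graph gives a
  walk in the other.\<close>

lemma quasi_isometric_graphsI:
  assumes G: "pair_wf_digraph G" and H: "pair_wf_digraph H"
    and f: "\<And>u. u \<in> pverts G \<Longrightarrow> f u \<in> pverts H" and L: "1 \<le> L"
    and upper: "\<And>u v n. u \<in> pverts G \<Longrightarrow> v \<in> pverts G \<Longrightarrow> joined G u v n \<Longrightarrow>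
      joined H (f u) (f v) (n * L + C)"
    and lower: "\<And>u v n. u \<in> pverts G \<Longrightarrow> v \<in> pverts G \<Longrightarrow> joined H (f u) (f v) n \<Longrightarrow>
      joined G u v n"
    and dense: "\<And>w. w \<in> pverts H \<Longrightarrow> \<exists>u\<in>pverts G. joined H (f u) w C"
  shows "quasi_isometric_graphs G H"
proof -
  interpret G: pair_wf_digraph G by (rule G)
  interpret H: pair_wf_digraph H by (rule H)
  let ?d = "graph_dist G" and ?e = "graph_dist H" and ?L = "real L" and ?C = "real C"
  have "?d u v / ereal ?L - ereal ?C \<le> ?e (f u) (f v)" if uv: "u \<in> pverts G" "v \<in> pverts G" for u v
  proof (rule H.graph_dist_cases[of "f u" "f v"])
    fix n assume n: "?e (f u) (f v) = ereal (real n)" "joined H (f u) (f v) n"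
    then have j: "joined G u v n" using lower uv by simp
    show ?thesis
    proof (rule G.graph_dist_cases[of u v])
      assume "?d u v = \<infinity>"
      then show ?thesis using G.graph_dist_le[OF j] by simp
    next
      fix k assume k: "?d u v = ereal (real k)"
      then have "real k \<le> real n" using G.graph_dist_le[OF j] by simp
      moreover have "real k / ?L \<le> real k"
        using L mult_right_mono[of 1 "real L" "real k"] by (simp add: field_simps)
      ultimately show ?thesis using L by (simp add: k n(1))
    qed
  qed simp
  moreover have "?e (f u) (f v) \<le> ereal ?L * ?d u v + ereal ?C"
    if uv: "u \<in> pverts G" "v \<in> pverts G" for u v
  proof (rule G.graph_dist_cases[of u v])
    fix n assume n: "?d u v = ereal (real n)" "joined G u v n"
    then show ?thesis using H.graph_dist_le[OF upper[OF uv n(2)]] by (simp add: mult.commute)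
  qed (use L in simp)
  moreover have "\<exists>u\<in>pverts G. ?e (f u) w \<le> ereal ?C" if "w \<in> pverts H" for w
    using dense[OF that] H.graph_dist_le by blast
  ultimately have "quasi_isometry (pverts G) ?d (pverts H) ?e f"
    unfolding quasi_isometry_def using f L
    by (intro conjI exI[of _ ?L] exI[of _ ?C]) auto
  then show ?thesis unfolding quasi_isometric_graphs_def by blast
qed

lemma parcs_mk_symmetric_pair:
  "parcs (mk_symmetric (with_proj \<lparr>pverts = V, parcs = E\<rparr>)) = E \<union> E\<inverse>"
  by (auto simp: parcs_mk_symmetric)

lemma pair_wf_mk_symmetric:
  "E \<subseteq> V \<times> V \<Longrightarrow> pair_wf_digraph (mk_symmetric (with_proj \<lparr>pverts = V, parcs = E\<rparr>))"
  by unfold_locales (auto simp: parcs_mk_symmetric_pair)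

text \<open>The first arc of a walk from \<open>s\<close> to another vertex leads to such a
  \<open>t\<close>.\<close>

lemma irreducible_type_neighbour:
  assumes "irreducible_type S m" "s \<in> S" "2 \<le> card S" "coxeter_matrix S m"
  shows "\<exists>t\<in>S. s \<noteq> t \<and> m s t \<noteq> 2"
proof -
  define E where "E = {(s, t). s \<in> S \<and> t \<in> S \<and> s \<noteq> t \<and> 3 \<le> m s t}"
  \<comment> \<open>\<open>connected\<close> symmetrizes its argument once more, hence the doubled
    \<open>mk_symmetric\<close>.\<close>
  let ?H = "mk_symmetric (with_proj (mk_symmetric (with_proj \<lparr>pverts = S, parcs = E\<rparr>)))"
  have H: "coxeter_graph S m = mk_symmetric (with_proj \<lparr>pverts = S, parcs = E\<rparr>)"
    by (simp add: coxeter_graph_def E_def)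
  have arcs: "parcs ?H = E \<union> E\<inverse>" by (auto simp: parcs_mk_symmetric)
  have "E \<union> E\<inverse> \<subseteq> S \<times> S" by (auto simp: E_def)
  then interpret H: pair_wf_digraph ?H
    by unfold_locales (auto simp only: arcs pverts_mk_symmetric with_proj_simps pair_pre_digraph.simps fst_conv snd_conv)
  have "S \<noteq> {s}" using assms(3) by auto
  then obtain r where r: "r \<in> S" "r \<noteq> s" using assms(2) by auto
  have "s \<rightarrow>\<^sup>*\<^bsub>with_proj ?H\<^esub> r"
    using assms(1,2) r unfolding irreducible_type_def Digraph_Component.connected_def H strongly_connected_def
    by auto
  then obtain p where p: "H.awalk s p r" unfolding H.reachable_awalk by blast
  then obtain e q where "p = e # q" using r by (cases p) (auto simp: H.awalk_Nil_iff)
  then have "e \<in> parcs ?H" "s = fst e" using p by (auto simp: H.awalk_Cons_iff)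
  then obtain t where t: "t \<in> S" "s \<noteq> t" "3 \<le> m s t \<or> 3 \<le> m t s"
    unfolding arcs by (cases e) (auto simp: E_def)
  moreover have "m t s = m s t" using assms t by (simp add: coxeter_matrix_def)
  ultimately show ?thesis by (intro bexI[of _ t]) auto
qed

context finite_coxeter
begin

section \<open>Comparison of the Cayley graph and the additional length graph\<close>

abbreviation Cay :: "('a \<times> bool) list set pair_pre_digraph" where
  "Cay \<equiv> cayley_graph A (X_abs S m)"

abbreviation AL :: "('a \<times> bool) list set set pair_pre_digraph" where
  "AL \<equiv> additional_length_graph S m"

abbreviation Z :: "('a \<times> bool) list set set" where "Z \<equiv> generate A {\<Delta>}"

lemma Z_eq: "Z = range (\<lambda>k::int. \<Delta> [^]\<^bsub>A\<^esub> k)"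
  using A.generate_pow[of \<Delta>] by auto

lemma subgroup_Z: "subgroup Z A"
  using A.generate_is_subgroup[of "{\<Delta>}"] by simp

lemma coset_eq: "a <#\<^bsub>A\<^esub> Z = range (\<lambda>k::int. a \<otimes>\<^bsub>A\<^esub> \<Delta> [^]\<^bsub>A\<^esub> k)"
  unfolding l_coset_def Z_eq by auto

lemma X_abs_closed: "X_abs S m \<subseteq> carrier A"
proof -
  have "generate A {garside S m [^]\<^bsub>A\<^esub> (2::nat)} \<subseteq> carrier A"
    by (intro A.generate_incl) (simp add: garside_eq)
  then show ?thesis by (auto simp: X_abs_def absorbable_elements_def)
qed

lemma parcs_Cay: "parcs Cay = {(a, a \<otimes>\<^bsub>A\<^esub> x) | a x. a \<in> carrier A \<and> x \<in> X_abs S m} \<union>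
    {(a, a \<otimes>\<^bsub>A\<^esub> x) | a x. a \<in> carrier A \<and> x \<in> X_abs S m}\<inverse>"
  unfolding cayley_graph_def parcs_mk_symmetric_pair ..

lemma pverts_Cay [simp]: "pverts Cay = carrier A"
  by (simp add: cayley_graph_def)

definition AL_arcs :: "(('a \<times> bool) list set set \<times> ('a \<times> bool) list set set) set" where
  "AL_arcs = {(a <#\<^bsub>A\<^esub> Z, b <#\<^bsub>A\<^esub> Z) | a b. a \<in> carrier A \<and> b \<in> carrier A \<and>
    (\<exists>u \<in> simple_elements S m \<union> absorbable_elements S m. a \<otimes>\<^bsub>A\<^esub> u \<in> b <#\<^bsub>A\<^esub> Z)}"

lemma AL_eq: "AL = mk_symmetric (with_proj \<lparr>pverts = lcosets\<^bsub>A\<^esub> Z, parcs = AL_arcs\<rparr>)"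
  by (simp add: additional_length_graph_def AL_arcs_def garside_eq Let_def)

lemma parcs_AL: "parcs AL = AL_arcs \<union> AL_arcs\<inverse>"
  unfolding AL_eq parcs_mk_symmetric_pair ..

lemma pverts_AL [simp]: "pverts AL = lcosets\<^bsub>A\<^esub> Z"
  by (simp add: AL_eq)

sublocale Cay: pair_wf_digraph Cay
  unfolding cayley_graph_def using X_abs_closed by (intro pair_wf_mk_symmetric) auto

sublocale AL: pair_wf_digraph AL
  unfolding AL_eq by (intro pair_wf_mk_symmetric) (auto simp: AL_arcs_def LCOSETS_def)

lemma Cay_sym: "joined Cay a b k \<Longrightarrow> joined Cay b a k"
  by (rule Cay.joined_sym[rotated]) (auto simp: parcs_Cay)

text \<open>Word length at most \<open>k\<close> over \<open>X_abs\<close> and its inverses, stated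
  at every base point so that left invariance of the Cayley graph is built in.\<close>

definition bounded :: "nat \<Rightarrow> ('a \<times> bool) list set \<Rightarrow> bool" where
  "bounded k x \<longleftrightarrow> x \<in> carrier A \<and> (\<forall>a\<in>carrier A. joined Cay a (a \<otimes>\<^bsub>A\<^esub> x) k)"

lemma bounded_one: "bounded k \<one>\<^bsub>A\<^esub>"
  by (simp add: bounded_def Cay.joined_refl)

lemma bounded_mono:
  assumes "bounded i x" "i \<le> j"
  shows "bounded j x"
  unfolding bounded_def
proof (intro conjI ballI)
  show "x \<in> carrier A" using assms(1) by (simp add: bounded_def)
  fix a assume "a \<in> carrier A"
  then have "joined Cay a (a \<otimes>\<^bsub>A\<^esub> x) i" using assms(1) by (simp add: bounded_def)
  then show "joined Cay a (a \<otimes>\<^bsub>A\<^esub> x) j" using assms(2) by (rule joined_mono)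
qed

lemma bounded_mult:
  assumes "bounded i x" "bounded j y"
  shows "bounded (i + j) (x \<otimes>\<^bsub>A\<^esub> y)"
  unfolding bounded_def
proof (intro conjI ballI)
  have xy: "x \<in> carrier A" "y \<in> carrier A" using assms by (simp_all add: bounded_def)
  then show "x \<otimes>\<^bsub>A\<^esub> y \<in> carrier A" by simp
  fix a assume a: "a \<in> carrier A"
  then have "joined Cay a (a \<otimes>\<^bsub>A\<^esub> x) i" using assms by (simp add: bounded_def)
  moreover have "joined Cay (a \<otimes>\<^bsub>A\<^esub> x) (a \<otimes>\<^bsub>A\<^esub> x \<otimes>\<^bsub>A\<^esub> y) j"
    using assms a xy by (simp add: bounded_def del: A.m_assoc)
  ultimately show "joined Cay a (a \<otimes>\<^bsub>A\<^esub> (x \<otimes>\<^bsub>A\<^esub> y)) (i + j)"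
    using Cay.joined_trans a xy by (simp add: A.m_assoc)
qed

lemma bounded_inv:
  assumes "bounded k x"
  shows "bounded k (inv\<^bsub>A\<^esub> x)"
  unfolding bounded_def
proof (intro conjI ballI)
  have x: "x \<in> carrier A" using assms by (simp add: bounded_def)
  then show "inv\<^bsub>A\<^esub> x \<in> carrier A" by simp
  fix a assume a: "a \<in> carrier A"
  then have "joined Cay (a \<otimes>\<^bsub>A\<^esub> inv\<^bsub>A\<^esub> x) (a \<otimes>\<^bsub>A\<^esub> inv\<^bsub>A\<^esub> x \<otimes>\<^bsub>A\<^esub> x) k"
    using assms x by (simp add: bounded_def)
  then show "joined Cay a (a \<otimes>\<^bsub>A\<^esub> inv\<^bsub>A\<^esub> x) k"
    using a x Cay_sym by (simp add: A.m_assoc)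
qed

lemma bounded_X_abs: "x \<in> X_abs S m \<Longrightarrow> bounded 1 x"
  unfolding bounded_def
proof (intro conjI ballI Cay.joined_arc)
  assume x: "x \<in> X_abs S m"
  then show "x \<in> carrier A" using X_abs_closed by blast
  show "(a, a \<otimes>\<^bsub>A\<^esub> x) \<in> parcs Cay" if "a \<in> carrier A" for a
    using x that unfolding parcs_Cay by blast
qed

lemma bounded_absorbable: "x \<in> absorbable_elements S m \<Longrightarrow> bounded 1 x"
  by (rule bounded_X_abs) (simp add: X_abs_def)

context
  assumes card_S: "2 \<le> card S"
    and neighbour: "\<And>s. s \<in> S \<Longrightarrow> \<exists>t\<in>S. s \<noteq> t \<and> m s t \<noteq> 2"
    and commuting: "3 \<le> card S \<Longrightarrow> \<exists>s\<in>S. \<exists>t\<in>S. s \<noteq> t \<and> m s t = 2"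
begin

lemma bounded_P: "w \<in> lists S \<Longrightarrow> bounded (length w) (P w)"
proof (induction w rule: list.induct)
  case Nil
  then show ?case by (simp add: positive_element_Nil bounded_one)
next
  case (Cons s w)
  then obtain t where "t \<in> S" "s \<noteq> t" "m s t \<noteq> 2" using neighbour[of s] by auto
  then have "bounded 1 (P [s])" using Cons by (intro bounded_absorbable absorbable_gen) simp_all
  then show ?case using bounded_mult[of 1 "P [s]" "length w" "P w"] Cons P_append[of "[s]" w] by simp
qed

lemma bounded_simple: "u \<in> simple_elements S m \<Longrightarrow> bounded (length delta) u"
proof -
  assume "u \<in> simple_elements S m"
  then obtain w where w: "w \<in> lists S" "u = P w" "positive_prefix S m (P w) \<Delta>"
    by (auto simp: simple_elements_def positive_monoid_eq garside_eq)
  then obtain y where "delta \<approx> w @ y" by (auto simp: positive_prefix_iff)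
  then have "length w \<le> length delta" using braid_eq_length by fastforce
  then show ?thesis using bounded_P[OF w(1)] w bounded_mono by blast
qed

text \<open>The bound must not depend on \<open>k\<close>; it covers both
  \<open>1 + length delta\<close> in the dihedral case and 3 otherwise.\<close>

lemma bounded_delta_pow: "bounded (3 + length delta) (\<Delta> [^]\<^bsub>A\<^esub> (k::int))"
proof (cases "card S = 2")
  case True
  \<comment> \<open>The even part is a single element of \<open>X_abs\<close>; at most one factor
    \<Delta> remains.\<close>
  have eq: "\<Delta> [^]\<^bsub>A\<^esub> k = (\<Delta> [^]\<^bsub>A\<^esub> (2::nat)) [^]\<^bsub>A\<^esub> (k div 2) \<otimes>\<^bsub>A\<^esub> \<Delta> [^]\<^bsub>A\<^esub> (k mod 2)"
    using A.int_pow_mult[of \<Delta> "2 * (k div 2)" "k mod 2"] A.int_pow_pow[of \<Delta> 2 "k div 2"]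
      int_pow_int[of A \<Delta> 2] by simp
  have "(\<Delta> [^]\<^bsub>A\<^esub> (2::nat)) [^]\<^bsub>A\<^esub> (k div 2) \<in> X_abs S m"
    using True A.generate_pow[of "\<Delta> [^]\<^bsub>A\<^esub> (2::nat)"] by (auto simp: X_abs_def dihedral_type_def garside_eq)
  then have "bounded 1 ((\<Delta> [^]\<^bsub>A\<^esub> (2::nat)) [^]\<^bsub>A\<^esub> (k div 2))" by (rule bounded_X_abs)
  moreover have "bounded (length delta) (\<Delta> [^]\<^bsub>A\<^esub> (k mod 2))"
  proof (cases "k mod 2 = 0")
    case True
    then show ?thesis by (simp add: bounded_one)
  next
    case False
    then have "k mod 2 = 1" by presburger
    then show ?thesis using bounded_P[of delta] by (simp add: A.int_pow_1)
  qed
  ultimately have "bounded (1 + length delta) (\<Delta> [^]\<^bsub>A\<^esub> k)" unfolding eq by (rule bounded_mult)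
  then show ?thesis by (rule bounded_mono) simp
next
  case False
  then have card: "3 \<le> card S" using card_S by simp
  then obtain s t where st: "s \<in> S" "t \<in> S" "s \<noteq> t" "m s t = 2" using commuting by blast
  have nat: "bounded 3 (\<Delta> [^]\<^bsub>A\<^esub> n)" for n :: nat
  proof (cases "n = 0")
    case False
    then obtain x y z where xyz: "x \<in> absorbable_elements S m" "y \<in> absorbable_elements S m"
      "z \<in> absorbable_elements S m" and eq: "\<Delta> [^]\<^bsub>A\<^esub> n = x \<otimes>\<^bsub>A\<^esub> y \<otimes>\<^bsub>A\<^esub> z"
      using delta_pow_absorbable[OF st card, of n] by blast
    have "bounded (1 + 1 + 1) (x \<otimes>\<^bsub>A\<^esub> y \<otimes>\<^bsub>A\<^esub> z)"
      using xyz by (intro bounded_mult bounded_absorbable)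
    then show ?thesis by (simp add: eq numeral_3_eq_3)
  qed (simp add: bounded_one)
  have "bounded 3 (\<Delta> [^]\<^bsub>A\<^esub> k)"
  proof (cases "0 \<le> k")
    case True
    then obtain n where "k = int n" by (metis zero_le_imp_eq_int)
    then show ?thesis using nat by (simp add: int_pow_int)
  next
    case False
    then obtain n where "k = - int n" by (metis linear minus_minus neg_0_le_iff_le zero_le_imp_eq_int)
    then show ?thesis using bounded_inv[OF nat[of n]] by (simp add: A.int_pow_neg_int)
  qed
  then show ?thesis by (rule bounded_mono) simp
qed

text \<open>A radius: it bounds the distance from the representative \<open>a\<close>, and
  \<open>joined_same_coset\<close> uses it twice.\<close>

definition coset_diam :: nat where "coset_diam = 3 + length delta"

lemma joined_coset:
  assumes "a \<in> carrier A" "x \<in> a <#\<^bsub>A\<^esub> Z"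
  shows "joined Cay a x coset_diam"
  using assms bounded_delta_pow unfolding coset_eq bounded_def coset_diam_def by blast

lemma joined_same_coset:
  assumes "a \<in> carrier A" "x \<in> a <#\<^bsub>A\<^esub> Z" "y \<in> a <#\<^bsub>A\<^esub> Z"
  shows "joined Cay x y (coset_diam + coset_diam)"
  using assms Cay_sym joined_coset Cay.joined_trans by metis

text \<open>\<open>Suc (length delta)\<close> covers a simple or an absorbable \<open>u\<close>; two
  changes of representative, one at each end, cost \<open>2 * coset_diam\<close> each.\<close>

definition step_length :: nat where "step_length = Suc (length delta) + 4 * coset_diam"

lemma joined_AL_arc:
  assumes "(X, Y) \<in> AL_arcs" "x \<in> X" "y \<in> Y"
  shows "joined Cay x y step_length"
proof -
  obtain a b u where ab: "a \<in> carrier A" "b \<in> carrier A" "X = a <#\<^bsub>A\<^esub> Z" "Y = b <#\<^bsub>A\<^esub> Z"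
    and u: "u \<in> simple_elements S m \<union> absorbable_elements S m" "a \<otimes>\<^bsub>A\<^esub> u \<in> b <#\<^bsub>A\<^esub> Z"
    using assms(1) unfolding AL_arcs_def by blast
  have a: "a \<in> a <#\<^bsub>A\<^esub> Z" using A.lcos_self[OF ab(1) subgroup_Z] .
  from u(1) have "bounded (Suc (length delta)) u"
  proof
    assume "u \<in> simple_elements S m"
    then show ?thesis by (intro bounded_mono[OF bounded_simple]) simp_all
  next
    assume "u \<in> absorbable_elements S m"
    then show ?thesis by (intro bounded_mono[OF bounded_absorbable]) simp_all
  qed
  then have au: "joined Cay a (a \<otimes>\<^bsub>A\<^esub> u) (Suc (length delta))" using ab(1) by (simp add: bounded_def)
  have xa: "joined Cay x a (coset_diam + coset_diam)"
    using joined_same_coset[OF ab(1) _ a] assms(2) unfolding ab(3) .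
  have uy: "joined Cay (a \<otimes>\<^bsub>A\<^esub> u) y (coset_diam + coset_diam)"
    using joined_same_coset[OF ab(2) u(2)] assms(3) unfolding ab(4) .
  note Cay.joined_trans[OF Cay.joined_trans[OF xa au] uy]
  then show ?thesis by (rule joined_mono) (simp add: step_length_def)
qed

lemma coset_nonempty:
  assumes "X \<in> lcosets\<^bsub>A\<^esub> Z"
  shows "\<exists>a\<in>carrier A. a \<in> X \<and> X = a <#\<^bsub>A\<^esub> Z"
  using assms A.lcos_self[OF _ subgroup_Z] by (auto simp: LCOSETS_def)

text \<open>The summand \<open>2 * coset_diam\<close> is for walks of length 0, whose ends may be
  different elements of one coset. The induction runs over all choices of \<open>x\<close> and
  \<open>y\<close>, since the intermediate cosets have no preferred element.\<close>

lemma joined_of_AL: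
  assumes "joined AL X Y n" "x \<in> X" "y \<in> Y"
  shows "joined Cay x y (n * step_length + 2 * coset_diam)"
proof -
  have "\<forall>x\<in>X. \<forall>y\<in>Y. joined Cay x y (n * step_length + 2 * coset_diam)"
    using assms(1)
  proof (induction rule: AL.joined_induct)
    case (refl X)
    then show ?case using coset_nonempty[of X] joined_same_coset by (auto simp: mult_2)
  next
    case (step X Y W k)
    show ?case
    proof (intro ballI)
      fix x w assume xw: "x \<in> X" "w \<in> W"
      have "Y \<in> lcosets\<^bsub>A\<^esub> Z" using step(1) AL.in_arcsD2 by fastforce
      then obtain y where y: "y \<in> Y" using coset_nonempty by blast
      have "joined Cay x y step_length"
        using step(1) joined_AL_arc xw(1) y Cay_sym by (auto simp: parcs_AL)
      moreover have "joined Cay y w (k * step_length + 2 * coset_diam)" using step(2) y xw(2) by blast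
      ultimately have "joined Cay x w (step_length + (k * step_length + 2 * coset_diam))"
        by (rule Cay.joined_trans)
      then show "joined Cay x w (Suc k * step_length + 2 * coset_diam)" by (simp add: add.assoc)
    qed
  next
    case (mono X Y i j)
    have "i * step_length + 2 * coset_diam \<le> j * step_length + 2 * coset_diam" using mono(2) by simp
    then show ?case using mono(1) joined_mono[of Cay _ _ "i * step_length + 2 * coset_diam"] by metis
  qed
  then show ?thesis using assms by blast
qed

text \<open>An absorbable \<open>x\<close> gives an arc by definition; a power of the square of
  \<Delta> stays in the coset.\<close>

lemma AL_of_X_abs:
  assumes a: "a \<in> carrier A" and x: "x \<in> X_abs S m"
  shows "joined AL (a <#\<^bsub>A\<^esub> Z) ((a \<otimes>\<^bsub>A\<^esub> x) <#\<^bsub>A\<^esub> Z) 1"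
    "joined AL ((a \<otimes>\<^bsub>A\<^esub> x) <#\<^bsub>A\<^esub> Z) (a <#\<^bsub>A\<^esub> Z) 1"
proof -
  have ax: "a \<otimes>\<^bsub>A\<^esub> x \<in> carrier A" using a x X_abs_closed by auto
  have self: "a \<otimes>\<^bsub>A\<^esub> x \<in> (a \<otimes>\<^bsub>A\<^esub> x) <#\<^bsub>A\<^esub> Z" using A.lcos_self[OF ax subgroup_Z] .
  have "joined AL (a <#\<^bsub>A\<^esub> Z) ((a \<otimes>\<^bsub>A\<^esub> x) <#\<^bsub>A\<^esub> Z) 1 \<and>
    joined AL ((a \<otimes>\<^bsub>A\<^esub> x) <#\<^bsub>A\<^esub> Z) (a <#\<^bsub>A\<^esub> Z) 1"
  proof (cases "x \<in> absorbable_elements S m")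
    case True
    then have "(a <#\<^bsub>A\<^esub> Z, (a \<otimes>\<^bsub>A\<^esub> x) <#\<^bsub>A\<^esub> Z) \<in> AL_arcs"
      unfolding AL_arcs_def using a ax self by blast
    then show ?thesis by (intro conjI AL.joined_arc) (simp_all add: parcs_AL)
  next
    case False
    then have "x \<in> generate A {\<Delta> [^]\<^bsub>A\<^esub> (2::nat)}"
      using x by (simp add: X_abs_def garside_eq split: if_splits)
    moreover have "\<Delta> [^]\<^bsub>A\<^esub> (2::nat) \<in> Z"
      unfolding Z_eq using int_pow_int[of A \<Delta> 2] by (metis rangeI)
    ultimately have "x \<in> Z"
      using A.generate_subgroup_incl[of "{\<Delta> [^]\<^bsub>A\<^esub> (2::nat)}" Z] subgroup_Z by auto
    then have "a \<otimes>\<^bsub>A\<^esub> x \<in> a <#\<^bsub>A\<^esub> Z" by (auto simp: l_coset_def)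
    then have "a <#\<^bsub>A\<^esub> Z = (a \<otimes>\<^bsub>A\<^esub> x) <#\<^bsub>A\<^esub> Z"
      using A.l_repr_independence a subgroup_Z by blast
    moreover have "a <#\<^bsub>A\<^esub> Z \<in> lcosets\<^bsub>A\<^esub> Z" using a by (auto simp: LCOSETS_def)
    ultimately show ?thesis by (auto intro: AL.joined_refl)
  qed
  then show "joined AL (a <#\<^bsub>A\<^esub> Z) ((a \<otimes>\<^bsub>A\<^esub> x) <#\<^bsub>A\<^esub> Z) 1"
    "joined AL ((a \<otimes>\<^bsub>A\<^esub> x) <#\<^bsub>A\<^esub> Z) (a <#\<^bsub>A\<^esub> Z) 1" by blast+
qed

lemma AL_of_joined:
  assumes "joined Cay a b n"
  shows "joined AL (a <#\<^bsub>A\<^esub> Z) (b <#\<^bsub>A\<^esub> Z) n"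
  using assms
proof (induction rule: Cay.joined_induct)
  case (refl a)
  then show ?case by (intro AL.joined_refl) (auto simp: LCOSETS_def)
next
  case (step a b c k)
  then have "joined AL (a <#\<^bsub>A\<^esub> Z) (b <#\<^bsub>A\<^esub> Z) 1" using AL_of_X_abs by (auto simp: parcs_Cay)
  from AL.joined_trans[OF this step(2)] show ?case by simp
next
  case (mono a b i j)
  then show ?case by (rule joined_mono)
qed

text \<open>The map is a section of the projection to cosets: \<open>joined_of_AL\<close> is the
  upper estimate, and \<open>AL_of_joined\<close>, saying that the projection does not increase
  distances, is the lower one.\<close>

theorem quasi_isometric_AL_Cay: "quasi_isometric_graphs AL Cay"
proof (rule quasi_isometric_graphsI[where f = "\<lambda>X. SOME x. x \<in> X" and L = step_length and C = "2 * coset_diam"])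
  let ?f = "\<lambda>X. SOME x. x \<in> X"
  have f: "?f X \<in> X" if "X \<in> lcosets\<^bsub>A\<^esub> Z" for X
    using coset_nonempty[OF that] someI_ex[of "\<lambda>x. x \<in> X"] by blast
  have fc: "?f X \<in> carrier A" if "X \<in> lcosets\<^bsub>A\<^esub> Z" for X
    using f[OF that] that A.lcosets_part_G[OF subgroup_Z] by blast
  have f_coset: "?f X <#\<^bsub>A\<^esub> Z = X" if "X \<in> lcosets\<^bsub>A\<^esub> Z" for X
    using coset_nonempty[OF that] A.l_repr_independence[OF _ _ subgroup_Z] f[OF that] by metis
  show "pair_wf_digraph AL" "pair_wf_digraph Cay" by unfold_locales
  show "?f X \<in> pverts Cay" if "X \<in> pverts AL" for X using that fc by simp
  show "1 \<le> step_length" by (simp add: step_length_def)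
  fix X Y n assume XY: "X \<in> pverts AL" "Y \<in> pverts AL"
  show "joined Cay (?f X) (?f Y) (n * step_length + 2 * coset_diam)" if "joined AL X Y n"
    using joined_of_AL[OF that] f XY by simp
  show "joined AL X Y n" if "joined Cay (?f X) (?f Y) n"
    using AL_of_joined[OF that] f_coset XY by simp
next
  let ?f = "\<lambda>X. SOME x. x \<in> X"
  fix a assume "a \<in> pverts Cay"
  then have a: "a \<in> carrier A" by simp
  let ?X = "a <#\<^bsub>A\<^esub> Z"
  have "a \<in> ?X" using A.lcos_self[OF a subgroup_Z] .
  then have "?f ?X \<in> ?X" by (rule someI)
  then have "joined Cay (?f ?X) a (2 * coset_diam)"
    using joined_same_coset[OF a] \<open>a \<in> ?X\<close> by (simp add: mult_2)
  then show "\<exists>X\<in>pverts AL. joined Cay (?f X) a (2 * coset_diam)"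
    using a by (intro bexI[of _ ?X]) (auto simp: LCOSETS_def)
qed

end

end

theorem lemma4p6:
  fixes S :: "'a set" and m :: "'a \<Rightarrow> 'a \<Rightarrow> enat"
  assumes "coxeter_matrix S m"
    and "2 \<le> card S"
    and "irreducible_type S m"
    and "spherical_type S m"
  shows "quasi_isometric_graphs (additional_length_graph S m)
    (cayley_graph (artin_group S m) (X_abs S m))"
proof -
  interpret T: coxeter_type S m by (rule coxeter_type.intro[OF assms(1)])
  have fin: "finite (carrier T.reflection_group)" by (rule T.finite_reflection_group[OF assms(4)])
  have "S \<noteq> {}" using assms(2) by auto
  then have W: "finite_coxeter T.reflection_group S m T.reflection"
    by (rule T.finite_coxeter_reflection_group[OF fin])
  show ?thesis
    by (rule finite_coxeter.quasi_isometric_AL_Cay[OF W assms(2)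
        irreducible_type_neighbour[OF assms(3) _ assms(2,1)] T.commuting_pair[OF fin]])
qed

end
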